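(* Let $X$ be a simplicial complex. For $n\geq 1$ there exist cellular decompositions of $X^n$, $\mathrm{SP}^nX$ and $\mathrm{Sub}_nX$ such that all of the quotient maps $X^n\to \mathrm{SP}^nX\to \mathrm{Sub}_nX$ are cellular, and such that the concatenation pairings $+$ in the commutative diagram formed by $$+:\mathrm{SP}^rX\times \mathrm{SP}^sX\to \mathrm{SP}^{r+s}X,\qquad +:\mathrm{Sub}_rX\times \mathrm{Sub}_sX\to \mathrm{Sub}_{r+s}X$$ and the vertical quotient maps $\mathrm{SP}^rX\times \mathrm{SP}^sX\to \mathrm{Sub}_rX\times \mathrm{Sub}_sX$ and $\mathrm{SP}^{r+s}X\to \mathrm{Sub}_{r+s}X$ are cellular. Furthermore the subspaces $\mathbf{\Delta}^n\subset \mathrm{SP}^nX$, $\mathrm{SP}^{n-1}X\subset \mathrm{SP}^nX$ and $\mathrm{Sub}_{n-1}X\subset \mathrm{Sub}_nX$ are subcomplexes.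
   Context: All spaces are path connected, paracompact, and have a chosen basepoint $x_0$. $\mathrm{SP}^nX=X^n/\mathfrak S_n$ is the $n$-th symmetric product, with elements $[x_1,\ldots,x_n]$. $\mathrm{Sub}_nX$ is the space of nonempty finite subsets of $X$ of cardinality at most $n$, with the quotient topology from $X^n$ (two $n$-tuples are identified if and only if their sets of coordinates coincide); the map $X^n\to \mathrm{Sub}_nX$ factors through $\mathrm{SP}^nX$ via $[x_1,\ldots,x_n]\mapsto\{x_1,\ldots,x_n\}$. $\mathrm{SP}^{n-1}X$ is embedded in $\mathrm{SP}^nX$ by $[x_1,\dots,x_{n-1}]\mapsto[x_1,\dots,x_{n-1},x_0]$, and $\mathrm{Sub}_{n-1}X$ is naturally included in $\mathrm{Sub}_nX$. $\mathbf{\Delta}^n\subset \mathrm{SP}^nX$ is the image of the fat diagonal of $X^n$, i.e. the set of $[x_1,\ldots,x_n]$ with $x_i=x_j$ for some $i\neq j$. The concatenation pairings are $([x_1,\dots,x_r],[y_1,\dots,y_s])\mapsto[x_1,\dots,x_r,y_1,\dots,y_s]$ and $(S,T)\mapsto S\cup T$.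
   Formalization: The products X^n, SP^rX×SP^sX and Sub_rX×Sub_sX carry the compactly generated topology; with the ordinary product topology the claim fails, e.g. for a star with continuum many edges (Dowker), and where it holds the topologies agree. *)

theory Defs
  imports "HOL-Analysis.Analysis" "HOL-Library.Multiset" "HOL-Combinatorics.Permutations"
begin

text \<open>The notion \<open>simplicial_complex\<close> of HOL-Analysis only covers finite complexes embedded in a
  Euclidean space; here complexes are arbitrary. Simplices are given by their vertex sets.\<close>

definition abstract_complex :: "'v set set \<Rightarrow> bool" where
  "abstract_complex K \<longleftrightarrow>
     (\<forall>\<sigma>\<in>K. finite \<sigma> \<and> \<sigma> \<noteq> {} \<and> (\<forall>\<tau>. \<tau> \<subseteq> \<sigma> \<and> \<tau> \<noteq> {} \<longrightarrow> \<tau> \<in> K))"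

definition closed_face :: "'v set \<Rightarrow> ('v \<Rightarrow> real) set" where
  "closed_face \<sigma> = {x. (\<forall>v. 0 \<le> x v) \<and> (\<forall>v. v \<notin> \<sigma> \<longrightarrow> x v = 0) \<and> sum x \<sigma> = 1}"

text \<open>Points are given by barycentric coordinates. The topology is the weak one: each closed
  simplex has its Euclidean topology, and a set is open iff its trace on each simplex is.\<close>

definition geometric_realization :: "'v set set \<Rightarrow> ('v \<Rightarrow> real) topology" where
  "geometric_realization K = topology (\<lambda>U. U \<subseteq> (\<Union>\<sigma>\<in>K. closed_face \<sigma>) \<and>
     (\<forall>\<sigma>\<in>K. openin (subtopology (powertop_real UNIV) (closed_face \<sigma>)) (closed_face \<sigma> \<inter> U)))"

lemma openin_geometric_realization:
  "openin (geometric_realization K) U \<longleftrightarrow> U \<subseteq> (\<Union>\<sigma>\<in>K. closed_face \<sigma>) \<and>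
     (\<forall>\<sigma>\<in>K. openin (subtopology (powertop_real UNIV) (closed_face \<sigma>)) (closed_face \<sigma> \<inter> U))"
proof -
  have "istopology (\<lambda>U. U \<subseteq> (\<Union>\<sigma>\<in>K. closed_face \<sigma>) \<and>
     (\<forall>\<sigma>\<in>K. openin (subtopology (powertop_real UNIV) (closed_face \<sigma>)) (closed_face \<sigma> \<inter> U)))"
    unfolding istopology_def
  proof (intro conjI allI impI ballI; (elim conjE)?)
    fix S T \<sigma>
    assume "\<forall>\<sigma>\<in>K. openin (subtopology (powertop_real UNIV) (closed_face \<sigma>)) (closed_face \<sigma> \<inter> S)"
      "\<forall>\<sigma>\<in>K. openin (subtopology (powertop_real UNIV) (closed_face \<sigma>)) (closed_face \<sigma> \<inter> T)" "\<sigma> \<in> K"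
    then have "openin (subtopology (powertop_real UNIV) (closed_face \<sigma>))
        ((closed_face \<sigma> \<inter> S) \<inter> (closed_face \<sigma> \<inter> T))"
      by (intro openin_Int[of _ "closed_face \<sigma> \<inter> S" "closed_face \<sigma> \<inter> T"]) auto
    then show "openin (subtopology (powertop_real UNIV) (closed_face \<sigma>)) (closed_face \<sigma> \<inter> (S \<inter> T))"
      by (simp add: Int_ac)
  next
    fix \<U> \<sigma>
    assume U: "\<forall>U\<in>\<U>. U \<subseteq> (\<Union>\<sigma>\<in>K. closed_face \<sigma>) \<and>
      (\<forall>\<sigma>\<in>K. openin (subtopology (powertop_real UNIV) (closed_face \<sigma>)) (closed_face \<sigma> \<inter> U))"
      and "\<sigma> \<in> K"
    then have "openin (subtopology (powertop_real UNIV) (closed_face \<sigma>)) (\<Union>U\<in>\<U>. closed_face \<sigma> \<inter> U)"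
      by (intro openin_Union) auto
    then show "openin (subtopology (powertop_real UNIV) (closed_face \<sigma>)) (closed_face \<sigma> \<inter> \<Union>\<U>)"
      by (simp only: Int_Union)
  qed blast+
  then show ?thesis
    by (simp add: geometric_realization_def)
qed

lemma topspace_geometric_realization [simp]:
  "topspace (geometric_realization K) = (\<Union>\<sigma>\<in>K. closed_face \<sigma>)"
proof -
  have "openin (geometric_realization K) (\<Union>\<sigma>\<in>K. closed_face \<sigma>)"
    unfolding openin_geometric_realization
  proof (intro conjI ballI)
    fix \<sigma> assume "\<sigma> \<in> K"
    then have "closed_face \<sigma> \<inter> (\<Union>\<sigma>\<in>K. closed_face \<sigma>) = closed_face \<sigma>" by blast
    then show "openin (subtopology (powertop_real UNIV) (closed_face \<sigma>))
        (closed_face \<sigma> \<inter> (\<Union>\<sigma>\<in>K. closed_face \<sigma>))"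
      by (simp add: openin_subtopology_refl)
  qed simp
  then show ?thesis
    by (meson openin_geometric_realization openin_subset openin_topspace subset_antisym)
qed

definition disk :: "nat \<Rightarrow> (nat \<Rightarrow> real) topology" where
  "disk k = subtopology (Euclidean_space k) {x. (\<Sum>i<k. (x i)\<^sup>2) \<le> 1}"

definition open_disk :: "nat \<Rightarrow> (nat \<Rightarrow> real) set" where
  "open_disk k = {x \<in> topspace (disk k). (\<Sum>i<k. (x i)\<^sup>2) < 1}"

definition disk_boundary :: "nat \<Rightarrow> (nat \<Rightarrow> real) set" where
  "disk_boundary k = {x \<in> topspace (disk k). (\<Sum>i<k. (x i)\<^sup>2) = 1}"

text \<open>A cell decomposition is given by a family \<open>E\<close> where \<open>E k\<close> is the set of open \<open>k\<close>-cells.\<close>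

definition skeleton :: "(nat \<Rightarrow> 'a set set) \<Rightarrow> nat \<Rightarrow> 'a set" where
  "skeleton E k = (\<Union>j\<le>k. \<Union>(E j))"

definition characteristic_map ::
    "'a topology \<Rightarrow> (nat \<Rightarrow> 'a set set) \<Rightarrow> nat \<Rightarrow> 'a set \<Rightarrow> ((nat \<Rightarrow> real) \<Rightarrow> 'a) \<Rightarrow> bool" where
  "characteristic_map X E k e \<phi> \<longleftrightarrow>
     continuous_map (disk k) X \<phi> \<and>
     homeomorphic_map (subtopology (disk k) (open_disk k)) (subtopology X e) \<phi> \<and>
     (\<exists>F. finite F \<and> F \<subseteq> (\<Union>j<k. E j) \<and> \<phi> ` disk_boundary k \<subseteq> \<Union>F)"

definition cell_decomposition :: "'a topology \<Rightarrow> (nat \<Rightarrow> 'a set set) \<Rightarrow> bool" where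
  "cell_decomposition X E \<longleftrightarrow>
     Hausdorff_space X \<and>
     (\<Union>k. \<Union>(E k)) = topspace X \<and>
     (\<forall>j k. \<forall>e\<in>E j. \<forall>f\<in>E k. e \<inter> f \<noteq> {} \<longrightarrow> j = k \<and> e = f) \<and>
     (\<forall>k. \<forall>e\<in>E k. \<exists>\<phi>. characteristic_map X E k e \<phi>) \<and>
     (\<forall>A\<subseteq>topspace X. (\<forall>k. \<forall>e\<in>E k. closedin X (A \<inter> X closure_of e)) \<longrightarrow> closedin X A)"

definition cellular_map ::
    "'a topology \<Rightarrow> (nat \<Rightarrow> 'a set set) \<Rightarrow> 'b topology \<Rightarrow> (nat \<Rightarrow> 'b set set) \<Rightarrow> ('a \<Rightarrow> 'b) \<Rightarrow> bool" where
  "cellular_map X E Y F f \<longleftrightarrow>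
     continuous_map X Y f \<and> (\<forall>k. f ` skeleton E k \<subseteq> skeleton F k)"

definition subcomplex :: "'a topology \<Rightarrow> (nat \<Rightarrow> 'a set set) \<Rightarrow> 'a set \<Rightarrow> bool" where
  "subcomplex X E A \<longleftrightarrow> closedin X A \<and> (\<exists>F. (\<forall>k. F k \<subseteq> E k) \<and> A = (\<Union>k. \<Union>(F k)))"

definition product_cells ::
    "(nat \<Rightarrow> 'a set set) \<Rightarrow> (nat \<Rightarrow> 'b set set) \<Rightarrow> nat \<Rightarrow> ('a \<times> 'b) set set" where
  "product_cells E F k = {e \<times> f | e f i j. e \<in> E i \<and> f \<in> F j \<and> i + j = k}"

text \<open>As usual for CW complexes, products carry the compactly generated topology. For the plain
  product topology a product of two infinite complexes need not be a CW complex (Dowker); whenever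
  the plain product is a k-space, e.g. if the complexes are countable or locally finite,
  the two topologies agree.\<close>

definition k_prod_topology :: "'a topology \<Rightarrow> 'b topology \<Rightarrow> ('a \<times> 'b) topology" where
  "k_prod_topology X Y = kification (prod_topology X Y)"

definition cartesian_power :: "nat \<Rightarrow> 'a topology \<Rightarrow> (nat \<Rightarrow> 'a) topology" where
  "cartesian_power n X = kification (product_topology (\<lambda>_. X) {..<n})"

lemma topspace_cartesian_power [simp]:
  "topspace (cartesian_power n X) = (\<Pi>\<^sub>E i\<in>{..<n}. topspace X)"
  by (simp add: cartesian_power_def)

text \<open>Quotient topology on the set \<open>C\<close> with respect to a map from the space \<open>X\<close>.\<close>

definition quotient_topology :: "'a topology \<Rightarrow> ('a \<Rightarrow> 'b) \<Rightarrow> 'b set \<Rightarrow> 'b topology" where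
  "quotient_topology X q C = topology (\<lambda>U. U \<subseteq> C \<and> openin X {x \<in> topspace X. q x \<in> U})"

lemma openin_quotient_topology:
  "openin (quotient_topology X q C) U \<longleftrightarrow> U \<subseteq> C \<and> openin X {x \<in> topspace X. q x \<in> U}"
proof -
  have "istopology (\<lambda>U. U \<subseteq> C \<and> openin X {x \<in> topspace X. q x \<in> U})"
    unfolding istopology_def
  proof (intro conjI allI impI; (elim conjE)?)
    fix S T
    assume "openin X {x \<in> topspace X. q x \<in> S}" "openin X {x \<in> topspace X. q x \<in> T}"
    moreover have "{x \<in> topspace X. q x \<in> S \<inter> T} =
        {x \<in> topspace X. q x \<in> S} \<inter> {x \<in> topspace X. q x \<in> T}" by blast
    ultimately show "openin X {x \<in> topspace X. q x \<in> S \<inter> T}"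
      by (simp only: openin_Int)
  next
    fix \<U>
    assume "\<forall>U\<in>\<U>. U \<subseteq> C \<and> openin X {x \<in> topspace X. q x \<in> U}"
    moreover have "{x \<in> topspace X. q x \<in> \<Union>\<U>} = (\<Union>U\<in>\<U>. {x \<in> topspace X. q x \<in> U})" by blast
    ultimately show "openin X {x \<in> topspace X. q x \<in> \<Union>\<U>}" by auto
  qed blast+
  then show ?thesis
    by (simp add: quotient_topology_def)
qed

lemma topspace_quotient_topology:
  assumes "q ` topspace X \<subseteq> C"
  shows "topspace (quotient_topology X q C) = C"
proof -
  have "{x \<in> topspace X. q x \<in> C} = topspace X" using assms by blast
  then have "openin (quotient_topology X q C) C"
    by (simp add: openin_quotient_topology)
  then show ?thesis
    by (meson openin_quotient_topology openin_subset openin_topspace subset_antisym)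
qed

lemma quotient_map_quotient_topology:
  assumes "q ` topspace X = C"
  shows "quotient_map X (quotient_topology X q C) q"
  using assms by (auto simp: quotient_map_def topspace_quotient_topology openin_quotient_topology)

text \<open>An element \<open>[x\<^sub>1,\<dots>,x\<^sub>n]\<close> of the \<open>n\<close>-th symmetric product is a multiset of size \<open>n\<close>;
  by \<open>unordered_eq_iff\<close> below these are exactly the orbits of \<open>n\<close>-tuples under permutations.\<close>

definition unordered :: "nat \<Rightarrow> (nat \<Rightarrow> 'a) \<Rightarrow> 'a multiset" where
  "unordered n x = image_mset x (mset_set {..<n})"

definition SP :: "nat \<Rightarrow> 'a topology \<Rightarrow> 'a multiset topology" where
  "SP n X = quotient_topology (cartesian_power n X) (unordered n)
     {A. size A = n \<and> set_mset A \<subseteq> topspace X}"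

definition Sub :: "nat \<Rightarrow> 'a topology \<Rightarrow> 'a set topology" where
  "Sub n X = quotient_topology (cartesian_power n X) (\<lambda>x. x ` {..<n})
     {S. S \<subseteq> topspace X \<and> S \<noteq> {} \<and> finite S \<and> card S \<le> n}"

definition fat_diagonal :: "nat \<Rightarrow> 'a topology \<Rightarrow> (nat \<Rightarrow> 'a) set" where
  "fat_diagonal n X = {x \<in> topspace (cartesian_power n X). \<exists>i<n. \<exists>j<n. i \<noteq> j \<and> x i = x j}"

lemma unordered_eq_iff:
  "unordered n x = unordered n y \<longleftrightarrow> (\<exists>p. p permutes {..<n} \<and> (\<forall>i<n. x i = y (p i)))"
proof
  assume "unordered n x = unordered n y"
  then have "image_mset x (mset_set {..<n}) = image_mset y (mset_set {..<n})"
    by (simp only: unordered_def)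
  from image_mset_eq_implies_permutes[OF finite_lessThan this]
  obtain p where "p permutes {..<n}" "\<forall>i\<in>{..<n}. x i = y (p i)" .
  then show "\<exists>p. p permutes {..<n} \<and> (\<forall>i<n. x i = y (p i))"
    by blast
next
  assume "\<exists>p. p permutes {..<n} \<and> (\<forall>i<n. x i = y (p i))"
  then obtain p where p: "p permutes {..<n}" "\<forall>i<n. x i = y (p i)" by blast
  then have "unordered n x = image_mset (y \<circ> p) (mset_set {..<n})"
    unfolding unordered_def by (intro image_mset_cong) auto
  also have "\<dots> = image_mset y (image_mset p (mset_set {..<n}))"
    by (simp add: multiset.map_comp)
  also have "image_mset p (mset_set {..<n}) = mset_set {..<n}"
    using p(1) by (simp add: image_mset_mset_set permutes_inj_on permutes_image)
  finally show "unordered n x = unordered n y"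
    by (simp add: unordered_def)
qed

lemma set_mset_unordered: "set_mset (unordered n x) = x ` {..<n}"
  by (simp add: unordered_def)

lemma image_unordered:
  "unordered n ` topspace (cartesian_power n X) = {A. size A = n \<and> set_mset A \<subseteq> topspace X}"
proof (intro equalityI subsetI)
  fix A assume "A \<in> {A. size A = n \<and> set_mset A \<subseteq> topspace X}"
  moreover obtain xs where xs: "A = mset xs" by (metis ex_mset)
  ultimately have len: "length xs = n" and sub: "set xs \<subseteq> topspace X" by auto
  let ?x = "restrict ((!) xs) {..<n}"
  have "unordered n ?x = image_mset ((!) xs) (mset_set {..<n})"
    unfolding unordered_def by (intro image_mset_cong) auto
  also have "\<dots> = mset xs"
    using len map_nth[of xs] by (simp flip: mset_map mset_upt add: lessThan_atLeast0)
  finally have "A = unordered n ?x" using xs by simp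
  moreover have "?x \<in> topspace (cartesian_power n X)"
    using len sub by (auto simp: PiE_iff)
  ultimately show "A \<in> unordered n ` topspace (cartesian_power n X)" by blast
next
  fix A assume "A \<in> unordered n ` topspace (cartesian_power n X)"
  then obtain x where "x \<in> topspace (cartesian_power n X)" "A = unordered n x" by blast
  then show "A \<in> {A. size A = n \<and> set_mset A \<subseteq> topspace X}"
    by (auto simp: set_mset_unordered PiE_iff) (simp add: unordered_def)
qed

lemma quotient_map_SP: "quotient_map (cartesian_power n X) (SP n X) (unordered n)"
  unfolding SP_def by (rule quotient_map_quotient_topology) (rule image_unordered)

lemma topspace_SP [simp]: "topspace (SP n X) = {A. size A = n \<and> set_mset A \<subseteq> topspace X}"
  unfolding SP_def by (rule topspace_quotient_topology) (simp only: image_unordered order_refl)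

lemma image_Sub:
  assumes "1 \<le> n"
  shows "(\<lambda>x. x ` {..<n}) ` topspace (cartesian_power n X) =
    {S. S \<subseteq> topspace X \<and> S \<noteq> {} \<and> finite S \<and> card S \<le> n}"
proof (intro equalityI subsetI)
  fix S assume "S \<in> {S. S \<subseteq> topspace X \<and> S \<noteq> {} \<and> finite S \<and> card S \<le> n}"
  then have S: "S \<subseteq> topspace X" "S \<noteq> {}" "finite S" "card S \<le> n" by auto
  obtain h where h: "bij_betw h {0..<card S} S"
    using ex_bij_betw_nat_finite S(3) by blast
  let ?x = "\<lambda>i\<in>{..<n}. if i < card S then h i else h 0"
  have pos: "0 < card S" using S by (simp add: card_gt_0_iff)
  have "S = ?x ` {..<n}"
  proof (intro equalityI subsetI)
    fix s assume "s \<in> S"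
    then obtain i where i: "i < card S" "s = h i"
      using h by (force simp: bij_betw_def)
    moreover from i have "i < n" using S(4) by simp
    ultimately show "s \<in> ?x ` {..<n}" by (intro image_eqI[of _ _ i]) auto
  next
    fix s assume "s \<in> ?x ` {..<n}"
    then show "s \<in> S" using h pos by (auto simp: bij_betw_def split: if_splits)
  qed
  moreover from calculation have "?x \<in> topspace (cartesian_power n X)"
    using S(1) by (auto simp: PiE_iff)
  ultimately show "S \<in> (\<lambda>x. x ` {..<n}) ` topspace (cartesian_power n X)" by blast
next
  fix S assume "S \<in> (\<lambda>x. x ` {..<n}) ` topspace (cartesian_power n X)"
  then obtain x where x: "x \<in> topspace (cartesian_power n X)" "S = x ` {..<n}" by blast
  have "card S \<le> n" using x(2) card_image_le[of "{..<n}" x] by simp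
  then show "S \<in> {S. S \<subseteq> topspace X \<and> S \<noteq> {} \<and> finite S \<and> card S \<le> n}"
    using x assms by (auto simp: PiE_iff lessThan_empty_iff)
qed

lemma quotient_map_Sub:
  "1 \<le> n \<Longrightarrow> quotient_map (cartesian_power n X) (Sub n X) (\<lambda>x. x ` {..<n})"
  unfolding Sub_def by (rule quotient_map_quotient_topology) (rule image_Sub)

lemma topspace_Sub [simp]:
  "topspace (Sub n X) = {S. S \<subseteq> topspace X \<and> S \<noteq> {} \<and> finite S \<and> card S \<le> n}"
proof (cases "1 \<le> n")
  case True
  then show ?thesis
    unfolding Sub_def by (intro topspace_quotient_topology) (simp only: image_Sub order_refl)
next
  case False
  have "topspace (Sub n X) \<subseteq> {S. S \<subseteq> topspace X \<and> S \<noteq> {} \<and> finite S \<and> card S \<le> n}"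
    using openin_topspace[of "Sub n X"] unfolding Sub_def openin_quotient_topology by simp
  moreover have "{S. S \<subseteq> topspace X \<and> S \<noteq> {} \<and> finite S \<and> card S \<le> n} = {}"
    using False by (auto simp: not_less_eq_eq)
  ultimately show ?thesis by simp
qed

end

theory Submission
  imports Defs
begin


text \<open>Order the vertices of the complex. A point of a simplex with vertices
  \<open>v\<^sub>0 < \<dots> < v\<^sub>d\<close> then cuts the unit interval into consecutive pieces, the \<open>i\<close>-th one labelled
  \<open>v\<^sub>i\<close> and as long as the \<open>i\<close>-th barycentric coordinate; the right endpoints of the pieces are the
  \<^emph>\<open>jumps\<close> of the point. For finitely many points, the union of their jumps is a common refinement of
  all these subdivisions, and over each of its pieces every one of the points has a constant label.
  So a finite family of points amounts to a point of an open simplex (the lengths of the pieces of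
  the refinement) together with one weakly increasing word of vertices for each member of the
  family, subject to the condition that at each break some word changes. Fixing the words and
  varying the lengths gives the open cells. For tuples this is the usual triangulation of a product
  of ordered simplicial complexes by chains in the product order.

  The point of this description is that jumps are attached to the \<^emph>\<open>set\<close> of points alone, and that
  two members of a family coincide iff their words do. Hence the same construction describes
  \<open>X\<^sup>n\<close>, its quotient by permutations and its quotient by equality of coordinate sets, the quotient
  maps sending cells onto cells of the same dimension; a permutation that preserves a cell fixes it
  pointwise, because it preserves the jumps and hence the lengths. The dimension of the cell through
  a family \<open>S\<close> is one less than the number of jumps of \<open>S\<close>. Every nonempty family has the jump \<open>1\<close>, so the
  dimension is subadditive under unions, which makes both concatenation pairings cellular.
  Loci defined by coincidences of coordinates (the fat diagonal, tuples having few distinct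
  entries) are unions of cells because coincidence only depends on the words.

  This argument is \<open>cell_decomposition_cells\<close> in the locale \<open>tuple_quotient\<close>; it rests on
  \<open>common_decomposition\<close> (the words exist), \<open>partial_sums_determine\<close> and \<open>word_determined\<close> (they are
  unique). The quotients are Hausdorff because symmetric functions of the coordinates, namely
  sums and maxima of a continuous function, separate their points. The weak topology condition
  and the continuity of the pairings on compactly generated products both reduce to compact
  sets, which meet only finitely many cells.

  It remains to make the basepoint a vertex: the complex is replaced by its star
  subdivision at the basepoint. The construction only needs to know a bijection from a geometric
  complex onto \<open>X\<close> that is continuous on closed simplices, together with a bound on the simplices
  that meet a compact set; this is the locale \<open>triangulated_space\<close>, and it spares a comparison of the
  two weak topologies.\<close>

section \<open>Compact sets, compactly generated products\<close>

lemma Hausdorff_space_functions: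
  assumes "\<And>x y. x \<in> topspace X \<Longrightarrow> y \<in> topspace X \<Longrightarrow> x \<noteq> y \<Longrightarrow>
             \<exists>f. continuous_map X euclideanreal f \<and> f x \<noteq> f y"
  shows "Hausdorff_space X"
  unfolding Hausdorff_space_def
proof (intro allI impI, elim conjE)
  fix x y assume xy: "x \<in> topspace X" "y \<in> topspace X" "x \<noteq> y"
  then obtain f where f: "continuous_map X euclideanreal f" "f x \<noteq> f y"
    using assms by blast
  from hausdorff[OF f(2)] obtain U V where UV: "open U" "open V" "f x \<in> U" "f y \<in> V" "U \<inter> V = {}"
    by blast
  have "openin X {z \<in> topspace X. f z \<in> U}" "openin X {z \<in> topspace X. f z \<in> V}"
    using f(1) UV(1,2) by (auto intro: openin_continuous_map_preimage)
  then show "\<exists>U V. openin X U \<and> openin X V \<and> x \<in> U \<and> y \<in> V \<and> disjnt U V"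
    using xy UV by (intro exI[of _ "{z \<in> topspace X. f z \<in> U}"] exI[of _ "{z \<in> topspace X. f z \<in> V}"])
      (auto simp: disjnt_def)
qed

lemma homeomorphic_map_compact_restriction:
  assumes "continuous_map D Y \<phi>" "compact_space D" "Hausdorff_space Y"
    and "U \<subseteq> topspace D" "inj_on \<phi> U" "\<phi> ` (topspace D - U) \<inter> \<phi> ` U = {}"
  shows "homeomorphic_map (subtopology D U) (subtopology Y (\<phi> ` U)) \<phi>"
proof -
  have im: "\<phi> ` U \<subseteq> topspace Y"
    using assms(1,4) by (auto simp: continuous_map_def)
  have U: "U = {x \<in> topspace D. \<phi> x \<in> \<phi> ` U}"
    using assms(4,6) by blast
  have "closed_map D Y \<phi>"
    using assms by (intro continuous_imp_closed_map)
  then have "closed_map (subtopology D U) (subtopology Y (\<phi> ` U)) \<phi>"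
    by (rule closed_map_restriction) (use U in simp)
  moreover have "continuous_map (subtopology D U) (subtopology Y (\<phi> ` U)) \<phi>"
    using assms(1) by (simp add: continuous_map_in_subtopology continuous_map_from_subtopology)
  ultimately show ?thesis
    using assms(4,5) im
    by (intro bijective_closed_imp_homeomorphic_map) (auto simp: Int_absorb1)
qed

text \<open>Choose one point of the compact set for each label. Every subset of the set of chosen points meets
  each of the sets in \<open>\<C>\<close> in finitely many points, so it is closed; thus the chosen points form a
  closed discrete set, and such a subset of a compact set is finite. The labels are supports of
  barycentric coordinates in one application and open cells in the other.\<close>

lemma compactin_finite_labels:
  assumes Y: "t1_space Y" and C: "compactin Y C"
    and weak: "\<And>A. A \<subseteq> topspace Y \<Longrightarrow> (\<And>c. c \<in> \<C> \<Longrightarrow> closedin Y (A \<inter> c)) \<Longrightarrow> closedin Y A"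
    and fin: "\<And>c. c \<in> \<C> \<Longrightarrow> finite (f ` (c \<inter> topspace Y))"
  shows "finite (f ` C)"
proof (rule ccontr)
  assume inf: "infinite (f ` C)"
  obtain Z where Z: "Z \<subseteq> C" "inj_on f Z" "f ` C = f ` Z"
    using subset_image_inj[of "f ` C" f C] by auto
  have CY: "C \<subseteq> topspace Y" using C by (rule compactin_subset_topspace)
  have closed: "closedin Y Z'" if "Z' \<subseteq> Z" for Z'
  proof (rule weak)
    show "Z' \<subseteq> topspace Y" using that Z(1) CY by blast
    fix c assume c: "c \<in> \<C>"
    have "f ` (Z' \<inter> c) \<subseteq> f ` (c \<inter> topspace Y)"
      using \<open>Z' \<subseteq> topspace Y\<close> by blast
    then have "finite (f ` (Z' \<inter> c))"
      using fin[OF c] finite_subset by blast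
    then have "finite (Z' \<inter> c)"
      by (rule finite_imageD) (use Z(2) that in \<open>auto intro: inj_on_subset\<close>)
    then show "closedin Y (Z' \<inter> c)"
      using Y \<open>Z' \<subseteq> topspace Y\<close> by (auto simp: t1_space_closedin_finite)
  qed
  have "infinite Z" using inf Z(3) by auto
  then have "C \<inter> Y derived_set_of Z \<noteq> {}"
    using C Z(1) by (intro compactin_imp_Bolzano_Weierstrass) auto
  then obtain z where z: "z \<in> Y derived_set_of Z" by blast
  have "openin Y (topspace Y - (Z - {z}))"
    using closed[of "Z - {z}"] by (auto intro: openin_diff)
  moreover have "z \<in> topspace Y - (Z - {z})"
    using z by (auto simp: derived_set_of_def)
  ultimately obtain y where "y \<noteq> z" "y \<in> Z" "y \<in> topspace Y - (Z - {z})"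
    using z in_derived_set_of[of z Y Z] by metis
  then show False by blast
qed

lemma continuous_map_Max:
  fixes f :: "'i \<Rightarrow> 'a \<Rightarrow> real"
  assumes "finite I" "I \<noteq> {}" "\<And>i. i \<in> I \<Longrightarrow> continuous_map X euclideanreal (f i)"
  shows "continuous_map X euclideanreal (\<lambda>x. Max ((\<lambda>i. f i x) ` I))"
  using assms
proof (induction I rule: finite_ne_induct)
  case (singleton i)
  then show ?case by simp
next
  case (insert i I)
  then show ?case
    by (simp add: continuous_map_real_max)
qed

text \<open>Products do not preserve quotient maps, but a map out of a compactly generated space only has to be
  continuous on compact sets. If compact sets lift along both factors, then each compact set of the
  product is covered by the image of a product of two compact sets, and a continuous map from a compact
  space to a Hausdorff space is a quotient map onto its image.\<close>

lemma continuous_map_from_k_prod: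
  assumes "Hausdorff_space Y1" "Hausdorff_space Y2"
    and q1: "continuous_map A1 Y1 q1" and q2: "continuous_map A2 Y2 q2"
    and cov1: "\<And>C. compactin Y1 C \<Longrightarrow> \<exists>L. compactin A1 L \<and> C \<subseteq> q1 ` L"
    and cov2: "\<And>C. compactin Y2 C \<Longrightarrow> \<exists>L. compactin A2 L \<and> C \<subseteq> q2 ` L"
    and g: "continuous_map (k_prod_topology A1 A2) Z (\<lambda>(a, b). g (q1 a, q2 b))"
  shows "continuous_map (k_prod_topology Y1 Y2) Z g"
proof (rule continuous_map_from_k_space)
  show "k_space (k_prod_topology Y1 Y2)"
    by (simp add: k_prod_topology_def)
  fix C assume "compactin (k_prod_topology Y1 Y2) C"
  then have C: "compactin (prod_topology Y1 Y2) C"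
    by (simp add: k_prod_topology_def)
  have "compactin Y1 (fst ` C)" "compactin Y2 (snd ` C)"
    using image_compactin[OF C continuous_map_fst] image_compactin[OF C continuous_map_snd] by auto
  then obtain L1 L2 where L: "compactin A1 L1" "fst ` C \<subseteq> q1 ` L1" "compactin A2 L2" "snd ` C \<subseteq> q2 ` L2"
    using cov1[of "fst ` C"] cov2[of "snd ` C"] by auto
  define L where "L = L1 \<times> L2"
  define Q where "Q = map_prod q1 q2"
  have cL: "compactin (prod_topology A1 A2) L"
    unfolding L_def using L by (auto simp: compactin_Times)
  have Q: "continuous_map (prod_topology A1 A2) (prod_topology Y1 Y2) Q"
  proof -
    have "continuous_map (prod_topology A1 A2) Y1 (\<lambda>p. q1 (fst p))"
      "continuous_map (prod_topology A1 A2) Y2 (\<lambda>p. q2 (snd p))"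
      using continuous_map_compose[OF continuous_map_fst q1] continuous_map_compose[OF continuous_map_snd q2]
      by (auto simp: comp_def)
    then show ?thesis
      by (simp add: Q_def map_prod_def continuous_map_pairwise comp_def case_prod_unfold)
  qed
  have CQL: "C \<subseteq> Q ` L"
  proof
    fix p assume "p \<in> C"
    then have "fst p \<in> q1 ` L1" "snd p \<in> q2 ` L2" using L by auto
    then show "p \<in> Q ` L" unfolding Q_def L_def
      by (cases p) (auto intro!: image_eqI)
  qed
  let ?A = "subtopology (prod_topology A1 A2) L" and ?Y = "subtopology (prod_topology Y1 Y2) (Q ` L)"
  have LA: "L \<subseteq> topspace (prod_topology A1 A2)" using cL by (rule compactin_subset_topspace)
  have "quotient_map ?A ?Y Q"
  proof (rule continuous_imp_quotient_map)
    show "continuous_map ?A ?Y Q"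
      using Q by (simp add: continuous_map_in_subtopology continuous_map_from_subtopology)
    show "compact_space ?A" using cL by (simp add: compact_space_subtopology)
    show "Hausdorff_space ?Y" using assms(1,2)
      by (simp add: Hausdorff_space_subtopology Hausdorff_space_prod_topology)
    show "Q ` topspace ?A = topspace ?Y"
    proof -
      have "Q ` L \<subseteq> topspace (prod_topology Y1 Y2)"
        using LA Q by (auto simp only: continuous_map_def)
      then show ?thesis using LA by (simp only: topspace_subtopology Int_absorb1)
    qed
  qed
  moreover have "continuous_map ?A Z (g \<circ> Q)"
  proof -
    have "continuous_map (subtopology (k_prod_topology A1 A2) L) Z (\<lambda>(a, b). g (q1 a, q2 b))"
      using g by (rule continuous_map_from_subtopology)
    moreover have "(\<lambda>(a, b). g (q1 a, q2 b)) = g \<circ> Q" by (auto simp: Q_def)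
    moreover have "subtopology (k_prod_topology A1 A2) L = ?A"
      unfolding k_prod_topology_def using cL by (rule subtopology_kification_compact)
    ultimately show ?thesis by simp
  qed
  ultimately have "continuous_map ?Y Z g"
    by (rule continuous_compose_quotient_map)
  then have "continuous_map (subtopology (prod_topology Y1 Y2) C) Z g"
    using CQL by (rule continuous_map_from_subtopology_mono)
  then show "continuous_map (subtopology (k_prod_topology Y1 Y2) C) Z g"
    unfolding k_prod_topology_def using C by (simp add: subtopology_kification_compact)
qed

lemma continuous_map_k_prod_map_prod:
  assumes "continuous_map X X' f" "continuous_map Y Y' g"
  shows "continuous_map (k_prod_topology X Y) (k_prod_topology X' Y') (map_prod f g)"
  unfolding k_prod_topology_def
proof (rule continuous_map_kification)
  have "continuous_map (prod_topology X Y) X' (\<lambda>p. f (fst p))"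
    "continuous_map (prod_topology X Y) Y' (\<lambda>p. g (snd p))"
    using continuous_map_compose[OF continuous_map_fst assms(1)] continuous_map_compose[OF continuous_map_snd assms(2)]
    by (auto simp: comp_def)
  then show "continuous_map (prod_topology X Y) (prod_topology X' Y') (map_prod f g)"
    by (simp add: map_prod_def continuous_map_pairwise comp_def case_prod_unfold)
qed

section \<open>A parametrization of the simplex by the disk\<close>

text \<open>Coordinates of the hyperplane of vectors with sum \<open>0\<close> in dimension \<open>k + 1\<close>: the last one is determined
  by the others. The standard simplex lies in its translate by the barycentre \<open>(1/(k+1), \<dots>, 1/(k+1))\<close>.\<close>

definition simplex_coord :: "nat \<Rightarrow> (nat \<Rightarrow> real) \<Rightarrow> nat \<Rightarrow> real" where
  "simplex_coord k x i = (if i < k then x i else - (\<Sum>j<k. x j))"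

text \<open>The Minkowski gauge of the simplex, translated so that its barycentre becomes the origin.\<close>

definition simplex_gauge :: "nat \<Rightarrow> (nat \<Rightarrow> real) \<Rightarrow> real" where
  "simplex_gauge k x = real (Suc k) * Max ((\<lambda>i. - simplex_coord k x i) ` {..k})"

definition radius :: "nat \<Rightarrow> (nat \<Rightarrow> real) \<Rightarrow> real" where
  "radius k x = sqrt (\<Sum>i<k. (x i)\<^sup>2)"

text \<open>The radial map that rescales each ray so that the Euclidean norm becomes the gauge. At the origin
  both vanish, and the convention \<open>0 / 0 = 0\<close> gives the barycentre.\<close>

definition disk_to_simplex :: "nat \<Rightarrow> (nat \<Rightarrow> real) \<Rightarrow> nat \<Rightarrow> real" where
  "disk_to_simplex k x i = 1 / real (Suc k) + simplex_coord k x i * radius k x / simplex_gauge k x"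

definition open_simplex :: "nat \<Rightarrow> (nat \<Rightarrow> real) set" where
  "open_simplex k = {s. (\<forall>j\<le>k. 0 < s j) \<and> sum s {..k} = 1}"

definition closed_simplex :: "nat \<Rightarrow> (nat \<Rightarrow> real) set" where
  "closed_simplex k = {s. (\<forall>j\<le>k. 0 \<le> s j) \<and> sum s {..k} = 1}"

lemma sum_simplex_coord: "(\<Sum>i\<le>k. simplex_coord k x i) = 0"
proof -
  have "(\<Sum>i\<le>k. simplex_coord k x i) = (\<Sum>i<k. simplex_coord k x i) + simplex_coord k x k"
    by (simp flip: lessThan_Suc_atMost)
  also have "(\<Sum>i<k. simplex_coord k x i) = (\<Sum>i<k. x i)"
    by (intro sum.cong) (auto simp: simplex_coord_def)
  finally show ?thesis by (simp add: simplex_coord_def)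
qed

lemma simplex_gauge_ge: "i \<le> k \<Longrightarrow> - simplex_coord k x i \<le> simplex_gauge k x / real (Suc k)"
  by (auto simp: simplex_gauge_def intro!: Max_ge)

lemma simplex_gauge_attained: "\<exists>i\<le>k. - simplex_coord k x i = simplex_gauge k x / real (Suc k)"
proof -
  have "Max ((\<lambda>i. - simplex_coord k x i) ` {..k}) \<in> (\<lambda>i. - simplex_coord k x i) ` {..k}"
    by (intro Max_in) auto
  then obtain i where "i \<le> k" "Max ((\<lambda>i. - simplex_coord k x i) ` {..k}) = - simplex_coord k x i"
    by blast
  then show ?thesis by (intro exI[of _ i]) (simp add: simplex_gauge_def)
qed

lemma simplex_gauge_unique:
  assumes "\<And>i. i \<le> k \<Longrightarrow> - simplex_coord k x i \<le> g / real (Suc k)"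
    and "\<exists>i\<le>k. - simplex_coord k x i = g / real (Suc k)"
  shows "simplex_gauge k x = g"
proof -
  obtain i where i: "i \<le> k" "- simplex_coord k x i = simplex_gauge k x / real (Suc k)"
    using simplex_gauge_attained by blast
  obtain j where j: "j \<le> k" "- simplex_coord k x j = g / real (Suc k)"
    using assms(2) by blast
  have "simplex_gauge k x / real (Suc k) = g / real (Suc k)"
    using assms(1)[OF i(1)] simplex_gauge_ge[OF j(1), of x] i(2) j(2) by linarith
  then show ?thesis by simp
qed

lemma simplex_gauge_scale:
  assumes "0 \<le> c"
  shows "simplex_gauge k (\<lambda>i. c * x i) = c * simplex_gauge k x"
proof (rule simplex_gauge_unique)
  have *: "simplex_coord k (\<lambda>i. c * x i) i = c * simplex_coord k x i" for i
    by (simp add: simplex_coord_def sum_distrib_left)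
  show "- simplex_coord k (\<lambda>i. c * x i) i \<le> c * simplex_gauge k x / real (Suc k)" if "i \<le> k" for i
    using mult_left_mono[OF simplex_gauge_ge[OF that, of x] assms] by (simp add: *)
  obtain i where "i \<le> k" "- simplex_coord k x i = simplex_gauge k x / real (Suc k)"
    using simplex_gauge_attained by blast
  then show "\<exists>i\<le>k. - simplex_coord k (\<lambda>i. c * x i) i = c * simplex_gauge k x / real (Suc k)"
    by (intro exI[of _ i]) (simp add: * flip: mult_minus_right)
qed

text \<open>All coordinates are at least \<open>- g/(k+1)\<close>, where \<open>g\<close> is the gauge; as they sum to \<open>0\<close>, each of them is at most
  \<open>k g/(k+1)\<close>.\<close>

lemma simplex_coord_abs_le: 
  assumes "i \<le> k" 
  shows "\<bar>simplex_coord k x i\<bar> \<le> simplex_gauge k x"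
proof -
  define m where "m = simplex_gauge k x / real (Suc k)"
  have ge: "- simplex_coord k x j \<le> m" if "j \<le> k" for j
    using simplex_gauge_ge[OF that] by (simp add: m_def)
  have "0 = (\<Sum>j\<le>k. - simplex_coord k x j)"
    by (simp add: sum_negf sum_simplex_coord)
  also have "\<dots> \<le> (\<Sum>j\<le>k. m)" by (intro sum_mono ge) auto
  finally have "0 \<le> real (Suc k) * m" by simp
  then have m0: "0 \<le> m" by (simp add: zero_le_mult_iff)
  have "(\<Sum>j\<le>k. - simplex_coord k x j) = - simplex_coord k x i + (\<Sum>j\<in>{..k}-{i}. - simplex_coord k x j)"
    using assms by (simp add: sum.remove)
  moreover have "(\<Sum>j\<in>{..k}-{i}. - simplex_coord k x j) \<le> (\<Sum>j\<in>{..k}-{i}. m)"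
    by (intro sum_mono ge) auto
  moreover have "(\<Sum>j\<in>{..k}-{i}. m) = real k * m"
    using assms by (simp add: card_Diff_singleton)
  ultimately have "simplex_coord k x i \<le> real k * m"
    using \<open>0 = _\<close> by linarith
  moreover have "simplex_gauge k x = m + real k * m"
  proof -
    have "simplex_gauge k x = real (Suc k) * m" by (simp only: m_def) simp
    then show ?thesis by (simp add: distrib_right)
  qed
  moreover have "0 \<le> real k * m" using m0 by simp
  ultimately show ?thesis using ge[OF assms] m0 by linarith
qed

lemma simplex_gauge_nonneg: "0 \<le> simplex_gauge k x"
  using simplex_coord_abs_le[of 0 k x] by linarith

lemma simplex_gauge_eq_0: "simplex_gauge k x = 0 \<longleftrightarrow> (\<forall>i<k. x i = 0)"
proof
  assume "simplex_gauge k x = 0"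
  then have "simplex_coord k x i = 0" if "i < k" for i
    using simplex_coord_abs_le[of i k x] that by simp
  then show "\<forall>i<k. x i = 0" by (auto simp: simplex_coord_def split: if_splits)
next
  assume "\<forall>i<k. x i = 0"
  then have "simplex_coord k x i = 0" for i
    by (auto simp: simplex_coord_def)
  then show "simplex_gauge k x = 0" by (simp add: simplex_gauge_def image_constant_conv)
qed

lemma radius_nonneg: "0 \<le> radius k x"
  by (simp add: radius_def sum_nonneg)

lemma radius_eq_0: "radius k x = 0 \<longleftrightarrow> (\<forall>i<k. x i = 0)"
  by (auto simp: radius_def sum_nonneg_eq_0_iff)

lemma radius_scale: "0 \<le> c \<Longrightarrow> radius k (\<lambda>i. c * x i) = c * radius k x"
  by (simp add: radius_def power_mult_distrib real_sqrt_mult flip: sum_distrib_left)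

text \<open>The displacement from the barycentre is bounded by the Euclidean norm; this is what makes the radial
  map continuous at the origin, where its formula is singular.\<close>

lemma disk_to_simplex_deviation:
  assumes "i \<le> k"
  shows "\<bar>simplex_coord k x i * radius k x / simplex_gauge k x\<bar> \<le> radius k x"
proof (cases "simplex_gauge k x = 0")
  case True
  then show ?thesis by (simp add: radius_nonneg)
next
  case False
  then have "\<bar>simplex_coord k x i\<bar> / simplex_gauge k x \<le> 1"
    using simplex_coord_abs_le[OF assms, of x] simplex_gauge_nonneg[of k x] by simp
  from mult_left_mono[OF this radius_nonneg[of k x]]
  show ?thesis using simplex_gauge_nonneg[of k x] radius_nonneg[of k x]
    by (simp add: abs_mult mult_ac)
qed

lemma continuous_map_disk_coord: "continuous_map (disk k) euclideanreal (\<lambda>x. x i)"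
  unfolding disk_def Euclidean_space_def
  by (intro continuous_map_from_subtopology continuous_map_product_projection) auto

lemma continuous_map_disk_to_simplex:
  assumes "i \<le> k"
  shows "continuous_map (disk k) euclideanreal (\<lambda>x. disk_to_simplex k x i)"
proof -
  have c: "continuous_map (disk k) euclideanreal (\<lambda>x. simplex_coord k x i)" for i
    unfolding simplex_coord_def
    by (cases "i < k") (auto intro!: continuous_intros continuous_map_disk_coord)
  have r: "continuous_map (disk k) euclideanreal (radius k)"
    unfolding continuous_map_atin radius_def
    using continuous_map_disk_coord[unfolded continuous_map_atin]
    by (auto intro!: tendsto_intros)
  have g: "continuous_map (disk k) euclideanreal (simplex_gauge k)"
    unfolding simplex_gauge_def
    by (intro continuous_intros continuous_map_Max c) auto
  show ?thesis
    unfolding continuous_map_atin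
  proof
    fix x assume x: "x \<in> topspace (disk k)"
    let ?F = "atin (disk k) x"
    have cx: "((\<lambda>x. simplex_coord k x i) \<longlongrightarrow> simplex_coord k x i) ?F"
      and rx: "(radius k \<longlongrightarrow> radius k x) ?F" 
      and gx: "(simplex_gauge k \<longlongrightarrow> simplex_gauge k x) ?F"
      using c r g x by (auto simp: continuous_map_atin)
    have "((\<lambda>x. simplex_coord k x i * radius k x / simplex_gauge k x) 
             \<longlongrightarrow> simplex_coord k x i * radius k x / simplex_gauge k x) ?F"
    proof (cases "simplex_gauge k x = 0")
      case False
      then show ?thesis by (intro tendsto_intros cx rx gx)
    next
      case True
      then have "radius k x = 0" by (simp add: simplex_gauge_eq_0 radius_eq_0)
      then have "(radius k \<longlongrightarrow> 0) ?F" using rx by simp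
      then have "((\<lambda>x. simplex_coord k x i * radius k x / simplex_gauge k x) \<longlongrightarrow> 0) ?F"
        by (rule Lim_null_comparison[rotated]) (use disk_to_simplex_deviation[OF assms] in simp)
      then show ?thesis using \<open>radius k x = 0\<close> by simp
    qed
    then show "limitin euclideanreal (\<lambda>x. disk_to_simplex k x i) (disk_to_simplex k x i) ?F"
      unfolding disk_to_simplex_def by (auto intro!: tendsto_intros)
  qed
qed

lemma sum_disk_to_simplex: "(\<Sum>i\<le>k. disk_to_simplex k x i) = 1"
  by (simp add: disk_to_simplex_def sum.distrib sum_simplex_coord flip: sum_distrib_right sum_divide_distrib)

lemma disk_to_simplex_ge:
  assumes "i \<le> k" shows "(1 - radius k x) / real (Suc k) \<le> disk_to_simplex k x i"
proof (cases "simplex_gauge k x = 0")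
  case True
  then have "radius k x = 0" by (simp add: simplex_gauge_eq_0 radius_eq_0)
  then show ?thesis by (simp add: disk_to_simplex_def)
next
  case False
  then have "simplex_gauge k x > 0" using simplex_gauge_nonneg[of k x] by simp
  moreover from mult_left_mono[OF simplex_gauge_ge[OF assms, of x] radius_nonneg[of k x]]
  have "- (simplex_coord k x i * radius k x) \<le> simplex_gauge k x * (radius k x / real (Suc k))"
    by (simp add: mult_ac)
  ultimately have "- (simplex_coord k x i * radius k x) / simplex_gauge k x \<le> radius k x / real (Suc k)"
    by (simp only: pos_divide_le_eq mult.commute)
  then show ?thesis by (simp add: disk_to_simplex_def diff_divide_distrib)
qed

text \<open>Together with \<open>disk_to_simplex_ge\<close> this says that the least barycentric coordinate of the image is
  \<open>(1 - r)/(k+1)\<close>, with \<open>r\<close> the norm of the argument. So the sphere goes to the boundary of the simplex and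
  the open disk to its interior, and the norm can be recovered from the image.\<close>

lemma disk_to_simplex_attained: "\<exists>i\<le>k. disk_to_simplex k x i = (1 - radius k x) / real (Suc k)"
proof -
  obtain i where i: "i \<le> k" "- simplex_coord k x i = simplex_gauge k x / real (Suc k)"
    using simplex_gauge_attained by blast
  have ci: "simplex_coord k x i = - (simplex_gauge k x / real (Suc k))" using i(2) by linarith
  have "disk_to_simplex k x i = (1 - radius k x) / real (Suc k)"
  proof (cases "simplex_gauge k x = 0")
    case True
    then have "radius k x = 0" by (simp add: simplex_gauge_eq_0 radius_eq_0)
    then show ?thesis by (simp add: disk_to_simplex_def)
  next
    case False
    then have "simplex_gauge k x / real (Suc k) * radius k x / simplex_gauge k x = radius k x / real (Suc k)"
      by simp
    then show ?thesis
      unfolding disk_to_simplex_def ci by (simp only: mult_minus_left minus_divide_left[symmetric]) (simp add: diff_divide_distrib)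
  qed
  with i(1) show ?thesis by blast
qed

lemma topspace_disk: "topspace (disk k) = {x. (\<forall>i\<ge>k. x i = 0) \<and> radius k x \<le> 1}"
  by (auto simp: disk_def topspace_Euclidean_space radius_def)

lemma open_disk_radius: "open_disk k = {x. (\<forall>i\<ge>k. x i = 0) \<and> radius k x < 1}"
  by (auto simp: open_disk_def topspace_disk) (auto simp: radius_def)

lemma disk_boundary_radius: "disk_boundary k = {x. (\<forall>i\<ge>k. x i = 0) \<and> radius k x = 1}"
  by (auto simp: disk_boundary_def topspace_disk) (auto simp: radius_def)

lemma compact_space_disk: "compact_space (disk k)"
proof -
  let ?P = "product_topology (\<lambda>i::nat. euclideanreal) UNIV"
  have comp: "compactin ?P (PiE UNIV (\<lambda>i. {-1..1}))"
    by (subst compactin_PiE) auto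
  have "closedin (Euclidean_space k) {x \<in> topspace (Euclidean_space k). (\<Sum>i<k. (x i)\<^sup>2) \<in> {..1}}"
    unfolding Euclidean_space_def
    by (intro closedin_continuous_map_preimage[where Y = euclideanreal] continuous_intros continuous_map_from_subtopology continuous_map_product_projection) auto
  moreover have "{x \<in> topspace (Euclidean_space k). (\<Sum>i<k. (x i)\<^sup>2) \<in> {..1}} = topspace (disk k)"
    by (auto simp: disk_def)
  ultimately have "closedin (Euclidean_space k) (topspace (disk k))" by simp
  then have cl: "closedin ?P (topspace (disk k))"
    using closedin_Euclidean_space[of k] unfolding Euclidean_space_def[of k]
    by (simp add: closedin_closed_subtopology)
  have "topspace (disk k) \<subseteq> PiE UNIV (\<lambda>i. {-1..1})"
  proof
    fix x assume x: "x \<in> topspace (disk k)"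
    have "\<bar>x i\<bar> \<le> 1" for i
    proof (cases "i < k")
      case True
      have "(x i)\<^sup>2 \<le> (\<Sum>i<k. (x i)\<^sup>2)"
        by (rule member_le_sum) (use True in auto)
      also have "\<dots> \<le> 1" using x by (simp add: disk_def)
      finally show ?thesis by (simp add: abs_square_le_1)
    next
      case False
      then show ?thesis using x by (simp add: topspace_disk)
    qed
    then show "x \<in> PiE UNIV (\<lambda>i. {-1..1})" by (auto simp: abs_le_iff minus_le_iff)
  qed
  then have "compactin ?P (topspace (disk k))"
    using closed_compactin[OF comp _ cl] by blast
  moreover have "subtopology ?P (topspace (disk k)) = disk k"
    by (simp add: disk_def Euclidean_space_def subtopology_subtopology)
  ultimately show ?thesis
    using compact_space_subtopology by metis
qed

lemma disk_to_simplex_closed: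
  assumes "x \<in> topspace (disk k)" shows "disk_to_simplex k x \<in> closed_simplex k"
proof -
  have "0 \<le> (1 - radius k x) / real (Suc k)" using assms by (simp add: topspace_disk)
  then show ?thesis
    using disk_to_simplex_ge[of _ k x] by (auto simp: closed_simplex_def sum_disk_to_simplex intro: order_trans)
qed

lemma disk_to_simplex_open:
  assumes "x \<in> open_disk k" shows "disk_to_simplex k x \<in> open_simplex k"
proof -
  have "0 < (1 - radius k x) / real (Suc k)" using assms by (simp add: open_disk_radius)
  then show ?thesis
    using disk_to_simplex_ge[of _ k x] by (auto simp: open_simplex_def sum_disk_to_simplex intro: less_le_trans)
qed

lemma disk_to_simplex_boundary:
  assumes "x \<in> disk_boundary k" shows "\<exists>j\<le>k. disk_to_simplex k x j = 0"
  using disk_to_simplex_attained[of k x] assms by (auto simp: disk_boundary_radius)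

text \<open>The least coordinates agree, hence so do the norms; then the two arguments are positive multiples of
  each other of the same norm.\<close>

lemma disk_to_simplex_inj:
  assumes x: "x \<in> topspace (disk k)" and y: "y \<in> topspace (disk k)"
    and eq: "\<And>i. i \<le> k \<Longrightarrow> disk_to_simplex k x i = disk_to_simplex k y i"
  shows "x = y"
proof -
  obtain i where i: "i \<le> k" "disk_to_simplex k x i = (1 - radius k x) / real (Suc k)"
    using disk_to_simplex_attained by blast
  obtain j where j: "j \<le> k" "disk_to_simplex k y j = (1 - radius k y) / real (Suc k)"
    using disk_to_simplex_attained by blast
  have "(1 - radius k x) / real (Suc k) = (1 - radius k y) / real (Suc k)"
    using disk_to_simplex_ge[OF i(1), of y] disk_to_simplex_ge[OF j(1), of x] eq[OF i(1)] eq[OF j(1)] i(2) j(2)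
    by linarith
  then have r: "radius k x = radius k y" by simp
  have "x i = y i" if "i < k" for i
  proof (cases "radius k x = 0")
    case True
    then have "radius k y = 0" using r by simp
    with True show ?thesis using that by (simp only: radius_eq_0)
  next
    case False
    let ?gx = "simplex_gauge k x" and ?gy = "simplex_gauge k y"
    have nz: "?gx \<noteq> 0" "?gy \<noteq> 0"
      using False r unfolding simplex_gauge_eq_0 radius_eq_0[symmetric] by simp_all
    have scaled: "x i = ?gx / ?gy * y i" if "i < k" for i
    proof -
      have "x i * radius k y / ?gx = y i * radius k y / ?gy"
        using eq[of i] that r by (simp add: disk_to_simplex_def simplex_coord_def)
      then show ?thesis using False r nz by (simp add: field_simps)
    qed
    have "0 \<le> ?gx / ?gy" by (simp add: simplex_gauge_nonneg)
    have "radius k x = radius k (\<lambda>i. ?gx / ?gy * y i)"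
      unfolding radius_def by (intro arg_cong[of _ _ sqrt] sum.cong) (auto simp: scaled)
    also have "\<dots> = ?gx / ?gy * radius k y"
      by (rule radius_scale) fact
    finally have "?gx / ?gy * radius k y = 1 * radius k y" using r by simp
    then have "?gx / ?gy = 1" using r False mult_right_cancel[of "radius k y"] by metis
    with scaled[OF that] show ?thesis by simp
  qed
  then show ?thesis
    using x y by (intro ext) (metis (mono_tags, lifting) mem_Collect_eq not_le topspace_disk)
qed

lemma disk_to_simplex_surj:
  assumes "s \<in> open_simplex k"
  shows "\<exists>x\<in>open_disk k. \<forall>i\<le>k. disk_to_simplex k x i = s i"
proof -
  \<comment> \<open>the displacement from the barycentre; its gauge \<open>G\<close> is the norm of the preimage sought\<close>
  define z where "z i = (if i < k then s i - 1 / real (Suc k) else 0)" for i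
  have s: "0 < s i" if "i \<le> k" for i using assms that by (simp add: open_simplex_def)
  have coord: "simplex_coord k z i = s i - 1 / real (Suc k)" if "i \<le> k" for i
  proof (cases "i < k")
    case False
    then have "i = k" using that by simp
    have "(\<Sum>j<k. z j) = (\<Sum>j<k. s j - 1 / real (Suc k))"
      by (intro sum.cong) (auto simp: z_def)
    also have "\<dots> = (\<Sum>j<k. s j) - real k / real (Suc k)"
      by (simp add: sum_subtractf)
    also have "(\<Sum>j<k. s j) = 1 - s k"
      using assms by (simp add: open_simplex_def flip: lessThan_Suc_atMost)
    finally show ?thesis using \<open>i = k\<close> by (simp add: simplex_coord_def field_simps)
  qed (simp add: simplex_coord_def z_def)
  define G where "G = simplex_gauge k z"
  define N where "N = radius k z"
  define x where "x i = G / N * z i" for i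
  have z0: "\<forall>i\<ge>k. z i = 0" by (simp add: z_def)
  show ?thesis
  proof (cases "N = 0")
    case True
    then have "\<forall>i<k. z i = 0" by (simp add: N_def radius_eq_0)
    then have "simplex_coord k z i = 0" for i by (simp add: simplex_coord_def)
    then have "disk_to_simplex k z i = s i" if "i \<le> k" for i
      using coord[OF that] by (simp add: disk_to_simplex_def)
    moreover have "z \<in> open_disk k" using True z0 by (simp add: open_disk_radius N_def)
    ultimately show ?thesis by blast
  next
    case False
    then have "N > 0" using radius_nonneg[of k z] by (simp add: N_def)
    have "G \<noteq> 0" using False by (simp add: G_def N_def radius_eq_0 simplex_gauge_eq_0)
    then have "G > 0" using simplex_gauge_nonneg[of k z] by (simp add: G_def)
    have "0 \<le> G / N" using \<open>G > 0\<close> \<open>N > 0\<close> by simp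
    have rx: "radius k x = G"
      using radius_scale[OF \<open>0 \<le> G / N\<close>, of k z] \<open>N > 0\<close> by (simp add: x_def[abs_def] N_def)
    have gx: "simplex_gauge k x = G / N * G"
      using simplex_gauge_scale[OF \<open>0 \<le> G / N\<close>, of k z] by (simp add: x_def[abs_def] G_def)
    have cx: "simplex_coord k x i = G / N * simplex_coord k z i" for i
      by (simp add: simplex_coord_def x_def flip: sum_distrib_left sum_divide_distrib)
    have "disk_to_simplex k x i = s i" if "i \<le> k" for i
      using \<open>G > 0\<close> \<open>N > 0\<close> coord[OF that] by (simp add: disk_to_simplex_def rx gx cx)
    moreover have "G < 1"
    proof -
      obtain i where i: "i \<le> k" "- simplex_coord k z i = G / real (Suc k)"
        using simplex_gauge_attained unfolding G_def by blast
      have "G / real (Suc k) < 1 / real (Suc k)"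
        using s[OF i(1)] coord[OF i(1)] i(2) by linarith
      then show ?thesis by (simp add: divide_less_cancel)
    qed
    then have "x \<in> open_disk k" using z0 rx by (simp add: open_disk_radius x_def)
    ultimately show ?thesis by blast
  qed
qed

section \<open>Words of vertices and jumps\<close>

text \<open>Barycentric coordinates of the point described by a word \<open>t\<close> and lengths \<open>s\<close>: a vertex receives the total
  length of the pieces labelled by it.\<close>

definition bary :: "nat \<Rightarrow> (nat \<Rightarrow> 'w) \<Rightarrow> (nat \<Rightarrow> real) \<Rightarrow> 'w \<Rightarrow> real" where
  "bary d t s v = (\<Sum>j\<le>d. if t j = v then s j else 0)"

lemma bary_nonneg: "(\<And>j. j \<le> d \<Longrightarrow> 0 \<le> s j) \<Longrightarrow> 0 \<le> bary d t s v"
  by (auto simp: bary_def intro!: sum_nonneg)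

lemma bary_ge: 
  assumes "\<And>j. j \<le> d \<Longrightarrow> 0 \<le> s j" "j \<le> d" shows "s j \<le> bary d t s (t j)"
proof -
  have "(if t j = t j then s j else 0) \<le> (\<Sum>i\<le>d. if t i = t j then s i else 0)"
    by (rule member_le_sum) (use assms in auto)
  then show ?thesis by (simp add: bary_def)
qed

lemma bary_eq_0: "v \<notin> t ` {..d} \<Longrightarrow> bary d t s v = 0"
  by (auto simp: bary_def intro!: sum.neutral)

lemma sum_bary:
  assumes "finite A" "t ` {..d} \<subseteq> A" shows "sum (bary d t s) A = sum s {..d}"
proof -
  have "sum (bary d t s) A = (\<Sum>j\<le>d. \<Sum>v\<in>A. if t j = v then s j else 0)"
    unfolding bary_def by (rule sum.swap)
  also have "\<dots> = (\<Sum>j\<le>d. s j)"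
    using assms by (intro sum.cong) (auto simp: image_subset_iff)
  finally show ?thesis .
qed

lemma bary_in_closed_face:
  assumes "s \<in> closed_simplex d" "t ` {..d} \<subseteq> \<sigma>" "finite \<sigma>"
  shows "bary d t s \<in> closed_face \<sigma>"
proof -
  have "bary d t s v = 0" if "v \<notin> \<sigma>" for v
    using that assms(2) by (intro bary_eq_0) blast
  then show ?thesis
    using assms bary_nonneg[of d s t] sum_bary[of \<sigma> t d s]
    by (auto simp: closed_face_def closed_simplex_def)
qed

lemma bary_cong: "(\<And>j. j \<le> d \<Longrightarrow> t j = t' j) \<Longrightarrow> (\<And>j. j \<le> d \<Longrightarrow> s j = s' j) \<Longrightarrow> bary d t s = bary d t' s'"
  by (auto simp: bary_def fun_eq_iff intro!: sum.cong)

definition partial_sum :: "(nat \<Rightarrow> real) \<Rightarrow> nat \<Rightarrow> real" where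
  "partial_sum s m = sum s {..<m}"

lemma open_simplex_closed_simplex: "s \<in> open_simplex d \<Longrightarrow> s \<in> closed_simplex d"
  by (auto simp: open_simplex_def closed_simplex_def less_imp_le)

lemma partial_sum_strict:
  assumes "s \<in> open_simplex d" "i < j" "j \<le> Suc d" shows "partial_sum s i < partial_sum s j"
proof -
  have "sum s {..<i} < sum s {..<j}"
    by (rule sum_strict_mono2[of _ _ i]) (use assms in \<open>auto simp: open_simplex_def less_imp_le\<close>)
  then show ?thesis by (simp add: partial_sum_def)
qed

lemma partial_sum_inj:
  assumes "s \<in> open_simplex d" shows "inj_on (partial_sum s) {..Suc d}"
proof (rule inj_onI)
  fix i j assume ij: "i \<in> {..Suc d}" "j \<in> {..Suc d}" "partial_sum s i = partial_sum s j"
  then show "i = j"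
    using partial_sum_strict[OF assms, of i j] partial_sum_strict[OF assms, of j i]
    by (cases i j rule: linorder_cases) auto
qed

text \<open>The partial sums increase strictly, so their set determines their list, and the lengths are
  differences of consecutive partial sums. The value \<open>0\<close> is left out and \<open>1\<close> is included,
  in accordance with the convention that jumps are right endpoints of pieces.\<close>

lemma partial_sums_determine:
  assumes s: "s \<in> open_simplex d" and s': "s' \<in> open_simplex d'"
    and eq: "partial_sum s ` {1..Suc d} = partial_sum s' ` {1..Suc d'}"
  shows "d = d'" "\<And>j. j \<le> d \<Longrightarrow> s j = s' j"
proof -
  have card: "card (partial_sum s ` {1..Suc d}) = Suc d" if "s \<in> open_simplex d" for s d
    by (subst card_image[OF inj_on_subset[OF partial_sum_inj[OF that]]]) auto
  show d: "d = d'" using card[OF s] card[OF s'] eq by simp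
  have sorted: "sorted (map (partial_sum s) [1..<Suc (Suc d)])" if "s \<in> open_simplex d" for s d
    unfolding sorted_iff_nth_mono
  proof (intro allI impI)
    fix i j assume ij: "i \<le> j" "j < length (map (partial_sum s) [1..<Suc (Suc d)])"
    then have "partial_sum s (Suc i) \<le> partial_sum s (Suc j)"
      using partial_sum_strict[OF that, of "Suc i" "Suc j"] by (cases "i = j") (auto simp del: upt_Suc)
    then show "map (partial_sum s) [1..<Suc (Suc d)] ! i \<le> map (partial_sum s) [1..<Suc (Suc d)] ! j"
      using ij by (simp del: upt_Suc)
  qed
  have distinct: "distinct (map (partial_sum s) [1..<Suc (Suc d)])" if "s \<in> open_simplex d" for s d
  proof -
    have "inj_on (partial_sum s) (set [1..<Suc (Suc d)])"
      by (rule inj_on_subset[OF partial_sum_inj[OF that]]) auto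
    then show ?thesis unfolding distinct_map by simp
  qed
  have "map (partial_sum s) [1..<Suc (Suc d)] = map (partial_sum s') [1..<Suc (Suc d)]"
    using sorted[OF s] distinct[OF s] sorted[OF s'] distinct[OF s'] eq d
    by (intro sorted_distinct_set_unique) (simp_all add: atLeastLessThanSuc_atLeastAtMost del: upt_Suc)
  then have "partial_sum s m = partial_sum s' m" if "1 \<le> m" "m \<le> Suc d" for m
    using that by (auto simp: map_eq_conv simp del: upt_Suc)
  moreover have "partial_sum s 0 = partial_sum s' 0" by (simp add: partial_sum_def)
  ultimately have *: "partial_sum s m = partial_sum s' m" if "m \<le> Suc d" for m
    using that by (cases m) auto
  fix j assume "j \<le> d"
  have step: "partial_sum s (Suc j) = partial_sum s j + s j" for s by (simp add: partial_sum_def)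
  show "s j = s' j" using *[of j] *[of "Suc j"] \<open>j \<le> d\<close> step[of s] step[of s'] by simp
qed

text \<open>An explicit order relation rather than a type class: it is to be chosen on an arbitrary vertex type.\<close>

locale vertex_order =
  fixes le :: "'w \<Rightarrow> 'w \<Rightarrow> bool"
  assumes total: "le u v \<or> le v u"
    and antisym: "le u v \<Longrightarrow> le v u \<Longrightarrow> u = v"
    and trans: "le u v \<Longrightarrow> le v w \<Longrightarrow> le u w"
begin

lemma ex_least: "finite S \<Longrightarrow> S \<noteq> {} \<Longrightarrow> \<exists>m\<in>S. \<forall>v\<in>S. le m v"
proof (induction S rule: finite_ne_induct)
  case (singleton x)
  then show ?case using total by blast
next
  case (insert x S)
  then obtain m where m: "m \<in> S" "\<forall>v\<in>S. le m v" by blast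
  show ?case
  proof (cases "le m x")
    case True
    then show ?thesis using m by blast
  next
    case False
    then have "le x m" using total by blast
    then have "\<forall>v\<in>S. le x v" using m(2) trans[of x m] by simp
    then show ?thesis using total[of x x] by simp
  qed
qed

definition monotone_word :: "nat \<Rightarrow> (nat \<Rightarrow> 'w) \<Rightarrow> bool" where
  "monotone_word d t \<longleftrightarrow> (\<forall>i j. i \<le> j \<longrightarrow> j \<le> d \<longrightarrow> le (t i) (t j))"

definition cumulative :: "('w \<Rightarrow> real) \<Rightarrow> 'w \<Rightarrow> real" where
  "cumulative b v = (\<Sum>u | b u \<noteq> 0 \<and> le u v. b u)"

text \<open>The right endpoints of the pieces into which a point cuts the unit interval.\<close>

definition jumps :: "('w \<Rightarrow> real) \<Rightarrow> real set" where
  "jumps b = cumulative b ` {v. b v \<noteq> 0}"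

lemma cumulative_bary: "cumulative (bary d t s) v = (\<Sum>j | j \<le> d \<and> le (t j) v. s j)"
proof -
  let ?A = "{u \<in> t ` {..d}. le u v}"
  have "cumulative (bary d t s) v = sum (bary d t s) ?A"
    unfolding cumulative_def using bary_eq_0[of _ t d s] by (intro sum.mono_neutral_left) auto
  also have "\<dots> = (\<Sum>j\<le>d. \<Sum>u\<in>?A. if t j = u then s j else 0)"
    unfolding bary_def by (rule sum.swap)
  also have "\<dots> = (\<Sum>j\<le>d. if le (t j) v then s j else 0)"
    by (intro sum.cong) auto
  also have "\<dots> = (\<Sum>j | j \<le> d \<and> le (t j) v. s j)"
    by (simp add: sum.inter_filter flip: atMost_iff)
  finally show ?thesis .
qed

lemma initial_segment:
  assumes "monotone_word d t"
  shows "\<exists>m\<le>Suc d. {j. j \<le> d \<and> le (t j) v} = {..<m}"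
proof (cases "\<forall>j\<le>d. le (t j) v")
  case True
  then show ?thesis by (intro exI[of _ "Suc d"]) auto
next
  case False
  define m where "m = (LEAST j. j \<le> d \<and> \<not> le (t j) v)"
  have m: "m \<le> d" "\<not> le (t m) v"
    using LeastI_ex[of "\<lambda>j. j \<le> d \<and> \<not> le (t j) v"] False by (auto simp: m_def)
  have "le (t j) v \<longleftrightarrow> j < m" if "j \<le> d" for j
  proof
    assume "le (t j) v"
    show "j < m"
    proof (rule ccontr)
      assume "\<not> j < m"
      then have "le (t m) (t j)" using assms that by (auto simp: monotone_word_def)
      then show False using \<open>le (t j) v\<close> m(2) trans[of "t m" "t j" v] by simp
    qed
  next
    assume "j < m"
    then show "le (t j) v" using not_less_Least[of j "\<lambda>j. j \<le> d \<and> \<not> le (t j) v"] that by (auto simp: m_def)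
  qed
  then show ?thesis using m by (intro exI[of _ m]) auto
qed

text \<open>Some lengths may vanish here. This is the case of the boundary of a cell: equal consecutive partial
  sums, as well as a partial sum equal to \<open>0\<close>, reduce the number of jumps.\<close>

lemma jumps_bary_subset:
  assumes t: "monotone_word d t" and s: "s \<in> closed_simplex d"
  shows "jumps (bary d t s) \<subseteq> partial_sum s ` {..Suc d} - {0}"
proof
  fix p assume "p \<in> jumps (bary d t s)"
  then obtain v where v: "bary d t s v \<noteq> 0" "p = cumulative (bary d t s) v" by (auto simp: jumps_def)
  have s0: "0 \<le> s j" if "j \<le> d" for j using s that by (simp add: closed_simplex_def)
  obtain m where m: "m \<le> Suc d" "{j. j \<le> d \<and> le (t j) v} = {..<m}"
    using initial_segment[OF t] by blast
  have "p = partial_sum s m" by (simp add: v(2) cumulative_bary m(2) partial_sum_def)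
  moreover have "p \<noteq> 0"
  proof
    assume "p = 0"
    then have "\<forall>j\<in>{j. j \<le> d \<and> le (t j) v}. s j = 0"
      unfolding v(2) cumulative_bary by (subst (asm) sum_nonneg_eq_0_iff) (use s0 in auto)
    then have "bary d t s v = 0"
      unfolding bary_def using total[of v v] by (intro sum.neutral) auto
    with v(1) show False by simp
  qed
  ultimately show "p \<in> partial_sum s ` {..Suc d} - {0}" using m(1) by auto
qed

text \<open>The last occurrence of a letter in an increasing word produces a jump.\<close>

lemma jump_bary:
  assumes t: "monotone_word d t" and s: "s \<in> open_simplex d" and j: "j \<le> d"
    and strict: "j < d \<Longrightarrow> t j \<noteq> t (Suc j)"
  shows "partial_sum s (Suc j) \<in> jumps (bary d t s)"
proof -
  have s0: "0 < s i" if "i \<le> d" for i using s that by (simp add: open_simplex_def)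
  have "s j \<le> bary d t s (t j)" by (rule bary_ge) (use s0 j in \<open>auto simp: less_imp_le\<close>)
  then have "bary d t s (t j) \<noteq> 0" using s0[OF j] by simp
  moreover have "{i. i \<le> d \<and> le (t i) (t j)} = {..<Suc j}"
  proof -
    have "i \<le> j" if "i \<le> d" "le (t i) (t j)" for i
    proof (rule ccontr)
      assume "\<not> i \<le> j"
      then have "le (t j) (t (Suc j))" "le (t (Suc j)) (t i)" "j < d"
        using t that by (auto simp: monotone_word_def)
      then show False
        using trans[OF _ that(2), of "t (Suc j)"] antisym[of "t j" "t (Suc j)"] strict by simp
    qed
    then show ?thesis using t j by (auto simp: monotone_word_def less_Suc_eq_le)
  qed
  then have "cumulative (bary d t s) (t j) = partial_sum s (Suc j)"
    by (simp add: cumulative_bary partial_sum_def)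
  ultimately show ?thesis unfolding jumps_def by (auto intro!: image_eqI[of _ _ "t j"])
qed

lemma jumps_family:
  assumes "0 < n" and t: "\<And>i. i < n \<Longrightarrow> monotone_word d (t i)" and s: "s \<in> open_simplex d"
    and strict: "\<And>j. j < d \<Longrightarrow> \<exists>i<n. t i j \<noteq> t i (Suc j)"
  shows "(\<Union>i<n. jumps (bary d (t i) s)) = partial_sum s ` {1..Suc d}"
proof
  show "(\<Union>i<n. jumps (bary d (t i) s)) \<subseteq> partial_sum s ` {1..Suc d}"
  proof
    fix p assume "p \<in> (\<Union>i<n. jumps (bary d (t i) s))"
    then have "p \<in> partial_sum s ` {..Suc d} - {0}"
      using jumps_bary_subset[OF t open_simplex_closed_simplex[OF s]] by blast
    then obtain m where m: "m \<le> Suc d" "p = partial_sum s m" "p \<noteq> 0" by auto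
    then have "m \<noteq> 0" by (cases m) (auto simp: partial_sum_def)
    with m show "p \<in> partial_sum s ` {1..Suc d}" by auto
  qed
  show "partial_sum s ` {1..Suc d} \<subseteq> (\<Union>i<n. jumps (bary d (t i) s))"
  proof
    fix p assume "p \<in> partial_sum s ` {1..Suc d}"
    then obtain j where j: "j \<le> d" "p = partial_sum s (Suc j)"
    proof -
      from \<open>p \<in> _\<close> obtain m where "1 \<le> m" "m \<le> Suc d" "p = partial_sum s m" by auto
      then show ?thesis using that[of "m - 1"] by simp
    qed
    obtain i where i: "i < n" "j < d \<longrightarrow> t i j \<noteq> t i (Suc j)"
      using strict[of j] \<open>0 < n\<close> by (cases "j < d") auto
    show "p \<in> (\<Union>i<n. jumps (bary d (t i) s))"
      using jump_bary[OF t[OF i(1)] s j(1)] i j(2) by auto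
  qed
qed

text \<open>If \<open>t j < t' j\<close>, then the mass on vertices up to \<open>t j\<close> is at least the \<open>(j+1)\<close>-st partial sum according
  to \<open>t\<close>, but at most the \<open>j\<close>-th one according to \<open>t'\<close>.\<close>

lemma word_determined:
  assumes t: "monotone_word d t" and t': "monotone_word d t'" and s: "s \<in> open_simplex d"
    and eq: "bary d t s = bary d t' s" and j: "j \<le> d"
  shows "t j = t' j"
proof -
  have le: "le (t' j) (t j)"
    if t: "monotone_word d t" and t': "monotone_word d t'" and eq: "bary d t s = bary d t' s" for t t'
  proof (rule ccontr)
    assume not: "\<not> le (t' j) (t j)"
    have s0: "0 < s i" if "i \<le> d" for i using s that by (simp add: open_simplex_def)
    have sub: "{i. i \<le> d \<and> le (t' i) (t j)} \<subseteq> {..<j}"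
    proof
      fix i assume i: "i \<in> {i. i \<le> d \<and> le (t' i) (t j)}"
      show "i \<in> {..<j}"
      proof (rule ccontr)
        assume "i \<notin> {..<j}"
        then have "le (t' j) (t' i)" using t' i by (auto simp: monotone_word_def)
        then show False using i not trans[of "t' j" "t' i" "t j"] by simp
      qed
    qed
    have "(\<Sum>i | i \<le> d \<and> le (t' i) (t j). s i) \<le> sum s {..<j}"
      by (rule sum_mono2) (use sub s0 j in \<open>auto simp: less_imp_le\<close>)
    also have "\<dots> < sum s {..j}" using s0[OF j] by (simp flip: lessThan_Suc_atMost)
    also have "\<dots> \<le> (\<Sum>i | i \<le> d \<and> le (t i) (t j). s i)"
      by (rule sum_mono2) (use t s0 j in \<open>auto simp: monotone_word_def less_imp_le\<close>)
    finally show False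
      using cumulative_bary[of d t s "t j"] cumulative_bary[of d t' s "t j"] eq by simp
  qed
  show ?thesis using le[OF t t' eq] le[OF t' t eq[symmetric]] antisym by blast
qed

text \<open>Here \<open>k\<close> is the number of letters, so that the empty decomposition of the zero vector is allowed and can start
  an induction.\<close>

definition decomposes ::
    "nat \<Rightarrow> (nat \<Rightarrow> 'w \<Rightarrow> real) \<Rightarrow> nat \<Rightarrow> (nat \<Rightarrow> nat \<Rightarrow> 'w) \<Rightarrow> (nat \<Rightarrow> real) \<Rightarrow> bool" where
  "decomposes n b k t s \<longleftrightarrow>
     (\<forall>j<k. 0 < s j) \<and> (\<forall>i<n. \<forall>j<k. b i (t i j) \<noteq> 0) \<and>
     (\<forall>i<n. \<forall>j j'. j \<le> j' \<longrightarrow> j' < k \<longrightarrow> le (t i j) (t i j')) \<and>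
     (\<forall>j. Suc j < k \<longrightarrow> (\<exists>i<n. t i j \<noteq> t i (Suc j))) \<and>
     (\<forall>i<n. \<forall>v. b i v = (\<Sum>j<k. if t i j = v then s j else 0))"

text \<open>Greedy construction of the common refinement: each vector puts forward the least vertex of its
  support, and the smallest of the masses found there is the length of the first piece. Removing this mass from
  all the vectors deletes a vertex from at least one of the supports, whose next letter will
  therefore differ; so the construction stops, and at each break some word changes.\<close>

lemma common_decomposition:
  fixes b :: "nat \<Rightarrow> 'w \<Rightarrow> real"
  assumes "0 < n"
    and "\<And>i. i < n \<Longrightarrow> finite {v. b i v \<noteq> 0}"
    and "\<And>i v. i < n \<Longrightarrow> 0 \<le> b i v"
    and "\<And>i. i < n \<Longrightarrow> (\<Sum>v | b i v \<noteq> 0. b i v) = m"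
  shows "\<exists>k t s. decomposes n b k t s \<and> m = (\<Sum>j<k. s j)"
  using assms(2-)
proof (induction "\<Sum>i<n. card {v. b i v \<noteq> 0}" arbitrary: b m rule: less_induct)
  case less
  note fin = less.prems(1) and nonneg = less.prems(2) and mass = less.prems(3)
  show ?case
  proof (cases "m = 0")
    case True
    have "b i v = 0" if "i < n" for i v
    proof (rule ccontr)
      assume "b i v \<noteq> 0"
      moreover have "\<forall>v\<in>{v. b i v \<noteq> 0}. b i v = 0"
        using mass[OF that] True sum_nonneg_eq_0_iff[of "{v. b i v \<noteq> 0}" "b i"] that fin nonneg by simp
      ultimately show False by blast
    qed
    then show ?thesis using True by (intro exI[of _ 0]) (auto simp: decomposes_def)
  next
    case False
    have ne: "{v. b i v \<noteq> 0} \<noteq> {}" if "i < n" for i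
      using mass[OF that] False by (metis sum.empty)
    have "\<forall>i\<in>{..<n}. \<exists>u. b i u \<noteq> 0 \<and> (\<forall>v. b i v \<noteq> 0 \<longrightarrow> le u v)"
      using ex_least[OF fin ne] by simp
    from bchoice[OF this] obtain u
      where u: "\<And>i. i < n \<Longrightarrow> b i (u i) \<noteq> 0" "\<And>i v. i < n \<Longrightarrow> b i v \<noteq> 0 \<Longrightarrow> le (u i) v"
      by auto
    define \<mu> where "\<mu> = Min ((\<lambda>i. b i (u i)) ` {..<n})"
    have \<mu>le: "\<mu> \<le> b i (u i)" if "i < n" for i using that by (auto simp: \<mu>_def)
    obtain i0 where i0: "i0 < n" "\<mu> = b i0 (u i0)"
    proof -
      have "\<mu> \<in> (\<lambda>i. b i (u i)) ` {..<n}" unfolding \<mu>_def using \<open>0 < n\<close> by (intro Min_in) auto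
      then show ?thesis using that by auto
    qed
    have "\<mu> > 0" using u(1)[OF i0(1)] nonneg[OF i0(1), of "u i0"] i0(2) by simp
    define b' where "b' i = (b i)(u i := b i (u i) - \<mu>)" for i
    have supp: "{v. b' i v \<noteq> 0} \<subseteq> {v. b i v \<noteq> 0}" if "i < n" for i
      using u(1)[OF that] by (auto simp: b'_def)
    have "b' i0 (u i0) = 0" using i0 by (simp add: b'_def)
    then have "{v. b' i0 v \<noteq> 0} \<subset> {v. b i0 v \<noteq> 0}"
      using supp[OF i0(1)] u(1)[OF i0(1)] by (intro psubsetI) auto
    then have "card {v. b' i0 v \<noteq> 0} < card {v. b i0 v \<noteq> 0}"
      by (rule psubset_card_mono[OF fin[OF i0(1)]])
    then have smaller: "(\<Sum>i<n. card {v. b' i v \<noteq> 0}) < (\<Sum>i<n. card {v. b i v \<noteq> 0})"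
      using supp fin i0(1) by (intro sum_strict_mono_ex1) (auto intro!: card_mono)
    have fin': "finite {v. b' i v \<noteq> 0}" if "i < n" for i
      by (rule finite_subset[OF supp[OF that] fin[OF that]])
    have nonneg': "0 \<le> b' i v" if "i < n" for i v
      using nonneg[OF that] \<mu>le[OF that] by (simp add: b'_def)
    have mass': "(\<Sum>v | b' i v \<noteq> 0. b' i v) = m - \<mu>" if "i < n" for i
    proof -
      let ?S = "{v. b i v \<noteq> 0}"
      have "(\<Sum>v | b' i v \<noteq> 0. b' i v) = sum (b' i) ?S"
        using supp[OF that] fin[OF that] by (intro sum.mono_neutral_left) auto
      also have "\<dots> = (\<Sum>v\<in>?S. b i v - (if v = u i then \<mu> else 0))"
        by (intro sum.cong) (auto simp: b'_def)
      also have "\<dots> = m - \<mu>"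
        using fin[OF that] mass[OF that] u(1)[OF that] by (simp add: sum_subtractf)
      finally show ?thesis .
    qed
    have "\<exists>k t s. decomposes n b' k t s \<and> m - \<mu> = (\<Sum>j<k. s j)"
      by (rule less.hyps[OF smaller fin' nonneg' mass'])
    then obtain k t s where dec: "decomposes n b' k t s" and IH_mass: "m - \<mu> = (\<Sum>j<k. s j)"
      by blast
    note IH = dec[unfolded decomposes_def, THEN conjunct1]
      dec[unfolded decomposes_def, THEN conjunct2, THEN conjunct1]
      dec[unfolded decomposes_def, THEN conjunct2, THEN conjunct2, THEN conjunct1]
      dec[unfolded decomposes_def, THEN conjunct2, THEN conjunct2, THEN conjunct2, THEN conjunct1]
      dec[unfolded decomposes_def, THEN conjunct2, THEN conjunct2, THEN conjunct2, THEN conjunct2]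
      IH_mass
    \<comment> \<open>prepend the new first letters and the length of the first piece\<close>
    define t' where "t' i = case_nat (u i) (t i)" for i
    define s' where "s' = case_nat \<mu> s"
    have bt: "b i (t i j) \<noteq> 0" if "i < n" "j < k" for i j
      using subsetD[OF supp[OF that(1)], of "t i j"] IH(2) that by simp
    show ?thesis
      unfolding decomposes_def
    proof (rule exI[of _ "Suc k"], rule exI[of _ t'], rule exI[of _ s'], intro conjI allI impI)
      show "0 < s' j" if "j < Suc k" for j
        using that IH(1) \<open>\<mu> > 0\<close> by (auto simp: s'_def split: nat.split)
      show "b i (t' i j) \<noteq> 0" if "i < n" "j < Suc k" for i j
        using that bt u(1) by (auto simp: t'_def split: nat.split)
      show "le (t' i j) (t' i j')" if "i < n" "j \<le> j'" "j' < Suc k" for i j j'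
        using that bt u IH(3) total[of "u i" "u i"] by (auto simp: t'_def split: nat.split)
      show "\<exists>i<n. t' i j \<noteq> t' i (Suc j)" if "Suc j < Suc k" for j
      proof (cases j)
        case 0
        have "b' i0 (t i0 0) \<noteq> 0" using IH(2) i0(1) that by auto
        then have "t i0 0 \<noteq> u i0" using \<open>b' i0 (u i0) = 0\<close> by auto
        then show ?thesis using i0(1) 0 by (intro exI[of _ i0]) (auto simp: t'_def)
      next
        case (Suc l)
        then show ?thesis using IH(4) that by (auto simp: t'_def)
      qed
      show "b i v = (\<Sum>j<Suc k. if t' i j = v then s' j else 0)" if "i < n" for i v
      proof -
        have "(\<Sum>j<Suc k. if t' i j = v then s' j else 0) = (if u i = v then \<mu> else 0) + b' i v"
          unfolding sum.lessThan_Suc_shift using IH(5) that by (simp add: t'_def s'_def cong: if_cong)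
        then show ?thesis by (auto simp: b'_def)
      qed
      show "m = (\<Sum>j<Suc k. s' j)"
        unfolding sum.lessThan_Suc_shift using IH(6) by (simp add: s'_def)
    qed
  qed
qed

end

section \<open>Compact subsets of a cell complex\<close>

text \<open>Closures of cells are covered by finitely many cells, since they lie in the images of closed disks.\<close>

lemma cell_decomposition_compactin:
  assumes E: "cell_decomposition Y E" and C: "compactin Y C"
  shows "\<exists>F. finite F \<and> F \<subseteq> (\<Union>k. E k) \<and> C \<subseteq> \<Union>F"
proof -
  note conj = E[unfolded cell_decomposition_def]
  note haus = conj[THEN conjunct1]
  note cover = conj[THEN conjunct2, THEN conjunct1]
  note disj0 = conj[THEN conjunct2, THEN conjunct2, THEN conjunct1]
  note char0 = conj[THEN conjunct2, THEN conjunct2, THEN conjunct2, THEN conjunct1]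
  note weak0 = conj[THEN conjunct2, THEN conjunct2, THEN conjunct2, THEN conjunct2]
  have disj: "e = f" if "e \<in> E j" "f \<in> E k" "e \<inter> f \<noteq> {}" for j k e f
    using disj0[rule_format, OF that] by (rule conjunct2)
  have char: "\<exists>\<phi>. characteristic_map Y E k e \<phi>" if "e \<in> E k" for k e
    using char0[rule_format, OF that] .
  have weak: "closedin Y A"
    if "A \<subseteq> topspace Y" "\<And>k e. e \<in> E k \<Longrightarrow> closedin Y (A \<inter> Y closure_of e)" for A
    by (rule weak0[rule_format, OF that])
  \<comment> \<open>the set of cells through \<open>y\<close>, which is a singleton\<close>
  define label where "label y = {e. (\<exists>k. e \<in> E k) \<and> y \<in> e}" for y
  have label: "label y = {e}" if e: "e \<in> E k" "y \<in> e" for e k y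
  proof (intro equalityI subsetI)
    fix f assume "f \<in> label y"
    then obtain j where "f \<in> E j" "y \<in> f" by (auto simp: label_def)
    then have "f = e" using disj[of f j e k] e by blast
    then show "f \<in> {e}" by simp
  next
    fix f assume "f \<in> {e}"
    then show "f \<in> label y" using e by (auto simp: label_def)
  qed
  have closure: "\<exists>F. finite F \<and> F \<subseteq> (\<Union>k. E k) \<and> Y closure_of e \<subseteq> \<Union>F" if e: "e \<in> E k" for e k
  proof -
    obtain \<phi> F where cont: "continuous_map (disk k) Y \<phi>"
      and homeo: "homeomorphic_map (subtopology (disk k) (open_disk k)) (subtopology Y e) \<phi>"
      and F: "finite F" "F \<subseteq> (\<Union>j<k. E j)" "\<phi> ` disk_boundary k \<subseteq> \<Union>F"
      using char[OF e] unfolding characteristic_map_def by blast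
    have disk: "topspace (disk k) = open_disk k \<union> disk_boundary k"
      by (auto simp: topspace_disk open_disk_radius disk_boundary_radius)
    have "e \<subseteq> topspace Y" using e cover by blast
    then have im: "\<phi> ` open_disk k = e"
      using homeomorphic_imp_surjective_map[OF homeo] disk by (simp add: Int_absorb1 Int_absorb2)
    have "compactin Y (\<phi> ` topspace (disk k))"
      using compact_space_disk cont by (auto simp: compact_space_def intro: image_compactin)
    then have "closedin Y (\<phi> ` topspace (disk k))"
      using haus by (simp add: compactin_imp_closedin)
    then have "Y closure_of e \<subseteq> \<phi> ` topspace (disk k)"
      by (intro closure_of_minimal) (use im disk in auto)
    also have "\<dots> \<subseteq> \<Union>(insert e F)"
      using im F(3) by (auto simp: disk)
    finally have "Y closure_of e \<subseteq> \<Union>(insert e F)" .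
    moreover have "insert e F \<subseteq> (\<Union>k. E k)" using F(2) e by blast
    ultimately show ?thesis using F(1) by (intro exI[of _ "insert e F"]) simp
  qed
  have "finite (label ` C)"
  proof (rule compactin_finite_labels[OF _ C])
    let ?\<C> = "{Y closure_of e | e k. e \<in> E k}"
    show "t1_space Y" using haus by (rule Hausdorff_imp_t1_space)
    show "closedin Y A" if "A \<subseteq> topspace Y" "\<And>c. c \<in> ?\<C> \<Longrightarrow> closedin Y (A \<inter> c)" for A
    proof (rule weak[OF that(1)])
      fix k e assume "e \<in> E k"
      then have "Y closure_of e \<in> ?\<C>" by blast
      then show "closedin Y (A \<inter> Y closure_of e)" by (rule that(2))
    qed
    fix c assume "c \<in> ?\<C>"
    then obtain e k where e: "e \<in> E k" "c = Y closure_of e" by blast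
    from closure[OF e(1)] obtain F where F: "finite F" "F \<subseteq> (\<Union>k. E k)" "Y closure_of e \<subseteq> \<Union>F"
      by (elim exE conjE) (rule that)
    have "label y \<in> (\<lambda>e. {e}) ` F" if y: "y \<in> c" for y
    proof -
      obtain f where f: "f \<in> F" "y \<in> f" using F(3) y unfolding e(2) by blast
      then obtain j where "f \<in> E j" using F(2) by blast
      then show ?thesis using label[OF _ f(2)] f(1) by simp
    qed
    then have "label ` (c \<inter> topspace Y) \<subseteq> (\<lambda>e. {e}) ` F" by blast
    then show "finite (label ` (c \<inter> topspace Y))"
      by (rule finite_surj[OF F(1)])
  qed
  moreover have "finite (label y)" if "y \<in> C" for y
  proof -
    have "y \<in> topspace Y" using C that compactin_subset_topspace by blast
    then obtain e k where "e \<in> E k" "y \<in> e" using cover by blast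
    from label[OF this] show ?thesis by simp
  qed
  ultimately have "finite (\<Union>(label ` C))" by blast
  moreover have "C \<subseteq> \<Union>(\<Union>(label ` C))"
  proof
    fix y assume y: "y \<in> C"
    then have "y \<in> topspace Y" using C compactin_subset_topspace by blast
    then obtain e k where e: "e \<in> E k" "y \<in> e" using cover by blast
    then have "e \<in> label y" using label[OF e] by simp
    then show "y \<in> \<Union>(\<Union>(label ` C))" using y e(2) by blast
  qed
  moreover have "\<Union>(label ` C) \<subseteq> (\<Union>k. E k)" by (auto simp: label_def)
  ultimately show ?thesis by blast
qed

section \<open>Cells in the powers of a triangulated space\<close>

text \<open>The family \<open>L\<close> records which sets of vertices span a common simplex. Requiring compact sets of \<open>X\<close> to be covered by simplices on a finite vertex set, instead of
  requiring \<open>h\<close> to be a homeomorphism, is enough for the weak topology of the cells and easier to check for a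
  subdivision.\<close>

locale triangulated_space = vertex_order le for le :: "'w \<Rightarrow> 'w \<Rightarrow> bool" +
  fixes X :: "'a topology" and L :: "'w set set" and h :: "('w \<Rightarrow> real) \<Rightarrow> 'a"
  assumes finite_simplex: "\<sigma> \<in> L \<Longrightarrow> finite \<sigma>"
    and bij: "bij_betw h (\<Union>\<sigma>\<in>L. closed_face \<sigma>) (topspace X)"
    and continuous_on_face:
      "\<sigma> \<in> L \<Longrightarrow> continuous_map (subtopology (powertop_real UNIV) (closed_face \<sigma>)) X h"
    and compact_in_faces:
      "compactin X C \<Longrightarrow> \<exists>M. finite M \<and> C \<subseteq> h ` (\<Union>\<sigma>\<in>{\<sigma> \<in> L. \<sigma> \<subseteq> M}. closed_face \<sigma>)"
    and separated: "x \<in> topspace X \<Longrightarrow> y \<in> topspace X \<Longrightarrow> x \<noteq> y \<Longrightarrow>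
      \<exists>f. continuous_map X euclideanreal f \<and> f x \<noteq> f y"
begin

definition coord :: "'a \<Rightarrow> 'w \<Rightarrow> real" where
  "coord = inv_into (\<Union>\<sigma>\<in>L. closed_face \<sigma>) h"

definition all_jumps :: "'a set \<Rightarrow> real set" where
  "all_jumps S = (\<Union>x\<in>S. jumps (coord x))"

text \<open>The words that label a \<open>d\<close>-dimensional cell of the \<open>n\<close>-th power; a word of a \<open>d\<close>-cell has \<open>d + 1\<close> letters.\<close>

definition admissible :: "nat \<Rightarrow> nat \<Rightarrow> (nat \<Rightarrow> nat \<Rightarrow> 'w) \<Rightarrow> bool" where
  "admissible n d t \<longleftrightarrow>
     (\<forall>i<n. monotone_word d (t i) \<and> (\<exists>\<sigma>\<in>L. t i ` {..d} \<subseteq> \<sigma>)) \<and>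
     (\<forall>j<d. \<exists>i<n. t i j \<noteq> t i (Suc j))"

definition realize :: "nat \<Rightarrow> nat \<Rightarrow> (nat \<Rightarrow> nat \<Rightarrow> 'w) \<Rightarrow> (nat \<Rightarrow> real) \<Rightarrow> nat \<Rightarrow> 'a" where
  "realize n d t s = (\<lambda>i\<in>{..<n}. h (bary d (t i) s))"

definition cell :: "nat \<Rightarrow> nat \<Rightarrow> (nat \<Rightarrow> nat \<Rightarrow> 'w) \<Rightarrow> (nat \<Rightarrow> 'a) set" where
  "cell n d t = realize n d t ` open_simplex d"

lemma coord_h: "b \<in> closed_face \<sigma> \<Longrightarrow> \<sigma> \<in> L \<Longrightarrow> coord (h b) = b"
  unfolding coord_def using bij by (intro inv_into_f_f) (auto simp: bij_betw_def)

lemma coord_in: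
  assumes "x \<in> topspace X" obtains \<sigma> where "\<sigma> \<in> L" "coord x \<in> closed_face \<sigma>" "h (coord x) = x"
proof -
  have x: "x \<in> h ` (\<Union>\<sigma>\<in>L. closed_face \<sigma>)" using bij assms by (simp add: bij_betw_def)
  show ?thesis
    using that inv_into_into[OF x] f_inv_into_f[OF x] by (auto simp: coord_def)
qed

lemma bary_in_face:
  assumes "admissible n d t" "s \<in> closed_simplex d" "i < n"
  obtains \<sigma> where "\<sigma> \<in> L" "bary d (t i) s \<in> closed_face \<sigma>" "t i ` {..d} \<subseteq> \<sigma>"
proof -
  obtain \<sigma> where "\<sigma> \<in> L" "t i ` {..d} \<subseteq> \<sigma>" using assms by (auto simp: admissible_def)
  then show ?thesis
    using that bary_in_closed_face[OF assms(2)] finite_simplex by blast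
qed

lemma coord_realize:
  assumes "admissible n d t" "s \<in> closed_simplex d" "i < n"
  shows "coord (realize n d t s i) = bary d (t i) s"
proof -
  obtain \<sigma> where "\<sigma> \<in> L" "bary d (t i) s \<in> closed_face \<sigma>" by (rule bary_in_face[OF assms])
  then show ?thesis using assms(3) by (simp add: realize_def coord_h)
qed

lemma h_in_topspace: "\<sigma> \<in> L \<Longrightarrow> b \<in> closed_face \<sigma> \<Longrightarrow> h b \<in> topspace X"
  using bij by (auto simp: bij_betw_def)

lemma realize_in_power:
  assumes "admissible n d t" "s \<in> closed_simplex d"
  shows "realize n d t s \<in> topspace (cartesian_power n X)"
proof -
  have "h (bary d (t i) s) \<in> topspace X" if "i < n" for i
    by (rule bary_in_face[OF assms that]) (rule h_in_topspace)
  then show ?thesis by (auto simp: realize_def)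
qed

lemma realize_cong: "(\<And>j. j \<le> d \<Longrightarrow> s j = s' j) \<Longrightarrow> realize n d t s = realize n d t s'"
  by (auto simp: realize_def fun_eq_iff intro!: arg_cong[of _ _ h] bary_cong)

lemma all_jumps_realize:
  assumes "admissible n d t" "s \<in> closed_simplex d"
  shows "all_jumps (realize n d t s ` {..<n}) = (\<Union>i<n. jumps (bary d (t i) s))"
  using coord_realize[OF assms] by (auto simp: all_jumps_def)

lemma all_jumps_open:
  assumes "0 < n" "admissible n d t" "s \<in> open_simplex d"
  shows "all_jumps (realize n d t s ` {..<n}) = partial_sum s ` {1..Suc d}"
  unfolding all_jumps_realize[OF assms(2) open_simplex_closed_simplex[OF assms(3)]]
  by (rule jumps_family) (use assms in \<open>auto simp: admissible_def\<close>)

lemma card_all_jumps_open: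
  assumes "0 < n" "admissible n d t" "s \<in> open_simplex d"
  shows "card (all_jumps (realize n d t s ` {..<n})) = Suc d"
  unfolding all_jumps_open[OF assms]
  by (subst card_image[OF inj_on_subset[OF partial_sum_inj[OF assms(3)]]]) auto

text \<open>If the \<open>j\<close>-th length vanishes, then the \<open>j\<close>-th and the \<open>(j+1)\<close>-st partial sums agree; for \<open>j = 0\<close> their common
  value \<open>0\<close> is no jump.\<close>

lemma card_all_jumps_boundary:
  assumes "admissible n d t" "s \<in> closed_simplex d" "j \<le> d" "s j = 0"
  shows "card (all_jumps (realize n d t s ` {..<n})) \<le> d"
proof -
  let ?P = "partial_sum s ` ({..Suc d} - {j})"
  have "partial_sum s j = partial_sum s (Suc j)" using assms(4) by (simp add: partial_sum_def)
  then have "partial_sum s j \<in> ?P" using assms(3) by (auto intro!: image_eqI[of _ _ "Suc j"])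
  then have P: "partial_sum s ` {..Suc d} = ?P" by auto
  have sub: "all_jumps (realize n d t s ` {..<n}) \<subseteq> ?P - {0}"
    unfolding all_jumps_realize[OF assms(1,2)] P[symmetric]
  proof (rule UN_least)
    fix i assume "i \<in> {..<n}"
    then show "jumps (bary d (t i) s) \<subseteq> partial_sum s ` {..Suc d} - {0}"
      using assms(1) by (intro jumps_bary_subset[OF _ assms(2)]) (simp add: admissible_def)
  qed
  have "card ?P \<le> card ({..Suc d} - {j})" by (rule card_image_le) simp
  also have "\<dots> = Suc d" using assms(3) by simp
  finally have "card ?P \<le> Suc d" .
  moreover have "0 \<in> ?P"
    unfolding P[symmetric] by (rule image_eqI[of _ _ 0]) (auto simp: partial_sum_def)
  ultimately have "card (?P - {0}) \<le> d" by (simp add: card_Diff_singleton)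
  moreover have "card (all_jumps (realize n d t s ` {..<n})) \<le> card (?P - {0})"
    by (rule card_mono[OF _ sub]) simp
  ultimately show ?thesis by simp
qed

lemma power_covered:
  assumes "0 < n" and x: "x \<in> topspace (cartesian_power n X)"
  obtains d t s where "admissible n d t" "s \<in> open_simplex d" "x = realize n d t s"
    "\<And>i. i < n \<Longrightarrow> t i ` {..d} \<subseteq> {v. coord (x i) v \<noteq> 0}"
proof -
  have xi: "x i \<in> topspace X" if "i < n" for i using x that by (auto simp: PiE_iff)
  have face: "\<exists>\<sigma>\<in>L. coord (x i) \<in> closed_face \<sigma> \<and> {v. coord (x i) v \<noteq> 0} \<subseteq> \<sigma> \<and> h (coord (x i)) = x i"
    if i: "i < n" for i
  proof -
    obtain \<sigma> where "\<sigma> \<in> L" "coord (x i) \<in> closed_face \<sigma>" "h (coord (x i)) = x i"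
      by (rule coord_in[OF xi[OF i]])
    moreover from this(2) have "{v. coord (x i) v \<noteq> 0} \<subseteq> \<sigma>" by (auto simp: closed_face_def)
    ultimately show ?thesis by blast
  qed
  have "\<exists>k t s. decomposes n (\<lambda>i. coord (x i)) k t s \<and> 1 = (\<Sum>j<k. s j)"
  proof (rule common_decomposition[OF assms(1)])
    fix i assume "i < n"
    then obtain \<sigma> where \<sigma>: "\<sigma> \<in> L" "coord (x i) \<in> closed_face \<sigma>" "{v. coord (x i) v \<noteq> 0} \<subseteq> \<sigma>"
      using face by blast
    show "finite {v. coord (x i) v \<noteq> 0}"
      using \<sigma> finite_simplex finite_subset by blast
    show "0 \<le> coord (x i) v" for v using \<sigma>(2) by (simp add: closed_face_def)
    have "(\<Sum>v | coord (x i) v \<noteq> 0. coord (x i) v) = sum (coord (x i)) \<sigma>"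
      using \<sigma> finite_simplex by (intro sum.mono_neutral_left) auto
    then show "(\<Sum>v | coord (x i) v \<noteq> 0. coord (x i) v) = 1"
      using \<sigma>(2) by (simp add: closed_face_def)
  qed
  then obtain k t s where dec: "decomposes n (\<lambda>i. coord (x i)) k t s" and mass: "1 = (\<Sum>j<k. s j)"
    by blast
  obtain d where k: "k = Suc d" using mass by (cases k) auto
  note dec' = dec[unfolded decomposes_def k less_Suc_eq_le]
  note pos = dec'[THEN conjunct1]
    and nonzero = dec'[THEN conjunct2, THEN conjunct1]
    and mono = dec'[THEN conjunct2, THEN conjunct2, THEN conjunct1]
    and strict = dec'[THEN conjunct2, THEN conjunct2, THEN conjunct2, THEN conjunct1]
    and sums = dec'[THEN conjunct2, THEN conjunct2, THEN conjunct2, THEN conjunct2]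
  have supp: "t i ` {..d} \<subseteq> {v. coord (x i) v \<noteq> 0}" if "i < n" for i
    using nonzero that by auto
  have s: "s \<in> open_simplex d"
    using pos mass unfolding open_simplex_def k lessThan_Suc_atMost by simp
  have bary: "coord (x i) = bary d (t i) s" if "i < n" for i
    using sums that unfolding bary_def[abs_def] lessThan_Suc_atMost by auto
  have "\<exists>\<sigma>\<in>L. t i ` {..d} \<subseteq> \<sigma>" if "i < n" for i
    using face[OF that] supp[OF that] by blast
  then have adm: "admissible n d t"
    using mono strict unfolding admissible_def monotone_word_def Suc_le_eq by blast
  have "x = realize n d t s"
  proof
    fix i show "x i = realize n d t s i"
    proof (cases "i < n")
      case True
      then show ?thesis using face[OF True] bary[OF True] by (auto simp: realize_def)
    next
      case False
      then show ?thesis using x by (auto simp: realize_def PiE_iff extensional_def)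
    qed
  qed
  with that adm s supp show ?thesis by blast
qed

text \<open>Coordinates that agree at one point of a cell agree on the whole cell, because they have the same word. All
  compatibility of cells with identifications comes from this fact.\<close>

lemma coincidence_extends:
  assumes t: "admissible n d t" "admissible m d t'" "i < n" "j < m" and s: "s \<in> open_simplex d"
    and eq: "realize n d t s i = realize m d t' s j"
  shows "realize n d t r i = realize m d t' r j"
proof -
  have "bary d (t i) s = bary d (t' j) s"
    using coord_realize[OF t(1) open_simplex_closed_simplex[OF s] t(3)]
      coord_realize[OF t(2) open_simplex_closed_simplex[OF s] t(4)] eq by simp
  then have "t i k = t' j k" if "k \<le> d" for k
    using t s that by (intro word_determined[of d]) (auto simp: admissible_def)
  then show ?thesis using t(3,4) by (auto simp: realize_def intro!: arg_cong[of _ _ h] bary_cong)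
qed

lemma open_simplex_nonempty: "open_simplex d \<noteq> {}"
proof -
  have "(\<lambda>_. 1 / real (Suc d)) \<in> open_simplex d" by (simp add: open_simplex_def)
  then show ?thesis by blast
qed

text \<open>A point whose coordinates have supports in \<open>M\<close> has at most \<open>n \<cdot> |M|\<close> jumps, which bounds the length of the
  words.\<close>

lemma finite_cells_over:
  assumes "0 < n" "finite M"
  shows "finite {cell n d t | d t. admissible n d t \<and> (\<forall>i<n. t i ` {..d} \<subseteq> M)}"
proof -
  let ?D = "{..n * card M}"
  let ?T = "\<lambda>d. {..<n} \<rightarrow>\<^sub>E ({..d} \<rightarrow>\<^sub>E M)"
  have "finite (\<Union>d\<in>?D. cell n d ` ?T d)"
    using assms(2) by (intro finite_UN_I finite_imageI finite_PiE) auto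
  moreover have "{cell n d t | d t. admissible n d t \<and> (\<forall>i<n. t i ` {..d} \<subseteq> M)} \<subseteq> (\<Union>d\<in>?D. cell n d ` ?T d)"
  proof clarify
    fix d t assume t: "admissible n d t" "\<forall>i<n. t i ` {..d} \<subseteq> M"
    obtain s where s: "s \<in> open_simplex d" using open_simplex_nonempty by blast
    have "Suc d = card (\<Union>i<n. jumps (bary d (t i) s))"
      using card_all_jumps_open[OF assms(1) t(1) s] all_jumps_realize[OF t(1) open_simplex_closed_simplex[OF s]] by simp
    also have "\<dots> \<le> (\<Sum>i<n. card (jumps (bary d (t i) s)))" by (rule card_UN_le) simp
    also have "\<dots> \<le> (\<Sum>i<n. card M)"
    proof (rule sum_mono)
      fix i assume i: "i \<in> {..<n}"
      then have sub: "{v. bary d (t i) s v \<noteq> 0} \<subseteq> M" using t(2) bary_eq_0[of _ "t i" d s] by blast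
      then have "card (jumps (bary d (t i) s)) \<le> card {v. bary d (t i) s v \<noteq> 0}"
        unfolding jumps_def using assms(2) finite_subset by (intro card_image_le) blast
      also have "\<dots> \<le> card M" using assms(2) sub by (rule card_mono)
      finally show "card (jumps (bary d (t i) s)) \<le> card M" .
    qed
    finally have d: "d \<in> ?D" by simp
    define t' where "t' = (\<lambda>i\<in>{..<n}. restrict (t i) {..d})"
    have "t' \<in> ?T d"
      unfolding t'_def using t(2) by (intro restrict_PiE_iff[THEN iffD2] ballI) (auto simp: image_subset_iff)
    moreover have "realize n d t' s = realize n d t s" for s
      by (auto simp: realize_def t'_def fun_eq_iff intro!: arg_cong[of _ _ h] bary_cong)
    then have "cell n d t = cell n d t'" by (simp add: cell_def)
    ultimately show "cell n d t \<in> (\<Union>d\<in>?D. cell n d ` ?T d)" using d by blast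
  qed
  ultimately show ?thesis by (rule finite_subset[rotated])
qed

lemma continuous_map_into_power:
  assumes "k_space Z" "\<And>i. i < n \<Longrightarrow> continuous_map Z X (\<lambda>z. f z i)"
    and "\<And>z. z \<in> topspace Z \<Longrightarrow> f z \<in> extensional {..<n}"
  shows "continuous_map Z (cartesian_power n X) f"
  unfolding cartesian_power_def continuous_map_into_kification[OF assms(1)]
  using assms(2,3) by (auto simp: continuous_map_componentwise)

lemma continuous_map_realize:
  assumes "admissible n d t"
  shows "continuous_map (disk d) (cartesian_power n X) (\<lambda>x. realize n d t (disk_to_simplex d x))"
proof (rule continuous_map_into_power)
  show "k_space (disk d)" by (rule compact_imp_k_space) (rule compact_space_disk)
  show "realize n d t (disk_to_simplex d x) \<in> extensional {..<n}" for x by (simp add: realize_def)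
  fix i assume i: "i < n"
  obtain \<sigma> where \<sigma>: "\<sigma> \<in> L" "t i ` {..d} \<subseteq> \<sigma>" using assms i by (auto simp: admissible_def)
  have "continuous_map (disk d) (powertop_real UNIV) (\<lambda>x. bary d (t i) (disk_to_simplex d x))"
    unfolding continuous_map_componentwise_UNIV bary_def
  proof (intro allI continuous_map_sum)
    fix v j assume "j \<in> {..d}"
    then show "continuous_map (disk d) euclideanreal (\<lambda>x. if t i j = v then disk_to_simplex d x j else 0)"
      using continuous_map_disk_to_simplex[of j d] by auto
  qed simp
  then have "continuous_map (disk d) (subtopology (powertop_real UNIV) (closed_face \<sigma>)) (\<lambda>x. bary d (t i) (disk_to_simplex d x))"
    using bary_in_closed_face[OF disk_to_simplex_closed \<sigma>(2) finite_simplex[OF \<sigma>(1)]]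
    by (auto simp: continuous_map_in_subtopology)
  from continuous_map_compose[OF this continuous_on_face[OF \<sigma>(1)]]
  show "continuous_map (disk d) X (\<lambda>x. realize n d t (disk_to_simplex d x) i)"
    using i by (simp add: realize_def comp_def)
qed

lemma compact_in_cells:
  assumes "0 < n" "compactin (cartesian_power n X) C"
  shows "\<exists>F. finite F \<and> F \<subseteq> {cell n d t | d t. admissible n d t} \<and> C \<subseteq> \<Union>F"
proof -
  have C: "compactin (product_topology (\<lambda>_. X) {..<n}) C"
    using assms(2) by (simp add: cartesian_power_def)
  have "\<forall>i\<in>{..<n}. \<exists>M. finite M \<and> (\<lambda>x. x i) ` C \<subseteq> h ` (\<Union>\<sigma>\<in>{\<sigma> \<in> L. \<sigma> \<subseteq> M}. closed_face \<sigma>)"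
  proof
    fix i assume "i \<in> {..<n}"
    then have "compactin X ((\<lambda>x. x i) ` C)"
      using C by (intro image_compactin[OF C] continuous_map_product_projection)
    then show "\<exists>M. finite M \<and> (\<lambda>x. x i) ` C \<subseteq> h ` (\<Union>\<sigma>\<in>{\<sigma> \<in> L. \<sigma> \<subseteq> M}. closed_face \<sigma>)"
      by (rule compact_in_faces)
  qed
  from bchoice[OF this] obtain M where M0: "\<forall>i\<in>{..<n}. finite (M i) \<and>
      (\<lambda>x. x i) ` C \<subseteq> h ` (\<Union>\<sigma>\<in>{\<sigma> \<in> L. \<sigma> \<subseteq> M i}. closed_face \<sigma>)" ..
  have M: "finite (M i)" "x \<in> C \<Longrightarrow> x i \<in> h ` (\<Union>\<sigma>\<in>{\<sigma> \<in> L. \<sigma> \<subseteq> M i}. closed_face \<sigma>)"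
    if "i < n" for i x
    using bspec[OF M0, of i] that by auto
  define N where "N = (\<Union>i<n. M i)"
  have N: "finite N" using M(1) by (auto simp: N_def)
  let ?F = "{cell n d t | d t. admissible n d t \<and> (\<forall>i<n. t i ` {..d} \<subseteq> N)}"
  have "C \<subseteq> \<Union>?F"
  proof
    fix x assume x: "x \<in> C"
    then have "x \<in> topspace (cartesian_power n X)"
      using assms(2) compactin_subset_topspace by blast
    then obtain d t s where t: "admissible n d t" "s \<in> open_simplex d" "x = realize n d t s"
      "\<And>i. i < n \<Longrightarrow> t i ` {..d} \<subseteq> {v. coord (x i) v \<noteq> 0}"
      using power_covered[OF assms(1)] by blast
    have "t i ` {..d} \<subseteq> N" if i: "i < n" for i
    proof -
      obtain \<sigma> b where "\<sigma> \<in> L" "\<sigma> \<subseteq> M i" "b \<in> closed_face \<sigma>" "x i = h b"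
        using M(2)[OF i x] by blast
      then have "coord (x i) = b" "{v. b v \<noteq> 0} \<subseteq> \<sigma>" by (auto simp: coord_h closed_face_def)
      then have "{v. coord (x i) v \<noteq> 0} \<subseteq> M i" using \<open>\<sigma> \<subseteq> M i\<close> by auto
      then show ?thesis using t(4)[OF i] i by (auto simp: N_def)
    qed
    then show "x \<in> \<Union>?F" using t(1-3) by (auto simp: cell_def)
  qed
  moreover have "?F \<subseteq> {cell n d t | d t. admissible n d t}" by blast
  ultimately show ?thesis
    using finite_cells_over[OF assms(1) N] by blast
qed

end

section \<open>Cell decompositions of quotients of a power\<close>

text \<open>A quotient that remembers the set of coordinates and whose identifications are explained by
  coincidences of coordinates: \<open>q y = q y'\<close> is implied by \<open>q x = q x'\<close> as soon as \<open>y\<close> and \<open>y'\<close> coincide wherever \<open>x\<close> and \<open>x'\<close>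
  do. This covers the power itself, symmetric products and spaces of finite subsets.\<close>

locale tuple_quotient = triangulated_space le X L h
  for le :: "'w \<Rightarrow> 'w \<Rightarrow> bool" and X :: "'a topology" and L h +
  fixes n :: nat and q :: "(nat \<Rightarrow> 'a) \<Rightarrow> 'b" and Y :: "'b topology"
  assumes n_pos: "0 < n"
    and quotient: "quotient_map (cartesian_power n X) Y q"
    and hausdorff: "Hausdorff_space Y"
    and same_points: "x \<in> topspace (cartesian_power n X) \<Longrightarrow> y \<in> topspace (cartesian_power n X) \<Longrightarrow>
      q x = q y \<Longrightarrow> x ` {..<n} = y ` {..<n}"
    and identified: "x \<in> topspace (cartesian_power n X) \<Longrightarrow> x' \<in> topspace (cartesian_power n X) \<Longrightarrow>
      y \<in> topspace (cartesian_power n X) \<Longrightarrow> y' \<in> topspace (cartesian_power n X) \<Longrightarrow> q x = q x' \<Longrightarrow>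
      (\<And>i j. i < n \<Longrightarrow> j < n \<Longrightarrow> x i = x' j \<Longrightarrow> y i = y' j) \<Longrightarrow> q y = q y'"
begin

definition cells :: "nat \<Rightarrow> 'b set set" where
  "cells k = {q ` cell n k t | t. admissible n k t}"

lemma realize_open_in_power:
  "admissible n d t \<Longrightarrow> s \<in> open_simplex d \<Longrightarrow> realize n d t s \<in> topspace (cartesian_power n X)"
  by (intro realize_in_power open_simplex_closed_simplex)

lemma image_power: "q ` topspace (cartesian_power n X) = topspace Y"
  using quotient by (rule quotient_imp_surjective_map)

lemma cell_in_power: "admissible n d t \<Longrightarrow> cell n d t \<subseteq> topspace (cartesian_power n X)"
  by (auto simp: cell_def simp del: topspace_cartesian_power intro: realize_open_in_power)

lemma cell_image: 
  assumes "admissible n d t" shows "q ` cell n d t \<subseteq> topspace Y"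
  using image_mono[OF cell_in_power[OF assms], of q] unfolding image_power .

lemma cells_I: "admissible n k t \<Longrightarrow> q ` cell n k t \<in> cells k"
  unfolding cells_def by blast

lemma cells_E: 
  assumes "e \<in> cells k" obtains t where "admissible n k t" "e = q ` cell n k t"
  using assms unfolding cells_def by blast

text \<open>Identified points have the same set of coordinates, hence the same jumps, hence the same lengths. So they are
  the points with common lengths in their two cells; and since coincidences persist along cells, the
  identification extends to all other lengths.\<close>

lemma identified_cells:
  assumes t: "admissible n d t" and t': "admissible n d' t'"
    and s: "s \<in> open_simplex d" and s': "s' \<in> open_simplex d'"
    and eq: "q (realize n d t s) = q (realize n d' t' s')"
  shows "d = d'" and "\<And>j. j \<le> d \<Longrightarrow> s j = s' j" and "q ` cell n d t = q ` cell n d' t'"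
proof -
  note in_power = realize_open_in_power
  have "partial_sum s ` {1..Suc d} = partial_sum s' ` {1..Suc d'}"
    using same_points[OF in_power[OF t s] in_power[OF t' s'] eq]
      all_jumps_open[OF n_pos t s] all_jumps_open[OF n_pos t' s'] by simp
  note det = partial_sums_determine[OF s s' this]
  from det(1) show d: "d = d'" .
  from det(2) show ss': "s j = s' j" if "j \<le> d" for j using that .
  have t'd: "admissible n d t'" using t' d by simp
  have eq': "q (realize n d t s) = q (realize n d t' s)"
    using eq ss' realize_cong[of d s s' n t'] d by simp
  have "q (realize n d t r) = q (realize n d t' r)" if r: "r \<in> open_simplex d" for r
    by (rule identified[OF in_power[OF t s] in_power[OF t'd s] in_power[OF t r] in_power[OF t'd r] eq'])
      (rule coincidence_extends[OF t t'd _ _ s])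
  then have "q ` cell n d t = q ` cell n d t'"
    by (auto simp: cell_def image_image)
  then show "q ` cell n d t = q ` cell n d' t'" using d by simp
qed

text \<open>The boundary of the disk goes to families with fewer jumps, which lie in cells of lower dimension with
  the same vertices; in particular boundary and interior have disjoint images, and compactness of the disk
  yields the homeomorphism onto the open cell.\<close>

lemma characteristic_map_cell:
  assumes t: "admissible n k t"
  shows "characteristic_map Y cells k (q ` cell n k t) (\<lambda>x. q (realize n k t (disk_to_simplex k x)))"
  (is "characteristic_map Y cells k ?e ?\<phi>")
  unfolding characteristic_map_def
proof (intro conjI)
  have "continuous_map (disk k) Y (q \<circ> (\<lambda>x. realize n k t (disk_to_simplex k x)))"
    by (rule continuous_map_compose[OF continuous_map_realize[OF t] quotient_imp_continuous_map[OF quotient]])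
  then show cont: "continuous_map (disk k) Y ?\<phi>" by (simp add: comp_def)
  have power: "realize n k t (disk_to_simplex k x) \<in> topspace (cartesian_power n X)" if "x \<in> topspace (disk k)" for x
    using realize_in_power[OF t disk_to_simplex_closed[OF that]] .
  have open_sub: "open_disk k \<subseteq> topspace (disk k)"
    by (auto simp: open_disk_radius topspace_disk)
  have boundary: "topspace (disk k) - open_disk k = disk_boundary k"
    by (auto simp: open_disk_radius disk_boundary_radius topspace_disk)
  have small: "card (all_jumps (realize n k t (disk_to_simplex k x) ` {..<n})) \<le> k" if x: "x \<in> disk_boundary k" for x
  proof -
    obtain j where "j \<le> k" "disk_to_simplex k x j = 0" using disk_to_simplex_boundary[OF x] by blast
    moreover have "disk_to_simplex k x \<in> closed_simplex k"
      using x boundary by (intro disk_to_simplex_closed) blast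
    ultimately show ?thesis by (intro card_all_jumps_boundary[OF t])
  qed
  have image: "?\<phi> ` open_disk k = ?e"
  proof
    show "?\<phi> ` open_disk k \<subseteq> ?e"
      using disk_to_simplex_open by (auto simp: cell_def)
    show "?e \<subseteq> ?\<phi> ` open_disk k"
    proof
      fix z assume "z \<in> ?e"
      then obtain s where s: "s \<in> open_simplex k" "z = q (realize n k t s)" by (auto simp: cell_def)
      obtain x where x: "x \<in> open_disk k" "\<forall>i\<le>k. disk_to_simplex k x i = s i"
        using disk_to_simplex_surj[OF s(1)] by blast
      then have "realize n k t (disk_to_simplex k x) = realize n k t s" by (intro realize_cong) simp
      then show "z \<in> ?\<phi> ` open_disk k" using x(1) s(2) by (intro image_eqI[of _ _ x]) simp_all
    qed
  qed
  have "homeomorphic_map (subtopology (disk k) (open_disk k)) (subtopology Y (?\<phi> ` open_disk k)) ?\<phi>"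
  proof (rule homeomorphic_map_compact_restriction[OF cont compact_space_disk hausdorff open_sub])
    show "inj_on ?\<phi> (open_disk k)"
    proof (rule inj_onI)
      fix x y assume xy: "x \<in> open_disk k" "y \<in> open_disk k" "?\<phi> x = ?\<phi> y"
      have "disk_to_simplex k x i = disk_to_simplex k y i" if "i \<le> k" for i
        using identified_cells(2)[OF t t disk_to_simplex_open[OF xy(1)] disk_to_simplex_open[OF xy(2)] xy(3) that] .
      then show "x = y" using xy open_sub by (intro disk_to_simplex_inj) auto
    qed
    have "?\<phi> x \<noteq> ?\<phi> y" if x: "x \<in> disk_boundary k" and y: "y \<in> open_disk k" for x y
    proof
      assume "?\<phi> x = ?\<phi> y"
      then have "realize n k t (disk_to_simplex k x) ` {..<n} = realize n k t (disk_to_simplex k y) ` {..<n}"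
        using power x y open_sub boundary by (intro same_points) blast+
      then show False
        using small[OF x] card_all_jumps_open[OF n_pos t disk_to_simplex_open[OF y]] by simp
    qed
    then show "?\<phi> ` (topspace (disk k) - open_disk k) \<inter> ?\<phi> ` open_disk k = {}"
      unfolding boundary by blast
  qed
  then show "homeomorphic_map (subtopology (disk k) (open_disk k)) (subtopology Y ?e) ?\<phi>"
    by (simp only: image)
  show "\<exists>F. finite F \<and> F \<subseteq> (\<Union>j<k. cells j) \<and> ?\<phi> ` disk_boundary k \<subseteq> \<Union>F"
  proof -
    define M where "M = (\<Union>i<n. t i ` {..k})"
    define F where "F = {q ` cell n d t' | d t'. d < k \<and> admissible n d t' \<and> (\<forall>i<n. t' i ` {..d} \<subseteq> M)}"
    have "F \<subseteq> (`) q ` {cell n d t' | d t'. admissible n d t' \<and> (\<forall>i<n. t' i ` {..d} \<subseteq> M)}"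
      by (auto simp: F_def)
    moreover have "finite M" by (simp add: M_def)
    ultimately have "finite F"
      using finite_surj[OF finite_cells_over[OF n_pos, of M]] by simp
    moreover have "F \<subseteq> (\<Union>j<k. cells j)" by (auto simp: F_def cells_def)
    moreover have "?\<phi> ` disk_boundary k \<subseteq> \<Union>F"
    proof (rule image_subsetI)
      fix x assume x: "x \<in> disk_boundary k"
      then have xd: "x \<in> topspace (disk k)" using boundary by blast
      let ?y = "realize n k t (disk_to_simplex k x)"
      obtain d t' s where t': "admissible n d t'" "s \<in> open_simplex d" "?y = realize n d t' s"
        "\<And>i. i < n \<Longrightarrow> t' i ` {..d} \<subseteq> {v. coord (?y i) v \<noteq> 0}"
        using power_covered[OF n_pos power[OF xd]] by blast
      have "d < k" using small[OF x] card_all_jumps_open[OF n_pos t'(1,2)] t'(3) by simp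
      moreover have "t' i ` {..d} \<subseteq> M" if "i < n" for i
      proof -
        have "{v. coord (?y i) v \<noteq> 0} \<subseteq> t i ` {..k}"
          using coord_realize[OF t disk_to_simplex_closed[OF xd] that] bary_eq_0 by fastforce
        with t'(4)[OF that] have "t' i ` {..d} \<subseteq> t i ` {..k}" by (rule subset_trans)
        also have "\<dots> \<subseteq> M" using that unfolding M_def by blast
        finally show ?thesis .
      qed
      ultimately have "q ` cell n d t' \<in> F" using t'(1) by (auto simp: F_def)
      moreover have "q ?y \<in> q ` cell n d t'" using t'(2,3) by (auto simp: cell_def)
      ultimately show "?\<phi> x \<in> \<Union>F" by blast
    qed
    ultimately show ?thesis by blast
  qed
qed

lemma cells_cover: "(\<Union>k. \<Union>(cells k)) = topspace Y"
proof
  show "(\<Union>k. \<Union>(cells k)) \<subseteq> topspace Y"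
  proof (intro UN_least Union_least)
    fix k e assume "e \<in> cells k"
    then obtain t where "admissible n k t" "e = q ` cell n k t" by (rule cells_E)
    then show "e \<subseteq> topspace Y"
      using cell_image by simp
  qed
  show "topspace Y \<subseteq> (\<Union>k. \<Union>(cells k))"
  proof
    fix y assume "y \<in> topspace Y"
    then have "y \<in> q ` topspace (cartesian_power n X)" by (simp only: image_power)
    then obtain x where x: "x \<in> topspace (cartesian_power n X)" "y = q x" by (rule imageE)
    obtain d t s where "admissible n d t" "s \<in> open_simplex d" "x = realize n d t s"
      by (rule power_covered[OF n_pos x(1)])
    then have "q ` cell n d t \<in> cells d" "y \<in> q ` cell n d t"
      using x(2) cells_I by (auto simp: cell_def)
    then show "y \<in> (\<Union>k. \<Union>(cells k))" by blast
  qed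
qed

text \<open>A set is closed in the quotient if its preimage is, and in the compactly generated power this is
  tested on compact sets, which are covered by finitely many cells.\<close>

lemma closedin_by_cells:
  assumes A: "A \<subseteq> topspace Y" and cl: "\<And>k e. e \<in> cells k \<Longrightarrow> closedin Y (A \<inter> Y closure_of e)"
  shows "closedin Y A"
proof -
  let ?P = "product_topology (\<lambda>_. X) {..<n}"
  let ?pre = "\<lambda>B. {x \<in> topspace (cartesian_power n X). q x \<in> B}"
  have "closedin (cartesian_power n X) (?pre A)"
    unfolding cartesian_power_def closedin_kification
  proof (intro conjI allI impI)
    show "{x \<in> topspace (kification ?P). q x \<in> A} \<subseteq> topspace ?P" by auto
    fix C assume C: "compactin ?P C"
    then have "compactin (cartesian_power n X) C" by (simp add: cartesian_power_def)
    from compact_in_cells[OF n_pos this] obtain F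
      where F: "finite F" "F \<subseteq> {cell n d t | d t. admissible n d t}" "C \<subseteq> \<Union>F"
      by (elim exE conjE) (rule that)
    have closed: "closedin (subtopology ?P C) (C \<inter> ?pre (A \<inter> Y closure_of (q ` c)))" if c: "c \<in> F" for c
    proof -
      obtain d t where "admissible n d t" "c = cell n d t" using F(2) c by blast
      then have "closedin Y (A \<inter> Y closure_of (q ` c))" using cl[OF cells_I] by simp
      then have "closedin (cartesian_power n X) (?pre (A \<inter> Y closure_of (q ` c)))"
        by (rule closedin_continuous_map_preimage[OF quotient_imp_continuous_map[OF quotient]])
      then show ?thesis using C by (simp only: cartesian_power_def closedin_kification)
    qed
    have "C \<inter> ?pre A = (\<Union>c\<in>F. C \<inter> ?pre (A \<inter> Y closure_of (q ` c)))"
    proof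
      show "C \<inter> ?pre A \<subseteq> (\<Union>c\<in>F. C \<inter> ?pre (A \<inter> Y closure_of (q ` c)))"
      proof
        fix x assume x: "x \<in> C \<inter> ?pre A"
        then obtain c where c: "c \<in> F" "x \<in> c" using F(3) by blast
        then obtain d t where "admissible n d t" "c = cell n d t" using F(2) by blast
        then have "q ` c \<subseteq> topspace Y" using cell_image by simp
        then have "q ` c \<subseteq> Y closure_of (q ` c)" by (rule closure_of_subset)
        then have "q x \<in> Y closure_of (q ` c)" using c(2) by (rule subsetD[OF _ imageI])
        then show "x \<in> (\<Union>c\<in>F. C \<inter> ?pre (A \<inter> Y closure_of (q ` c)))"
          using x c(1) by (intro UN_I[of c]) simp_all
      qed
    qed blast
    moreover have "closedin (subtopology ?P C) (\<Union>c\<in>F. C \<inter> ?pre (A \<inter> Y closure_of (q ` c)))"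
      using F(1) closed by (intro closedin_Union) auto
    ultimately show "closedin (subtopology ?P C) (C \<inter> {x \<in> topspace (kification ?P). q x \<in> A})"
      by (simp only: cartesian_power_def)
  qed
  then show ?thesis using quotient A by (simp add: quotient_map_closedin)
qed

theorem cell_decomposition_cells: "cell_decomposition Y cells"
  unfolding cell_decomposition_def
proof (intro conjI)
  show "Hausdorff_space Y" by (rule hausdorff)
  show "(\<Union>k. \<Union>(cells k)) = topspace Y" by (rule cells_cover)
  show "\<forall>j k. \<forall>e\<in>cells j. \<forall>f\<in>cells k. e \<inter> f \<noteq> {} \<longrightarrow> j = k \<and> e = f"
  proof (intro allI ballI impI)
    fix j k e f assume ef: "e \<in> cells j" "f \<in> cells k" "e \<inter> f \<noteq> {}"
    obtain t where t: "admissible n j t" "e = q ` cell n j t" by (rule cells_E[OF ef(1)])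
    obtain t' where t': "admissible n k t'" "f = q ` cell n k t'" by (rule cells_E[OF ef(2)])
    obtain z where z: "z \<in> e" "z \<in> f" using ef(3) by blast
    obtain s where s: "s \<in> open_simplex j" "z = q (realize n j t s)" using z(1) t(2) by (auto simp: cell_def)
    obtain s' where s': "s' \<in> open_simplex k" "z = q (realize n k t' s')" using z(2) t'(2) by (auto simp: cell_def)
    have "q (realize n j t s) = q (realize n k t' s')" using s(2) s'(2) by simp
    note same = identified_cells[OF t(1) t'(1) s(1) s'(1) this]
    from same(1,3) show "j = k \<and> e = f" using t(2) t'(2) by simp
  qed
  show "\<forall>k. \<forall>e\<in>cells k. \<exists>\<phi>. characteristic_map Y cells k e \<phi>"
  proof (intro allI ballI)
    fix k e assume "e \<in> cells k"
    then obtain t where t: "admissible n k t" "e = q ` cell n k t" by (rule cells_E)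
    from characteristic_map_cell[OF t(1)] show "\<exists>\<phi>. characteristic_map Y cells k e \<phi>"
      unfolding t(2) by (rule exI[of "characteristic_map Y cells k (q ` cell n k t)"])
  qed
  show "\<forall>A\<subseteq>topspace Y. (\<forall>k. \<forall>e\<in>cells k. closedin Y (A \<inter> Y closure_of e)) \<longrightarrow> closedin Y A"
  proof (intro allI impI)
    fix A assume "A \<subseteq> topspace Y" "\<forall>k. \<forall>e\<in>cells k. closedin Y (A \<inter> Y closure_of e)"
    then show "closedin Y A" by - (rule closedin_by_cells, auto)
  qed
qed

lemma skeleton_cells:
  "skeleton cells k = q ` {x \<in> topspace (cartesian_power n X). card (all_jumps (x ` {..<n})) \<le> Suc k}"
proof
  show "skeleton cells k \<subseteq> q ` {x \<in> topspace (cartesian_power n X). card (all_jumps (x ` {..<n})) \<le> Suc k}"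
  proof
    fix y assume "y \<in> skeleton cells k"
    then obtain d t s where t: "d \<le> k" "admissible n d t" "s \<in> open_simplex d" "y = q (realize n d t s)"
      by (auto simp: skeleton_def cells_def cell_def)
    then show "y \<in> q ` {x \<in> topspace (cartesian_power n X). card (all_jumps (x ` {..<n})) \<le> Suc k}"
      using card_all_jumps_open[OF n_pos t(2,3)] realize_open_in_power[OF t(2,3)]
      by (intro image_eqI[of _ _ "realize n d t s"]) simp_all
  qed
  show "q ` {x \<in> topspace (cartesian_power n X). card (all_jumps (x ` {..<n})) \<le> Suc k} \<subseteq> skeleton cells k"
  proof (rule image_subsetI, elim CollectE conjE)
    fix x assume x: "x \<in> topspace (cartesian_power n X)" "card (all_jumps (x ` {..<n})) \<le> Suc k"
    obtain d t s where t: "admissible n d t" "s \<in> open_simplex d" "x = realize n d t s"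
      by (rule power_covered[OF n_pos x(1)])
    then have "d \<le> k" using card_all_jumps_open[OF n_pos t(1,2)] x(2) by simp
    then show "q x \<in> skeleton cells k"
      using t by (auto simp: skeleton_def cells_def cell_def)
  qed
qed

text \<open>Being a union of cells means that membership is independent of the lengths.\<close>

lemma subcomplexI:
  assumes A: "A \<subseteq> topspace Y"
    and closed: "closedin (cartesian_power n X) {x \<in> topspace (cartesian_power n X). q x \<in> A}"
    and invariant: "\<And>d t s r. admissible n d t \<Longrightarrow> s \<in> open_simplex d \<Longrightarrow> r \<in> open_simplex d \<Longrightarrow>
      q (realize n d t s) \<in> A \<Longrightarrow> q (realize n d t r) \<in> A"
  shows "subcomplex Y cells A"
  unfolding subcomplex_def
proof (intro conjI exI[of _ "\<lambda>k. {e \<in> cells k. e \<subseteq> A}"] allI)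
  show "closedin Y A" using closed A quotient by (simp add: quotient_map_closedin)
  show "A = (\<Union>k. \<Union>{e \<in> cells k. e \<subseteq> A})"
  proof
    show "A \<subseteq> (\<Union>k. \<Union>{e \<in> cells k. e \<subseteq> A})"
    proof
      fix y assume y: "y \<in> A"
      then obtain k e where e: "e \<in> cells k" "y \<in> e" using A cells_cover by blast
      then obtain t s where t: "admissible n k t" "e = q ` cell n k t" "s \<in> open_simplex k" "y = q (realize n k t s)"
        by (auto simp: cells_def cell_def)
      have "e \<subseteq> A"
        using invariant[OF t(1,3)] y t(4) by (auto simp: t(2) cell_def)
      then show "y \<in> (\<Union>k. \<Union>{e \<in> cells k. e \<subseteq> A})" using e by blast
    qed
  qed blast
qed blast

lemma compactin_lift:
  assumes "compactin Y C"
  shows "\<exists>D. compactin (cartesian_power n X) D \<and> C \<subseteq> q ` D"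
proof -
  obtain F where F: "finite F" "F \<subseteq> (\<Union>k. cells k)" "C \<subseteq> \<Union>F"
    using cell_decomposition_compactin[OF cell_decomposition_cells assms] by (elim exE conjE) (rule that)
  have "\<forall>e\<in>F. \<exists>D. compactin (cartesian_power n X) D \<and> e \<subseteq> q ` D"
  proof
    fix e assume "e \<in> F"
    then obtain k where "e \<in> cells k" using F(2) by blast
    then obtain t where t: "admissible n k t" "e = q ` cell n k t" by (rule cells_E)
    let ?D = "(\<lambda>x. realize n k t (disk_to_simplex k x)) ` topspace (disk k)"
    have "compactin (cartesian_power n X) ?D"
      using compact_space_disk continuous_map_realize[OF t(1)]
      unfolding compact_space_def by (rule image_compactin)
    moreover have "e \<subseteq> q ` ?D"
    proof
      fix z assume "z \<in> e"
      then obtain s where s: "s \<in> open_simplex k" "z = q (realize n k t s)" using t(2) by (auto simp: cell_def)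
      obtain x where x: "x \<in> open_disk k" "\<forall>i\<le>k. disk_to_simplex k x i = s i"
        using disk_to_simplex_surj[OF s(1)] by blast
      then have "realize n k t (disk_to_simplex k x) = realize n k t s" by (intro realize_cong) simp
      moreover have "x \<in> topspace (disk k)" using x(1) by (simp add: open_disk_radius topspace_disk)
      ultimately show "z \<in> q ` ?D" using s(2) by (metis image_eqI)
    qed
    ultimately show "\<exists>D. compactin (cartesian_power n X) D \<and> e \<subseteq> q ` D" by blast
  qed
  from bchoice[OF this] obtain D where D: "\<forall>e\<in>F. compactin (cartesian_power n X) (D e) \<and> e \<subseteq> q ` D e" ..
  then have "compactin (cartesian_power n X) (\<Union>(D ` F))"
    using F(1) by (intro compactin_Union) auto
  moreover have "C \<subseteq> q ` \<Union>(D ` F)"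
  proof
    fix z assume "z \<in> C"
    then obtain e where "e \<in> F" "z \<in> e" using F(3) by blast
    moreover from this D have "z \<in> q ` D e" by blast
    ultimately show "z \<in> q ` \<Union>(D ` F)" by blast
  qed
  ultimately show ?thesis by blast
qed

end

section \<open>Symmetric products and spaces of finite subsets\<close>

lemma skeleton_product_cells:
  "skeleton (product_cells E F) k = (\<Union>i\<le>k. skeleton E i \<times> skeleton F (k - i))"
proof
  show "skeleton (product_cells E F) k \<subseteq> (\<Union>i\<le>k. skeleton E i \<times> skeleton F (k - i))"
  proof
    fix p assume "p \<in> skeleton (product_cells E F) k"
    then obtain m c where mc: "m \<le> k" "c \<in> product_cells E F m" "p \<in> c" by (auto simp: skeleton_def)
    from mc(2) obtain e f i j where *: "c = e \<times> f" "e \<in> E i" "f \<in> F j" "i + j = m"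
      unfolding product_cells_def by (elim CollectE exE conjE) (rule that)
    have "i \<le> k" using *(4) mc(1) by simp
    moreover have "fst p \<in> skeleton E i"
      unfolding skeleton_def by (rule UN_I[of i]) (use * mc(3) in auto)
    moreover have "snd p \<in> skeleton F (k - i)"
      unfolding skeleton_def by (rule UN_I[of j]) (use * mc(1,3) in auto)
    ultimately show "p \<in> (\<Union>i\<le>k. skeleton E i \<times> skeleton F (k - i))"
      by (intro UN_I[of i]) (auto simp: mem_Times_iff)
  qed
  show "(\<Union>i\<le>k. skeleton E i \<times> skeleton F (k - i)) \<subseteq> skeleton (product_cells E F) k"
  proof (rule UN_least, rule subsetI)
    fix i p assume i: "i \<in> {..k}" and p: "p \<in> skeleton E i \<times> skeleton F (k - i)"
    from p obtain a e where a: "a \<le> i" "e \<in> E a" "fst p \<in> e" by (auto simp: skeleton_def)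
    from p obtain b f where b: "b \<le> k - i" "f \<in> F b" "snd p \<in> f" by (auto simp: skeleton_def)
    have "e \<times> f \<in> product_cells E F (a + b)" unfolding product_cells_def using a b by blast
    moreover have "a + b \<le> k" using a b i by simp
    moreover have "p \<in> e \<times> f" using a b by (simp add: mem_Times_iff)
    ultimately show "p \<in> skeleton (product_cells E F) k"
      unfolding skeleton_def by (intro UN_I[of "a + b"] UnionI[of "e \<times> f"]) simp_all
  qed
qed

lemma sum_mset_unordered:
  fixes f :: "'a \<Rightarrow> real"
  shows "sum_mset (image_mset f (unordered n x)) = (\<Sum>i<n. f (x i))"
  by (simp add: unordered_def image_mset.compositionality comp_def sum_unfold_sum_mset)

lemma sum_mset_supported_at:
  fixes f :: "'a \<Rightarrow> real"
  assumes "\<And>z. z \<in># A \<Longrightarrow> z \<noteq> x \<Longrightarrow> f z = 0"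
  shows "sum_mset (image_mset f A) = real (count A x) * f x"
  using assms by (induction A) (auto simp: algebra_simps)

definition append_tuple :: "nat \<Rightarrow> nat \<Rightarrow> (nat \<Rightarrow> 'a) \<Rightarrow> (nat \<Rightarrow> 'a) \<Rightarrow> nat \<Rightarrow> 'a" where
  "append_tuple r s a b = (\<lambda>i\<in>{..<r + s}. if i < r then a i else b (i - r))"

lemma unordered_append: "unordered (r + s) (append_tuple r s a b) = unordered r a + unordered s b"
proof -
  have split: "mset_set {..<r + s} = mset_set {..<r} + mset_set ((+) r ` {..<s})"
  proof -
    have "(+) r ` {..<s} = {r..<r + s}"
      by (simp add: lessThan_atLeast0 add.commute)
    then have "{..<r + s} = {..<r} \<union> (+) r ` {..<s}" by auto
    moreover have "{..<r} \<inter> (+) r ` {..<s} = {}" by auto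
    ultimately show ?thesis by (simp add: mset_set_Union)
  qed
  have "image_mset (append_tuple r s a b) (mset_set {..<r}) = image_mset a (mset_set {..<r})"
    by (intro image_mset_cong) (auto simp: append_tuple_def)
  moreover have "image_mset (append_tuple r s a b) (mset_set ((+) r ` {..<s})) = image_mset b (mset_set {..<s})"
  proof -
    have "mset_set ((+) r ` {..<s}) = image_mset ((+) r) (mset_set {..<s})"
      by (simp add: image_mset_mset_set)
    then show ?thesis
      by (simp add: image_mset.compositionality comp_def) (auto simp: append_tuple_def intro!: image_mset_cong)
  qed
  ultimately show ?thesis by (simp add: unordered_def split)
qed

lemma image_append: "append_tuple r s a b ` {..<r + s} = a ` {..<r} \<union> b ` {..<s}"
  using arg_cong[OF unordered_append[of r s a b], of set_mset] by (simp add: set_mset_unordered)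

lemma continuous_map_power_coord: "i < n \<Longrightarrow> continuous_map (cartesian_power n X) X (\<lambda>x. x i)"
  unfolding cartesian_power_def
  by (intro continuous_map_from_kification continuous_map_product_projection) simp

lemma continuous_map_set_mset:
  assumes "1 \<le> n" shows "continuous_map (SP n X) (Sub n X) set_mset"
proof (rule continuous_compose_quotient_map[OF quotient_map_SP])
  have "continuous_map (cartesian_power n X) (Sub n X) (\<lambda>x. x ` {..<n})"
    using quotient_map_Sub[OF assms] by (rule quotient_imp_continuous_map)
  then show "continuous_map (cartesian_power n X) (Sub n X) (set_mset \<circ> unordered n)"
    by (simp add: comp_def set_mset_unordered)
qed

context triangulated_space
begin

lemma continuous_map_append_tuple:
  "continuous_map (k_prod_topology (cartesian_power r X) (cartesian_power s X)) (cartesian_power (r + s) X)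
     (\<lambda>(a, b). append_tuple r s a b)"
proof (rule continuous_map_into_power)
  show "k_space (k_prod_topology (cartesian_power r X) (cartesian_power s X))"
    by (simp add: k_prod_topology_def)
  show "(case z of (a, b) \<Rightarrow> append_tuple r s a b) \<in> extensional {..<r + s}" for z
    by (simp add: append_tuple_def split: prod.split)
  fix i assume i: "i < r + s"
  let ?P = "prod_topology (cartesian_power r X) (cartesian_power s X)"
  have "continuous_map ?P X (\<lambda>z. (case z of (a, b) \<Rightarrow> append_tuple r s a b) i)"
  proof (cases "i < r")
    case True
    have "continuous_map ?P X (\<lambda>z. fst z i)"
      using continuous_map_compose[OF continuous_map_fst continuous_map_power_coord[OF True]] by (simp add: comp_def)
    then show ?thesis using True i by (simp add: append_tuple_def case_prod_unfold)
  next
    case False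
    have "i - r < s" using False i by simp
    have "continuous_map ?P X (\<lambda>z. snd z (i - r))"
      using continuous_map_compose[OF continuous_map_snd continuous_map_power_coord[OF \<open>i - r < s\<close>]] by (simp add: comp_def)
    then show ?thesis using False i by (simp add: append_tuple_def case_prod_unfold)
  qed
  then show "continuous_map (k_prod_topology (cartesian_power r X) (cartesian_power s X)) X
      (\<lambda>z. (case z of (a, b) \<Rightarrow> append_tuple r s a b) i)"
    unfolding k_prod_topology_def by (rule continuous_map_from_kification)
qed

text \<open>For each \<open>y\<close> in \<open>B\<close> take the distance of a function separating \<open>x\<close> from \<open>y\<close> to its value at \<open>y\<close>, and multiply
  these distances.\<close>

lemma bump:
  assumes "finite B" "B \<subseteq> topspace X" "x \<in> topspace X" "x \<notin> B"
  shows "\<exists>f. continuous_map X euclideanreal f \<and> (\<forall>z. 0 \<le> f z) \<and> f x \<noteq> 0 \<and> (\<forall>y\<in>B. f y = 0)"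
proof -
  have "\<forall>y\<in>B. \<exists>g. continuous_map X euclideanreal g \<and> g x \<noteq> g y"
    using assms separated by (metis subsetD)
  from bchoice[OF this] obtain g where g: "\<forall>y\<in>B. continuous_map X euclideanreal (g y) \<and> g y x \<noteq> g y y" ..
  let ?f = "\<lambda>z. \<Prod>y\<in>B. \<bar>g y z - g y y\<bar>"
  have "continuous_map X euclideanreal ?f"
    using assms(1) g by (intro continuous_intros) auto
  moreover have "?f x \<noteq> 0" using g assms(1) by simp
  moreover have "\<forall>y\<in>B. ?f y = 0" using assms(1) by (auto intro: prod_zero)
  ultimately show ?thesis by (intro exI[of _ ?f]) (simp add: prod_nonneg)
qed

lemma Hausdorff_space_X: "Hausdorff_space X"
  by (rule Hausdorff_space_functions) (rule separated)

lemma Hausdorff_cartesian_power: "Hausdorff_space (cartesian_power n X)"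
proof (rule Hausdorff_space_functions)
  fix x y assume xy: "x \<in> topspace (cartesian_power n X)" "y \<in> topspace (cartesian_power n X)" "x \<noteq> y"
  then obtain i where i: "i < n" "x i \<noteq> y i" by (auto dest: PiE_ext)
  moreover have "x i \<in> topspace X" "y i \<in> topspace X" using xy i(1) by (auto simp: PiE_iff)
  ultimately obtain f where f: "continuous_map X euclideanreal f" "f (x i) \<noteq> f (y i)"
    using separated by blast
  have "continuous_map (cartesian_power n X) euclideanreal (\<lambda>x. f (x i))"
    using continuous_map_compose[OF continuous_map_power_coord[OF i(1)] f(1)] by (simp add: comp_def)
  then show "\<exists>f. continuous_map (cartesian_power n X) euclideanreal f \<and> f x \<noteq> f y"
    using f(2) by (intro exI[of _ "\<lambda>x. f (x i)"] conjI)
qed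

text \<open>Let \<open>x\<close> have different multiplicities in two multisets. For a function that vanishes at all their other elements,
  the sums of its values are these multiplicities times its value at \<open>x\<close>.\<close>

lemma Hausdorff_SP: "Hausdorff_space (SP n X)"
proof (rule Hausdorff_space_functions)
  fix A B assume AB: "A \<in> topspace (SP n X)" "B \<in> topspace (SP n X)" "A \<noteq> B"
  then obtain x where x: "count A x \<noteq> count B x" by (auto simp: multiset_eq_iff)
  then have "x \<in># A \<or> x \<in># B" by (metis not_in_iff)
  then have "x \<in> topspace X" using AB by auto
  moreover have "set_mset (A + B) - {x} \<subseteq> topspace X" using AB by auto
  ultimately obtain f where f: "continuous_map X euclideanreal f" "f x \<noteq> 0"
    "\<forall>y\<in>set_mset (A + B) - {x}. f y = 0"
    using bump[of "set_mset (A + B) - {x}" x] by auto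
  let ?F = "\<lambda>A. sum_mset (image_mset f A)"
  have "continuous_map (SP n X) euclideanreal ?F"
  proof (rule continuous_compose_quotient_map[OF quotient_map_SP])
    have "continuous_map (cartesian_power n X) euclideanreal (\<lambda>x. \<Sum>i<n. f (x i))"
      using continuous_map_compose[OF continuous_map_power_coord f(1), of _ n]
      by (intro continuous_map_sum) (simp_all add: comp_def)
    then show "continuous_map (cartesian_power n X) euclideanreal (?F \<circ> unordered n)"
      by (simp add: comp_def sum_mset_unordered)
  qed
  moreover have "?F A = real (count A x) * f x" "?F B = real (count B x) * f x"
    using f(3) by (auto intro!: sum_mset_supported_at)
  then have "?F A \<noteq> ?F B" using x f(2) by simp
  ultimately show "\<exists>F. continuous_map (SP n X) euclideanreal F \<and> F A \<noteq> F B" by blast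
qed

text \<open>The maximum of a nonnegative function over a finite set depends continuously on the set, and for a function
  vanishing on \<open>T\<close> but not at a point of \<open>S\<close> it tells the two sets apart.\<close>

lemma Sub_separation:
  assumes n: "1 \<le> n" and S: "S \<in> topspace (Sub n X)" and T: "T \<in> topspace (Sub n X)" and x: "x \<in> S" "x \<notin> T"
  shows "\<exists>F. continuous_map (Sub n X) euclideanreal F \<and> F S \<noteq> F T"
proof -
  obtain f where f: "continuous_map X euclideanreal f" "\<forall>z. 0 \<le> f z" "f x \<noteq> 0" "\<forall>y\<in>T. f y = 0"
    using bump[of T x] S T x by auto
  let ?F = "\<lambda>S. Max (f ` S)"
  have "continuous_map (Sub n X) euclideanreal ?F"
  proof (rule continuous_compose_quotient_map[OF quotient_map_Sub[OF n]])
    have "continuous_map (cartesian_power n X) euclideanreal (\<lambda>x. Max ((\<lambda>i. f (x i)) ` {..<n}))"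
      using continuous_map_compose[OF continuous_map_power_coord f(1), of _ n] n
      by (intro continuous_map_Max) (auto simp: comp_def lessThan_empty_iff)
    then show "continuous_map (cartesian_power n X) euclideanreal (?F \<circ> (\<lambda>x. x ` {..<n}))"
      by (simp add: comp_def image_image)
  qed
  moreover have "f x \<le> ?F S" using S x by (intro Max_ge) auto
  then have "0 < ?F S" using f(2,3) by (metis less_le order_less_le_trans)
  moreover have "f ` T = {0}" using f(4) T by (auto simp: image_iff) 
  ultimately show ?thesis by (intro exI[of _ ?F]) auto
qed

lemma Hausdorff_Sub: "1 \<le> n \<Longrightarrow> Hausdorff_space (Sub n X)"
proof (rule Hausdorff_space_functions)
  fix S T assume n: "1 \<le> n" and ST: "S \<in> topspace (Sub n X)" "T \<in> topspace (Sub n X)" "S \<noteq> T"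
  then consider x where "x \<in> S" "x \<notin> T" | x where "x \<in> T" "x \<notin> S" by blast
  then show "\<exists>F. continuous_map (Sub n X) euclideanreal F \<and> F S \<noteq> F T"
  proof cases
    case 1
    then show ?thesis using Sub_separation[OF n ST(1,2)] by simp
  next
    case 2
    then show ?thesis using Sub_separation[OF n ST(2,1)] by metis
  qed
qed

lemma tuple_quotient_power:
  assumes "1 \<le> n" shows "tuple_quotient le X L h n (\<lambda>x. x) (cartesian_power n X)"
proof (unfold_locales)
  show "0 < n" using assms by simp
  show "quotient_map (cartesian_power n X) (cartesian_power n X) (\<lambda>x. x)"
  proof -
    have "{x \<in> topspace (cartesian_power n X). x \<in> U} = U" if "U \<subseteq> topspace (cartesian_power n X)" for U
      using that by blast
    then show ?thesis by (simp add: quotient_map_def del: topspace_cartesian_power)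
  qed
  show "Hausdorff_space (cartesian_power n X)" by (rule Hausdorff_cartesian_power)
  fix x x' y y' :: "nat \<Rightarrow> 'a"
  assume *: "x = x'" "\<And>i j. i < n \<Longrightarrow> j < n \<Longrightarrow> x i = x' j \<Longrightarrow> y i = y' j"
    "y \<in> topspace (cartesian_power n X)" "y' \<in> topspace (cartesian_power n X)"
  show "y = y'"
  proof (rule PiE_ext)
    show "y \<in> (\<Pi>\<^sub>E i\<in>{..<n}. topspace X)" "y' \<in> (\<Pi>\<^sub>E i\<in>{..<n}. topspace X)" using *(3,4) by simp_all
  qed (use * in auto)
qed simp

lemma tuple_quotient_SP:
  assumes "1 \<le> n" shows "tuple_quotient le X L h n (unordered n) (SP n X)"
proof (unfold_locales)
  show "0 < n" using assms by simp
  show "quotient_map (cartesian_power n X) (SP n X) (unordered n)" by (rule quotient_map_SP)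
  show "Hausdorff_space (SP n X)" by (rule Hausdorff_SP)
  show "x ` {..<n} = y ` {..<n}" if "unordered n x = unordered n y" for x y :: "nat \<Rightarrow> 'a"
    using arg_cong[OF that, of set_mset] by (simp add: set_mset_unordered)
  fix x x' y y' :: "nat \<Rightarrow> 'a"
  assume *: "unordered n x = unordered n x'" "\<And>i j. i < n \<Longrightarrow> j < n \<Longrightarrow> x i = x' j \<Longrightarrow> y i = y' j"
  obtain p where p: "p permutes {..<n}" "\<forall>i<n. x i = x' (p i)"
    using *(1) unfolding unordered_eq_iff by blast
  have "p i < n" if "i < n" for i using permutes_in_image[OF p(1), of i] that by simp
  then show "unordered n y = unordered n y'"
    unfolding unordered_eq_iff using p *(2) by (intro exI[of _ p]) simp
qed

lemma tuple_quotient_Sub: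
  assumes "1 \<le> n" shows "tuple_quotient le X L h n (\<lambda>x. x ` {..<n}) (Sub n X)"
proof (unfold_locales)
  show "0 < n" using assms by simp
  show "quotient_map (cartesian_power n X) (Sub n X) (\<lambda>x. x ` {..<n})"
    using assms by (rule quotient_map_Sub)
  show "Hausdorff_space (Sub n X)" using assms by (rule Hausdorff_Sub)
  fix x x' y y' :: "nat \<Rightarrow> 'a"
  assume im: "x ` {..<n} = x' ` {..<n}" and *: "\<And>i j. i < n \<Longrightarrow> j < n \<Longrightarrow> x i = x' j \<Longrightarrow> y i = y' j"
  show "y ` {..<n} = y' ` {..<n}"
  proof
    show "y ` {..<n} \<subseteq> y' ` {..<n}"
    proof (rule image_subsetI)
      fix i assume i: "i \<in> {..<n}"
      then have "x i \<in> x' ` {..<n}" using im by blast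
      then obtain j where "j < n" "x i = x' j" by blast
      then show "y i \<in> y' ` {..<n}" using * i by auto
    qed
    show "y' ` {..<n} \<subseteq> y ` {..<n}"
    proof (rule image_subsetI)
      fix j assume j: "j \<in> {..<n}"
      then have "x' j \<in> x ` {..<n}" using im by blast
      then obtain i where "i < n" "x i = x' j" by force
      then show "y' j \<in> y ` {..<n}" using *[of i j] j by force
    qed
  qed
qed

definition power_cells :: "nat \<Rightarrow> nat \<Rightarrow> (nat \<Rightarrow> 'a) set set" where
  "power_cells n = tuple_quotient.cells le L h n (\<lambda>x. x)"

definition SP_cells :: "nat \<Rightarrow> nat \<Rightarrow> 'a multiset set set" where
  "SP_cells n = tuple_quotient.cells le L h n (unordered n)"

definition Sub_cells :: "nat \<Rightarrow> nat \<Rightarrow> 'a set set set" where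
  "Sub_cells n = tuple_quotient.cells le L h n (\<lambda>x. x ` {..<n})"

lemma skeleton_power:
  assumes "1 \<le> n"
  shows "skeleton (power_cells n) k =
    {x \<in> topspace (cartesian_power n X). card (all_jumps (x ` {..<n})) \<le> Suc k}"
  using tuple_quotient.skeleton_cells[OF tuple_quotient_power[OF assms], of k] by (simp add: power_cells_def)

lemma skeleton_SP:
  assumes "1 \<le> n"
  shows "skeleton (SP_cells n) k = {A \<in> topspace (SP n X). card (all_jumps (set_mset A)) \<le> Suc k}"
proof -
  have "skeleton (SP_cells n) k =
      unordered n ` {x \<in> topspace (cartesian_power n X). card (all_jumps (x ` {..<n})) \<le> Suc k}"
    using tuple_quotient.skeleton_cells[OF tuple_quotient_SP[OF assms]] by (simp add: SP_cells_def)
  also have "\<dots> = {A \<in> unordered n ` topspace (cartesian_power n X). card (all_jumps (set_mset A)) \<le> Suc k}"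
    by (auto simp: set_mset_unordered simp del: topspace_cartesian_power)
  also have "\<dots> = {A \<in> topspace (SP n X). card (all_jumps (set_mset A)) \<le> Suc k}"
    by (simp only: image_unordered topspace_SP)
  finally show ?thesis .
qed

lemma skeleton_Sub:
  assumes "1 \<le> n"
  shows "skeleton (Sub_cells n) k = {S \<in> topspace (Sub n X). card (all_jumps S) \<le> Suc k}"
proof -
  have "skeleton (Sub_cells n) k =
      (\<lambda>x. x ` {..<n}) ` {x \<in> topspace (cartesian_power n X). card (all_jumps (x ` {..<n})) \<le> Suc k}"
    using tuple_quotient.skeleton_cells[OF tuple_quotient_Sub[OF assms]] by (simp add: Sub_cells_def)
  also have "\<dots> = {S \<in> (\<lambda>x. x ` {..<n}) ` topspace (cartesian_power n X). card (all_jumps S) \<le> Suc k}"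
    by (auto simp del: topspace_cartesian_power)
  also have "\<dots> = {S \<in> topspace (Sub n X). card (all_jumps S) \<le> Suc k}"
    by (simp only: image_Sub[OF assms] topspace_Sub)
  finally show ?thesis .
qed

lemma all_jumps_finite_set:
  assumes S: "finite S" "S \<noteq> {}" "S \<subseteq> topspace X"
  shows "finite (all_jumps S)" "1 \<in> all_jumps S"
proof -
  have "0 < card S" using S by (simp add: card_gt_0_iff)
  then have "S \<in> topspace (Sub (card S) X)" using S by auto
  then have "S \<in> (\<lambda>x. x ` {..<card S}) ` topspace (cartesian_power (card S) X)"
    using image_Sub[of "card S" X] \<open>0 < card S\<close> by simp
  then obtain x where x: "x \<in> topspace (cartesian_power (card S) X)" "S = x ` {..<card S}" by blast
  obtain d t s where t: "admissible (card S) d t" "s \<in> open_simplex d" "x = realize (card S) d t s"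
    by (rule power_covered[OF \<open>0 < card S\<close> x(1)])
  have eq: "all_jumps S = partial_sum s ` {1..Suc d}"
    using all_jumps_open[OF \<open>0 < card S\<close> t(1,2)] x(2) t(3) by simp
  then show "finite (all_jumps S)" by simp
  have "partial_sum s (Suc d) = 1" using t(2) by (simp add: open_simplex_def partial_sum_def lessThan_Suc_atMost)
  then show "1 \<in> all_jumps S" unfolding eq by (intro image_eqI[of _ _ "Suc d"]) auto
qed

lemma all_jumps_Un: "all_jumps (S \<union> T) = all_jumps S \<union> all_jumps T"
  by (auto simp: all_jumps_def)

text \<open>The jump \<open>1\<close> is common to both sets, which is why dimensions, one less than numbers of jumps, add up.\<close>

lemma card_all_jumps_Un:
  assumes "finite S" "S \<noteq> {}" "S \<subseteq> topspace X" "finite T" "T \<noteq> {}" "T \<subseteq> topspace X"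
    and "card (all_jumps S) \<le> Suc i" "card (all_jumps T) \<le> Suc j"
  shows "card (all_jumps (S \<union> T)) \<le> Suc (i + j)"
proof -
  note S = all_jumps_finite_set[OF assms(1-3)] and T = all_jumps_finite_set[OF assms(4-6)]
  have "0 < card (all_jumps S \<inter> all_jumps T)"
    using S T by (auto simp: card_gt_0_iff)
  then show ?thesis
    using card_Un_Int[OF S(1) T(1)] assms(7,8) unfolding all_jumps_Un by linarith
qed

lemma closedin_coords_eq:
  assumes "i < n" "j < n"
  shows "closedin (cartesian_power n X) {x \<in> topspace (cartesian_power n X). x i = x j}"
  by (rule closedin_continuous_maps_eq[OF Hausdorff_space_X]) (use assms in \<open>auto intro: continuous_map_power_coord\<close>)

lemma closedin_fat_diagonal: "closedin (cartesian_power n X) (fat_diagonal n X)"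
proof -
  have "fat_diagonal n X = (\<Union>(i, j)\<in>{(i, j). i < n \<and> j < n \<and> i \<noteq> j}.
      {x \<in> topspace (cartesian_power n X). x i = x j})"
    by (auto simp: fat_diagonal_def simp del: topspace_cartesian_power)
  moreover have "finite {(i, j). i < n \<and> j < n \<and> i \<noteq> j}"
    by (rule finite_subset[of _ "{..<n} \<times> {..<n}"]) auto
  ultimately show ?thesis
    using closedin_coords_eq by (auto intro!: closedin_Union simp del: topspace_cartesian_power)
qed

lemma fat_diagonal_realize:
  assumes "admissible n d t" "s \<in> open_simplex d" "r \<in> open_simplex d" "realize n d t s \<in> fat_diagonal n X"
  shows "realize n d t r \<in> fat_diagonal n X"
proof -
  obtain i j where ij: "i < n" "j < n" "i \<noteq> j" "realize n d t s i = realize n d t s j"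
    using assms(4) by (auto simp: fat_diagonal_def)
  have "realize n d t r i = realize n d t r j"
    by (rule coincidence_extends[OF assms(1,1) ij(1,2) assms(2) ij(4)])
  then show ?thesis
    using ij(1-3) realize_in_power[OF assms(1) open_simplex_closed_simplex[OF assms(3)]]
    unfolding fat_diagonal_def by blast
qed

lemma unordered_fat_diagonal:
  assumes x: "x \<in> topspace (cartesian_power n X)"
  shows "unordered n x \<in> unordered n ` fat_diagonal n X \<longleftrightarrow> x \<in> fat_diagonal n X"
proof
  assume "unordered n x \<in> unordered n ` fat_diagonal n X"
  then obtain y where y: "y \<in> fat_diagonal n X" "unordered n x = unordered n y" by blast
  then obtain p where p: "p permutes {..<n}" "\<forall>i<n. y i = x (p i)"
    using unordered_eq_iff[of n y x] by auto
  obtain i j where ij: "i < n" "j < n" "i \<noteq> j" "y i = y j" using y(1) by (auto simp: fat_diagonal_def)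
  have "p i < n" "p j < n" using permutes_in_image[OF p(1)] ij(1,2) by auto
  moreover have "p i \<noteq> p j" using permutes_inj[OF p(1)] ij(3) by (simp add: inj_eq)
  moreover have "x (p i) = x (p j)" using p(2) ij by simp
  ultimately show "x \<in> fat_diagonal n X" using x unfolding fat_diagonal_def by blast
qed blast

lemma subcomplex_fat_diagonal:
  assumes "1 \<le> n" shows "subcomplex (SP n X) (SP_cells n) (unordered n ` fat_diagonal n X)"
  unfolding SP_cells_def
proof (rule tuple_quotient.subcomplexI[OF tuple_quotient_SP[OF assms]])
  have sub: "fat_diagonal n X \<subseteq> topspace (cartesian_power n X)" unfolding fat_diagonal_def by blast
  show "unordered n ` fat_diagonal n X \<subseteq> topspace (SP n X)"
    using image_mono[OF sub, of "unordered n"] unfolding image_unordered topspace_SP .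
  have "{x \<in> topspace (cartesian_power n X). unordered n x \<in> unordered n ` fat_diagonal n X} = fat_diagonal n X"
    using unordered_fat_diagonal sub by blast
  then show "closedin (cartesian_power n X)
      {x \<in> topspace (cartesian_power n X). unordered n x \<in> unordered n ` fat_diagonal n X}"
    using closedin_fat_diagonal by (simp only:)
  fix d t s r
  assume *: "admissible n d t" "s \<in> open_simplex d" "r \<in> open_simplex d"
    "unordered n (realize n d t s) \<in> unordered n ` fat_diagonal n X"
  have "realize n d t s \<in> fat_diagonal n X"
    using unordered_fat_diagonal[OF realize_in_power[OF *(1) open_simplex_closed_simplex[OF *(2)]]] *(4) by blast
  then show "unordered n (realize n d t r) \<in> unordered n ` fat_diagonal n X"
    using fat_diagonal_realize[OF *(1-3)] by blast
qed

text \<open>Having fewer than \<open>n\<close> distinct entries means having a repeated entry, so the same closed set of tuples describes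
  both the fat diagonal and the subspace of smaller subsets.\<close>

lemma fat_diagonal_card:
  assumes "1 \<le> n" "x \<in> topspace (cartesian_power n X)"
  shows "x ` {..<n} \<in> topspace (Sub (n - 1) X) \<longleftrightarrow> x \<in> fat_diagonal n X"
proof -
  have "x ` {..<n} \<in> topspace (Sub (n - 1) X) \<longleftrightarrow> card (x ` {..<n}) \<le> n - 1"
    using assms by (auto simp: PiE_iff lessThan_empty_iff)
  also have "\<dots> \<longleftrightarrow> card (x ` {..<n}) \<noteq> card {..<n}"
    using card_image_le[of "{..<n}" x] assms(1) by auto
  also have "\<dots> \<longleftrightarrow> \<not> inj_on x {..<n}" using eq_card_imp_inj_on[of "{..<n}" x] card_image[of x "{..<n}"] by auto
  also have "\<dots> \<longleftrightarrow> x \<in> fat_diagonal n X"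
    using assms(2) by (auto simp: fat_diagonal_def inj_on_def simp del: topspace_cartesian_power)
  finally show ?thesis .
qed

lemma subcomplex_Sub:
  assumes "1 \<le> n" shows "subcomplex (Sub n X) (Sub_cells n) (topspace (Sub (n - 1) X))"
  unfolding Sub_cells_def
proof (rule tuple_quotient.subcomplexI[OF tuple_quotient_Sub[OF assms]])
  show "topspace (Sub (n - 1) X) \<subseteq> topspace (Sub n X)" by auto
  have "{x \<in> topspace (cartesian_power n X). x ` {..<n} \<in> topspace (Sub (n - 1) X)} = fat_diagonal n X"
    using fat_diagonal_card[OF assms] unfolding fat_diagonal_def by blast
  then show "closedin (cartesian_power n X)
      {x \<in> topspace (cartesian_power n X). x ` {..<n} \<in> topspace (Sub (n - 1) X)}"
    using closedin_fat_diagonal by (simp only:)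
  fix d t s r
  assume *: "admissible n d t" "s \<in> open_simplex d" "r \<in> open_simplex d"
    "realize n d t s ` {..<n} \<in> topspace (Sub (n - 1) X)"
  have "realize n d t s \<in> fat_diagonal n X"
    using fat_diagonal_card[OF assms realize_in_power[OF *(1) open_simplex_closed_simplex[OF *(2)]]] *(4) by blast
  from fat_diagonal_realize[OF *(1-3) this]
  show "realize n d t r ` {..<n} \<in> topspace (Sub (n - 1) X)"
    using fat_diagonal_card[OF assms realize_in_power[OF *(1) open_simplex_closed_simplex[OF *(3)]]] by blast
qed

text \<open>A coordinate sitting at a vertex has a constant word, hence stays there throughout the cell.\<close>

lemma realize_at_vertex:
  assumes t: "admissible n d t" and s: "s \<in> open_simplex d" and r: "r \<in> open_simplex d" and i: "i < n"
    and v: "\<sigma> \<in> L" "v \<in> \<sigma>" and eq: "realize n d t s i = h (\<lambda>w. if w = v then 1 else 0)"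
  shows "realize n d t r i = h (\<lambda>w. if w = v then 1 else 0)"
proof -
  have "(\<lambda>w. if w = v then 1 else 0) \<in> closed_face \<sigma>"
    using v finite_simplex[OF v(1)] by (auto simp: closed_face_def)
  then have bary: "bary d (t i) s = (\<lambda>w. if w = v then 1 else 0)"
    using coord_realize[OF t open_simplex_closed_simplex[OF s] i] eq coord_h[OF _ v(1)] by simp
  have "t i j = v" if "j \<le> d" for j
  proof (rule ccontr)
    assume "t i j \<noteq> v"
    then have "bary d (t i) s (t i j) = 0" by (simp add: bary)
    moreover have "s j \<le> bary d (t i) s (t i j)"
      by (rule bary_ge) (use s that in \<open>auto simp: open_simplex_def less_imp_le\<close>)
    ultimately show False using s that by (auto simp: open_simplex_def not_less[symmetric])
  qed
  then have "bary d (t i) r = (\<lambda>w. if w = v then 1 else 0)"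
    using r by (auto simp: bary_def open_simplex_def)
  then show ?thesis using i by (simp add: realize_def)
qed

lemma subcomplex_basepoint:
  assumes n: "1 \<le> n" and v: "\<sigma> \<in> L" "v \<in> \<sigma>" and x0: "x0 = h (\<lambda>w. if w = v then 1 else 0)" "x0 \<in> topspace X"
  shows "subcomplex (SP n X) (SP_cells n) (add_mset x0 ` topspace (SP (n - 1) X))"
proof -
  have A: "add_mset x0 ` topspace (SP (n - 1) X) = {A \<in> topspace (SP n X). x0 \<in># A}"
  proof
    show "add_mset x0 ` topspace (SP (n - 1) X) \<subseteq> {A \<in> topspace (SP n X). x0 \<in># A}"
      using n x0(2) by auto
    show "{A \<in> topspace (SP n X). x0 \<in># A} \<subseteq> add_mset x0 ` topspace (SP (n - 1) X)"
    proof
      fix A assume "A \<in> {A \<in> topspace (SP n X). x0 \<in># A}"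
      then have "A = add_mset x0 (A - {#x0#})" "A - {#x0#} \<in> topspace (SP (n - 1) X)"
        by (auto simp: size_Diff_singleton dest: in_diffD)
      then show "A \<in> add_mset x0 ` topspace (SP (n - 1) X)" by blast
    qed
  qed
  have mem: "unordered n x \<in> {A \<in> topspace (SP n X). x0 \<in># A} \<longleftrightarrow> (\<exists>i<n. x i = x0)"
    if x: "x \<in> topspace (cartesian_power n X)" for x
  proof -
    have "unordered n x \<in> topspace (SP n X)"
      using imageI[OF x, of "unordered n"] unfolding image_unordered topspace_SP .
    then show ?thesis by (auto simp: set_mset_unordered simp del: topspace_SP)
  qed
  show ?thesis
    unfolding SP_cells_def A
  proof (rule tuple_quotient.subcomplexI[OF tuple_quotient_SP[OF n]])
    have "{x \<in> topspace (cartesian_power n X). unordered n x \<in> {A \<in> topspace (SP n X). x0 \<in># A}} =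
        (\<Union>i<n. {x \<in> topspace (cartesian_power n X). x i \<in> {x0}})"
      using mem by (auto simp del: topspace_cartesian_power topspace_SP)
    moreover have "closedin X {x0}"
      using Hausdorff_space_X x0(2) by (simp add: closedin_Hausdorff_singleton)
    then have "closedin (cartesian_power n X) {x \<in> topspace (cartesian_power n X). x i \<in> {x0}}" if "i < n" for i
      by (rule closedin_continuous_map_preimage[OF continuous_map_power_coord[OF that]])
    ultimately show "closedin (cartesian_power n X)
        {x \<in> topspace (cartesian_power n X). unordered n x \<in> {A \<in> topspace (SP n X). x0 \<in># A}}"
      by (auto intro!: closedin_Union simp del: topspace_cartesian_power)
    fix d t s r
    assume *: "admissible n d t" "s \<in> open_simplex d" "r \<in> open_simplex d"
      "unordered n (realize n d t s) \<in> {A \<in> topspace (SP n X). x0 \<in># A}"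
    then obtain i where i: "i < n" "realize n d t s i = x0"
      using mem[OF realize_in_power[OF *(1) open_simplex_closed_simplex[OF *(2)]]] by blast
    have "realize n d t r i = x0" using realize_at_vertex[OF *(1-3) i(1) v] i(2) x0(1) by simp
    then show "unordered n (realize n d t r) \<in> {A \<in> topspace (SP n X). x0 \<in># A}"
      using mem[OF realize_in_power[OF *(1) open_simplex_closed_simplex[OF *(3)]]] i(1) by blast
  qed blast
qed

text \<open>On tuples the pairing is juxtaposition, which is continuous; it descends because compact sets lift.\<close>

lemma continuous_map_SP_plus:
  assumes "1 \<le> r" "1 \<le> s"
  shows "continuous_map (k_prod_topology (SP r X) (SP s X)) (SP (r + s) X) (\<lambda>(A, B). A + B)"
proof (rule continuous_map_from_k_prod)
  show "Hausdorff_space (SP r X)" "Hausdorff_space (SP s X)" by (rule Hausdorff_SP)+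
  show "continuous_map (cartesian_power r X) (SP r X) (unordered r)"
    "continuous_map (cartesian_power s X) (SP s X) (unordered s)"
    by (rule quotient_imp_continuous_map[OF quotient_map_SP])+
  show "\<exists>D. compactin (cartesian_power r X) D \<and> C \<subseteq> unordered r ` D" if "compactin (SP r X) C" for C
    using tuple_quotient.compactin_lift[OF tuple_quotient_SP[OF assms(1)] that] .
  show "\<exists>D. compactin (cartesian_power s X) D \<and> C \<subseteq> unordered s ` D" if "compactin (SP s X) C" for C
    using tuple_quotient.compactin_lift[OF tuple_quotient_SP[OF assms(2)] that] .
  have "continuous_map (k_prod_topology (cartesian_power r X) (cartesian_power s X)) (SP (r + s) X)
      (unordered (r + s) \<circ> (\<lambda>(a, b). append_tuple r s a b))"
    by (rule continuous_map_compose[OF continuous_map_append_tuple quotient_imp_continuous_map[OF quotient_map_SP]])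
  then show "continuous_map (k_prod_topology (cartesian_power r X) (cartesian_power s X)) (SP (r + s) X)
      (\<lambda>(a, b). case (unordered r a, unordered s b) of (A, B) \<Rightarrow> A + B)"
    by (simp add: comp_def case_prod_unfold unordered_append)
qed

lemma continuous_map_Sub_Un:
  assumes "1 \<le> r" "1 \<le> s"
  shows "continuous_map (k_prod_topology (Sub r X) (Sub s X)) (Sub (r + s) X) (\<lambda>(S, T). S \<union> T)"
proof (rule continuous_map_from_k_prod)
  show "Hausdorff_space (Sub r X)" "Hausdorff_space (Sub s X)" using assms by (auto intro: Hausdorff_Sub)
  show "continuous_map (cartesian_power r X) (Sub r X) (\<lambda>x. x ` {..<r})"
    "continuous_map (cartesian_power s X) (Sub s X) (\<lambda>x. x ` {..<s})"
    using assms by (auto intro: quotient_imp_continuous_map[OF quotient_map_Sub])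
  show "\<exists>D. compactin (cartesian_power r X) D \<and> C \<subseteq> (\<lambda>x. x ` {..<r}) ` D" if "compactin (Sub r X) C" for C
    using tuple_quotient.compactin_lift[OF tuple_quotient_Sub[OF assms(1)] that] .
  show "\<exists>D. compactin (cartesian_power s X) D \<and> C \<subseteq> (\<lambda>x. x ` {..<s}) ` D" if "compactin (Sub s X) C" for C
    using tuple_quotient.compactin_lift[OF tuple_quotient_Sub[OF assms(2)] that] .
  have "1 \<le> r + s" using assms by simp
  have "continuous_map (k_prod_topology (cartesian_power r X) (cartesian_power s X)) (Sub (r + s) X)
      ((\<lambda>x. x ` {..<r + s}) \<circ> (\<lambda>(a, b). append_tuple r s a b))"
    by (rule continuous_map_compose[OF continuous_map_append_tuple
          quotient_imp_continuous_map[OF quotient_map_Sub[OF \<open>1 \<le> r + s\<close>]]])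
  then show "continuous_map (k_prod_topology (cartesian_power r X) (cartesian_power s X)) (Sub (r + s) X)
      (\<lambda>(a, b). case (a ` {..<r}, b ` {..<s}) of (S, T) \<Rightarrow> S \<union> T)"
    by (simp add: comp_def case_prod_unfold image_append)
qed

lemma cellular_SP_plus:
  assumes "1 \<le> r" "1 \<le> s"
  shows "cellular_map (k_prod_topology (SP r X) (SP s X)) (product_cells (SP_cells r) (SP_cells s))
          (SP (r + s) X) (SP_cells (r + s)) (\<lambda>(A, B). A + B)"
  unfolding cellular_map_def
proof (intro conjI allI continuous_map_SP_plus[OF assms] image_subsetI)
  fix k p assume "p \<in> skeleton (product_cells (SP_cells r) (SP_cells s)) k"
  then obtain i A B where p: "i \<le> k" "p = (A, B)" "A \<in> skeleton (SP_cells r) i" "B \<in> skeleton (SP_cells s) (k - i)"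
    unfolding skeleton_product_cells by blast
  have A: "size A = r" "set_mset A \<subseteq> topspace X" "card (all_jumps (set_mset A)) \<le> Suc i"
    using p(3) unfolding skeleton_SP[OF assms(1)] by simp_all
  have B: "size B = s" "set_mset B \<subseteq> topspace X" "card (all_jumps (set_mset B)) \<le> Suc (k - i)"
    using p(4) unfolding skeleton_SP[OF assms(2)] by simp_all
  have "set_mset A \<noteq> {}" "set_mset B \<noteq> {}" using A(1) B(1) assms by auto
  then have "card (all_jumps (set_mset A \<union> set_mset B)) \<le> Suc (i + (k - i))"
    using A B by (intro card_all_jumps_Un) simp_all
  moreover have "1 \<le> r + s" using assms by simp
  ultimately show "(case p of (A, B) \<Rightarrow> A + B) \<in> skeleton (SP_cells (r + s)) k"
    using A B p(1,2) by (simp add: skeleton_SP)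
qed

lemma cellular_Sub_Un:
  assumes "1 \<le> r" "1 \<le> s"
  shows "cellular_map (k_prod_topology (Sub r X) (Sub s X)) (product_cells (Sub_cells r) (Sub_cells s))
          (Sub (r + s) X) (Sub_cells (r + s)) (\<lambda>(S, T). S \<union> T)"
  unfolding cellular_map_def
proof (intro conjI allI continuous_map_Sub_Un[OF assms] image_subsetI)
  fix k p assume "p \<in> skeleton (product_cells (Sub_cells r) (Sub_cells s)) k"
  then obtain i S T where p: "i \<le> k" "p = (S, T)" "S \<in> skeleton (Sub_cells r) i" "T \<in> skeleton (Sub_cells s) (k - i)"
    unfolding skeleton_product_cells by blast
  have S: "finite S" "S \<noteq> {}" "card S \<le> r" "S \<subseteq> topspace X" "card (all_jumps S) \<le> Suc i"
    using p(3) unfolding skeleton_Sub[OF assms(1)] by simp_all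
  have T: "finite T" "T \<noteq> {}" "card T \<le> s" "T \<subseteq> topspace X" "card (all_jumps T) \<le> Suc (k - i)"
    using p(4) unfolding skeleton_Sub[OF assms(2)] by simp_all
  have "card (all_jumps (S \<union> T)) \<le> Suc (i + (k - i))"
    using S T by (intro card_all_jumps_Un) simp_all
  moreover have "1 \<le> r + s" using assms by simp
  moreover have "card (S \<union> T) \<le> r + s" using card_Un_le[of S T] S(3) T(3) by simp
  ultimately show "(case p of (S, T) \<Rightarrow> S \<union> T) \<in> skeleton (Sub_cells (r + s)) k"
    using S T p(1,2) by (simp add: skeleton_Sub)
qed

lemma cellular_unordered:
  assumes "1 \<le> n"
  shows "cellular_map (cartesian_power n X) (power_cells n) (SP n X) (SP_cells n) (unordered n)"
  unfolding cellular_map_def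
proof (intro conjI allI image_subsetI)
  show "continuous_map (cartesian_power n X) (SP n X) (unordered n)"
    by (rule quotient_imp_continuous_map[OF quotient_map_SP])
  fix k x assume "x \<in> skeleton (power_cells n) k"
  then have x: "x \<in> topspace (cartesian_power n X)" "card (all_jumps (x ` {..<n})) \<le> Suc k"
    unfolding skeleton_power[OF assms] by blast+
  have "unordered n x \<in> topspace (SP n X)"
    using imageI[OF x(1), of "unordered n"] unfolding image_unordered topspace_SP .
  then show "unordered n x \<in> skeleton (SP_cells n) k"
    unfolding skeleton_SP[OF assms] using x(2) by (simp add: set_mset_unordered del: topspace_SP)
qed

lemma SP_to_Sub: "1 \<le> n \<Longrightarrow> A \<in> topspace (SP n X) \<Longrightarrow> set_mset A \<in> topspace (Sub n X)"
  using continuous_map_set_mset[of n X] by (auto simp: continuous_map_def)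

lemma set_mset_skeleton:
  assumes "1 \<le> n" "A \<in> skeleton (SP_cells n) k" shows "set_mset A \<in> skeleton (Sub_cells n) k"
  using assms(2) SP_to_Sub[OF assms(1)] unfolding skeleton_SP[OF assms(1)] skeleton_Sub[OF assms(1)] by blast

lemma cellular_set_mset:
  assumes "1 \<le> n"
  shows "cellular_map (SP n X) (SP_cells n) (Sub n X) (Sub_cells n) set_mset"
  unfolding cellular_map_def
  using continuous_map_set_mset[OF assms] set_mset_skeleton[OF assms] by blast

lemma cellular_map_prod_set_mset:
  assumes "1 \<le> r" "1 \<le> s"
  shows "cellular_map (k_prod_topology (SP r X) (SP s X)) (product_cells (SP_cells r) (SP_cells s))
          (k_prod_topology (Sub r X) (Sub s X)) (product_cells (Sub_cells r) (Sub_cells s))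
          (map_prod set_mset set_mset)"
  unfolding cellular_map_def
proof (intro conjI allI image_subsetI)
  show "continuous_map (k_prod_topology (SP r X) (SP s X)) (k_prod_topology (Sub r X) (Sub s X))
      (map_prod set_mset set_mset)"
    using assms by (intro continuous_map_k_prod_map_prod continuous_map_set_mset)
  fix k p assume "p \<in> skeleton (product_cells (SP_cells r) (SP_cells s)) k"
  then obtain i A B where p: "i \<le> k" "p = (A, B)" "A \<in> skeleton (SP_cells r) i" "B \<in> skeleton (SP_cells s) (k - i)"
    unfolding skeleton_product_cells by blast
  have "set_mset A \<in> skeleton (Sub_cells r) i" "set_mset B \<in> skeleton (Sub_cells s) (k - i)"
    using set_mset_skeleton[OF assms(1) p(3)] set_mset_skeleton[OF assms(2) p(4)] .
  then show "map_prod set_mset set_mset p \<in> skeleton (product_cells (Sub_cells r) (Sub_cells s)) k"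
    unfolding skeleton_product_cells using p(1,2) by (intro UN_I[of i]) simp_all
qed

lemma decomposition_power: "1 \<le> n \<Longrightarrow> cell_decomposition (cartesian_power n X) (power_cells n)"
  unfolding power_cells_def by (rule tuple_quotient.cell_decomposition_cells[OF tuple_quotient_power])

lemma decomposition_SP: "1 \<le> n \<Longrightarrow> cell_decomposition (SP n X) (SP_cells n)"
  unfolding SP_cells_def by (rule tuple_quotient.cell_decomposition_cells[OF tuple_quotient_SP])

lemma decomposition_Sub: "1 \<le> n \<Longrightarrow> cell_decomposition (Sub n X) (Sub_cells n)"
  unfolding Sub_cells_def by (rule tuple_quotient.cell_decomposition_cells[OF tuple_quotient_Sub])

end

section \<open>Geometric realizations and the star subdivision at the basepoint\<close>

lemma ex_vertex_order: "\<exists>le :: 'w \<Rightarrow> 'w \<Rightarrow> bool. vertex_order le"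
proof -
  from well_ordering[where 'a = 'w] obtain r :: "'w rel" where r: "Well_order r" "Field r = UNIV"
    by (elim exE conjE) (rule that)
  have refl: "refl_on UNIV r" and "trans r" and antisym: "antisym r" and total: "total_on UNIV r"
    using r by (simp_all add: well_order_on_def linear_order_on_def partial_order_on_def preorder_on_def)
  have "vertex_order (\<lambda>u v. (u, v) \<in> r)"
  proof
    fix u v w
    show "(u, v) \<in> r \<or> (v, u) \<in> r"
      using refl_onD[OF refl, of u] total unfolding total_on_def by (cases "u = v") simp_all
    show "u = v" if "(u, v) \<in> r" "(v, u) \<in> r"
      using antisymD[OF antisym that] .
    show "(u, w) \<in> r" if "(u, v) \<in> r" "(v, w) \<in> r"
      using transD[OF \<open>trans r\<close> that] .
  qed
  then show ?thesis by (rule exI[of vertex_order])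
qed

lemma continuous_map_face_realization:
  assumes "\<sigma> \<in> K"
  shows "continuous_map (subtopology (powertop_real UNIV) (closed_face \<sigma>)) (geometric_realization K) (\<lambda>x. x)"
  unfolding continuous_map_def
proof (intro conjI allI impI)
  show "(\<lambda>x. x) \<in> topspace (subtopology (powertop_real UNIV) (closed_face \<sigma>)) \<rightarrow> topspace (geometric_realization K)"
    using assms by auto
  fix U assume "openin (geometric_realization K) U"
  then have "openin (subtopology (powertop_real UNIV) (closed_face \<sigma>)) (closed_face \<sigma> \<inter> U)"
    using assms by (simp add: openin_geometric_realization)
  moreover have "{x \<in> topspace (subtopology (powertop_real UNIV) (closed_face \<sigma>)). x \<in> U} = closed_face \<sigma> \<inter> U"
    by auto
  ultimately show "openin (subtopology (powertop_real UNIV) (closed_face \<sigma>))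
      {x \<in> topspace (subtopology (powertop_real UNIV) (closed_face \<sigma>)). x \<in> U}" by simp
qed

lemma continuous_map_realization_coord:
  "continuous_map (geometric_realization K) euclideanreal (\<lambda>x. x v)"
proof -
  have "continuous_map (geometric_realization K) (powertop_real UNIV) (\<lambda>x. x)"
    unfolding continuous_map_def
  proof (intro conjI allI impI)
    fix U :: "('a \<Rightarrow> real) set" assume U: "openin (powertop_real UNIV) U"
    have "closed_face \<sigma> \<inter> {x \<in> topspace (geometric_realization K). x \<in> U} = U \<inter> closed_face \<sigma>" if "\<sigma> \<in> K" for \<sigma>
      using that by auto
    then show "openin (geometric_realization K) {x \<in> topspace (geometric_realization K). x \<in> U}"
      unfolding openin_geometric_realization using U by (auto simp: openin_subtopology_Int)
  qed simp
  then show ?thesis by (simp add: continuous_map_componentwise_UNIV)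
qed

lemma closedin_realizationI:
  assumes "A \<subseteq> topspace (geometric_realization K)"
    and "\<And>\<sigma>. \<sigma> \<in> K \<Longrightarrow> closedin (subtopology (powertop_real UNIV) (closed_face \<sigma>)) (closed_face \<sigma> \<inter> A)"
  shows "closedin (geometric_realization K) A"
  unfolding closedin_def openin_geometric_realization
proof (intro conjI ballI)
  fix \<sigma> assume \<sigma>: "\<sigma> \<in> K"
  have "closed_face \<sigma> \<inter> (topspace (geometric_realization K) - A) = closed_face \<sigma> - closed_face \<sigma> \<inter> A"
    using \<sigma> by auto
  moreover have "openin (subtopology (powertop_real UNIV) (closed_face \<sigma>)) (closed_face \<sigma> - closed_face \<sigma> \<inter> A)"
    using assms(2)[OF \<sigma>] by (simp add: closedin_def)
  ultimately show "openin (subtopology (powertop_real UNIV) (closed_face \<sigma>))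
      (closed_face \<sigma> \<inter> (topspace (geometric_realization K) - A))" by simp
qed (use assms(1) in auto)

lemma separated_realization:
  assumes "x \<noteq> y" shows "\<exists>f. continuous_map (geometric_realization K) euclideanreal f \<and> f x \<noteq> f y"
proof -
  obtain v where "x v \<noteq> y v" using assms by auto
  then show ?thesis using continuous_map_realization_coord[of K v] by (intro exI[of _ "\<lambda>x. x v"]) simp
qed

lemma closed_face_support: "x \<in> closed_face \<sigma> \<Longrightarrow> {v. x v \<noteq> 0} \<subseteq> \<sigma>"
  by (auto simp: closed_face_def)

lemma in_face_support:
  assumes "x \<in> closed_face \<sigma>" "finite \<sigma>"
  shows "x \<in> closed_face {v. x v \<noteq> 0}" "{v. x v \<noteq> 0} \<noteq> {}"
proof -
  have "sum x {v. x v \<noteq> 0} = sum x \<sigma>"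
    using closed_face_support[OF assms(1)] assms(2) by (intro sum.mono_neutral_left) auto
  then show x: "x \<in> closed_face {v. x v \<noteq> 0}" using assms(1) by (simp add: closed_face_def)
  show "{v. x v \<noteq> 0} \<noteq> {}"
  proof
    assume "{v. x v \<noteq> 0} = {}"
    with x show False by (simp add: closed_face_def)
  qed
qed

lemma abstract_complexD:
  assumes "abstract_complex K" "\<sigma> \<in> K"
  shows "finite \<sigma>" "\<sigma> \<noteq> {}" "\<And>\<tau>. \<tau> \<subseteq> \<sigma> \<Longrightarrow> \<tau> \<noteq> {} \<Longrightarrow> \<tau> \<in> K"
  using bspec[OF assms(1)[unfolded abstract_complex_def] assms(2)] by blast+

text \<open>Supports are the labels: a closed simplex contains points of only finitely many supports.\<close>

lemma compactin_realization:
  assumes K: "abstract_complex K" and C: "compactin (geometric_realization K) C"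
  shows "\<exists>M. finite M \<and> (\<forall>x\<in>C. {v. x v \<noteq> 0} \<subseteq> M)"
proof -
  let ?supp = "\<lambda>x :: 'a \<Rightarrow> real. {v. x v \<noteq> 0}"
  note fin = abstract_complexD(1)[OF K]
  have "finite (?supp ` C)"
  proof (rule compactin_finite_labels[OF _ C])
    show "t1_space (geometric_realization K)"
      by (intro Hausdorff_imp_t1_space Hausdorff_space_functions separated_realization)
    fix c assume "c \<in> closed_face ` K"
    then obtain \<sigma> where \<sigma>: "\<sigma> \<in> K" "c = closed_face \<sigma>" by blast
    have "?supp ` (c \<inter> topspace (geometric_realization K)) \<subseteq> Pow \<sigma>"
      using closed_face_support \<sigma>(2) by blast
    then show "finite (?supp ` (c \<inter> topspace (geometric_realization K)))"
      using fin[OF \<sigma>(1)] by (meson finite_Pow_iff finite_subset)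
  next
    fix A assume A: "A \<subseteq> topspace (geometric_realization K)"
      and cl: "\<And>c. c \<in> closed_face ` K \<Longrightarrow> closedin (geometric_realization K) (A \<inter> c)"
    show "closedin (geometric_realization K) A"
    proof (rule closedin_realizationI[OF A])
      fix \<sigma> assume \<sigma>: "\<sigma> \<in> K"
      have "closedin (geometric_realization K) (A \<inter> closed_face \<sigma>)" using cl \<sigma> by simp
      from closedin_continuous_map_preimage[OF continuous_map_face_realization[OF \<sigma>] this]
      show "closedin (subtopology (powertop_real UNIV) (closed_face \<sigma>)) (closed_face \<sigma> \<inter> A)"
        by (rule back_subst[of "closedin _"]) auto
    qed
  qed
  moreover have "finite (?supp x)" if "x \<in> C" for x
  proof -
    have "x \<in> topspace (geometric_realization K)" using that compactin_subset_topspace[OF C] by blast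
    then obtain \<sigma> where \<sigma>: "\<sigma> \<in> K" "x \<in> closed_face \<sigma>" by auto
    show ?thesis by (rule finite_subset[OF closed_face_support[OF \<sigma>(2)] fin[OF \<sigma>(1)]])
  qed
  ultimately have "finite (\<Union>(?supp ` C))" by blast
  then show ?thesis by (intro exI[of _ "\<Union>(?supp ` C)"]) blast
qed

text \<open>The new vertex \<open>None\<close> is placed in the interior of \<open>\<sigma>0\<close>. A simplex of the subdivision does not contain all of \<open>\<sigma>0\<close>,
  and it contains \<open>None\<close> only if its old vertices together with \<open>\<sigma>0\<close> span a simplex. If \<open>\<sigma>0\<close> is a
  single vertex, the subdivision just renames it to \<open>None\<close>.\<close>

definition star_subdivision :: "'v set set \<Rightarrow> 'v set \<Rightarrow> 'v option set set" where
  "star_subdivision K \<sigma>0 =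
     {\<tau>. Some -` \<tau> \<union> (if None \<in> \<tau> then \<sigma>0 else {}) \<in> K \<and> \<not> Some ` \<sigma>0 \<subseteq> \<tau>}"

definition star_map :: "('v \<Rightarrow> real) \<Rightarrow> ('v option \<Rightarrow> real) \<Rightarrow> 'v \<Rightarrow> real" where
  "star_map x0 y = (\<lambda>v. y (Some v) + y None * x0 v)"

lemma sum_option:
  fixes y :: "'v option \<Rightarrow> real"
  assumes "finite \<tau>" shows "sum y \<tau> = sum (\<lambda>v. y (Some v)) (Some -` \<tau>) + (if None \<in> \<tau> then y None else 0)"
proof -
  have \<tau>: "\<tau> = Some ` (Some -` \<tau>) \<union> (if None \<in> \<tau> then {None} else {})"
  proof (rule set_eqI)
    fix w show "w \<in> \<tau> \<longleftrightarrow> w \<in> Some ` (Some -` \<tau>) \<union> (if None \<in> \<tau> then {None} else {})"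
      by (cases w) auto
  qed
  have "finite (Some -` \<tau>)" by (rule finite_vimageI[OF assms]) simp
  then have "sum y (Some ` (Some -` \<tau>) \<union> (if None \<in> \<tau> then {None} else {})) =
      sum y (Some ` (Some -` \<tau>)) + sum y (if None \<in> \<tau> then {None} else {})"
    by (intro sum.union_disjoint finite_imageI) auto
  also have "sum y (Some ` (Some -` \<tau>)) = sum (\<lambda>v. y (Some v)) (Some -` \<tau>)"
    by (subst sum.reindex) (auto simp: comp_def)
  finally show ?thesis unfolding \<tau>[symmetric] by simp
qed

locale star_at_point =
  fixes K :: "'v set set" and \<sigma>0 :: "'v set" and x0 :: "'v \<Rightarrow> real"
  assumes K: "abstract_complex K" and \<sigma>0: "\<sigma>0 \<in> K" and x0: "x0 \<in> closed_face \<sigma>0"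
    and pos: "v \<in> \<sigma>0 \<Longrightarrow> 0 < x0 v"
begin

abbreviation "L \<equiv> star_subdivision K \<sigma>0"

lemma finite_K: "\<sigma> \<in> K \<Longrightarrow> finite \<sigma>"
  by (rule abstract_complexD(1)[OF K])

lemma face_K: "\<sigma> \<in> K \<Longrightarrow> \<tau> \<subseteq> \<sigma> \<Longrightarrow> \<tau> \<noteq> {} \<Longrightarrow> \<tau> \<in> K"
  by (rule abstract_complexD(3)[OF K])

lemma x0_props: "0 \<le> x0 v" "v \<notin> \<sigma>0 \<Longrightarrow> x0 v = 0" "sum x0 \<sigma>0 = 1"
  using x0 by (auto simp: closed_face_def)

lemma finite_L:
  assumes "\<tau> \<in> L" shows "finite \<tau>"
proof -
  have "Some -` \<tau> \<union> (if None \<in> \<tau> then \<sigma>0 else {}) \<in> K"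
    using assms by (simp add: star_subdivision_def)
  from finite_K[OF this] have fin: "finite (Some -` \<tau>)" by (rule rev_finite_subset) simp
  have sub: "\<tau> \<subseteq> insert None (Some ` (Some -` \<tau>))"
  proof
    fix w assume "w \<in> \<tau>"
    then show "w \<in> insert None (Some ` (Some -` \<tau>))" by (cases w) auto
  qed
  show ?thesis
    by (rule finite_subset[OF sub]) (intro finite.insertI finite_imageI fin)
qed

lemma star_map_face:
  assumes \<tau>: "\<tau> \<in> L" and y: "y \<in> closed_face \<tau>"
  shows "star_map x0 y \<in> closed_face (Some -` \<tau> \<union> (if None \<in> \<tau> then \<sigma>0 else {}))" (is "_ \<in> closed_face ?\<sigma>")
proof -
  have fin: "finite ?\<sigma>" by (rule finite_K) (use \<tau> in \<open>simp add: star_subdivision_def\<close>)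
  have nonneg: "0 \<le> y w" and zero: "w \<notin> \<tau> \<Longrightarrow> y w = 0" and total: "sum y \<tau> = 1" for w
    using y by (auto simp: closed_face_def)
  have "sum (star_map x0 y) ?\<sigma> = sum (\<lambda>v. y (Some v)) ?\<sigma> + y None * sum x0 ?\<sigma>"
    by (simp add: star_map_def sum.distrib sum_distrib_left)
  also have "sum (\<lambda>v. y (Some v)) ?\<sigma> = sum (\<lambda>v. y (Some v)) (Some -` \<tau>)"
    using fin zero by (intro sum.mono_neutral_right) auto
  also have "y None * sum x0 ?\<sigma> = (if None \<in> \<tau> then y None else 0)"
  proof (cases "None \<in> \<tau>")
    case True
    have "sum x0 ?\<sigma> = sum x0 \<sigma>0" using fin True x0_props(2) by (intro sum.mono_neutral_right) auto
    then show ?thesis using True x0_props(3) by simp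
  qed (simp add: zero)
  also have "sum (\<lambda>v. y (Some v)) (Some -` \<tau>) + (if None \<in> \<tau> then y None else 0) = 1"
    using sum_option[OF finite_L[OF \<tau>], of y] total by simp
  finally show ?thesis
    using nonneg zero x0_props(1,2) by (auto simp: closed_face_def star_map_def)
qed

text \<open>The coefficient of the new vertex is recovered as the least quotient \<open>x u / x0 u\<close> over the vertices \<open>u\<close> of \<open>\<sigma>0\<close>, where \<open>x\<close> is the image: some
  such vertex is missing from the simplex, and there the quotient equals this coefficient.\<close>

lemma star_map_inj: "inj_on (star_map x0) (\<Union>\<tau>\<in>L. closed_face \<tau>)"
proof (rule inj_onI)
  fix y y' assume y: "y \<in> (\<Union>\<tau>\<in>L. closed_face \<tau>)" and y': "y' \<in> (\<Union>\<tau>\<in>L. closed_face \<tau>)"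
    and eq: "star_map x0 y = star_map x0 y'"
  have le: "y' None \<le> y None"
    if y: "y \<in> (\<Union>\<tau>\<in>L. closed_face \<tau>)" and y': "y' \<in> (\<Union>\<tau>\<in>L. closed_face \<tau>)"
      and eq: "star_map x0 y = star_map x0 y'" for y y'
  proof -
    obtain \<tau> where \<tau>: "\<tau> \<in> L" "y \<in> closed_face \<tau>" using y by blast
    then obtain u where u: "u \<in> \<sigma>0" "Some u \<notin> \<tau>" by (auto simp: star_subdivision_def)
    have "y (Some u) = 0" using \<tau>(2) u(2) by (simp add: closed_face_def)
    moreover have "0 \<le> y' (Some u)" using y' by (auto simp: closed_face_def)
    moreover have "y (Some u) + y None * x0 u = y' (Some u) + y' None * x0 u"
      using fun_cong[OF eq, of u] by (simp add: star_map_def)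
    ultimately have "y' None * x0 u \<le> y None * x0 u" by linarith
    then show ?thesis using pos[OF u(1)] by simp
  qed
  have None: "y None = y' None" using le[OF y y' eq] le[OF y' y eq[symmetric]] by simp
  show "y = y'"
  proof
    fix w show "y w = y' w"
    proof (cases w)
      case (Some v)
      then show ?thesis using fun_cong[OF eq, of v] None by (simp add: star_map_def)
    qed (use None in simp)
  qed
qed

text \<open>Subtract from \<open>x\<close> the largest multiple \<open>t\<close> of the new vertex that leaves all coordinates nonnegative; a
  vertex of \<open>\<sigma>0\<close> where the bound is attained disappears from the support.\<close>

lemma star_map_onto:
  assumes \<sigma>: "\<sigma> \<in> K" and x: "x \<in> closed_face \<sigma>"
  shows "\<exists>\<tau>\<in>L. \<tau> \<subseteq> insert None (Some ` \<sigma>) \<and> x \<in> star_map x0 ` closed_face \<tau>"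
proof -
  define t where "t = Min ((\<lambda>u. x u / x0 u) ` \<sigma>0)"
  have ne: "\<sigma>0 \<noteq> {}" by (rule abstract_complexD(2)[OF K \<sigma>0])
  have xs: "0 \<le> x v" "v \<notin> \<sigma> \<Longrightarrow> x v = 0" "sum x \<sigma> = 1" for v using x by (auto simp: closed_face_def)
  have "t \<in> (\<lambda>u. x u / x0 u) ` \<sigma>0" unfolding t_def using ne finite_K[OF \<sigma>0] by (intro Min_in) auto
  then obtain u where u: "u \<in> \<sigma>0" "t = x u / x0 u" by blast
  have t0: "0 \<le> t" using u xs(1) x0_props(1) by simp
  have le: "t * x0 v \<le> x v" for v
  proof (cases "v \<in> \<sigma>0")
    case True
    then have "t \<le> x v / x0 v" unfolding t_def using finite_K[OF \<sigma>0] by (intro Min_le) auto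
    then show ?thesis using pos[OF True] by (simp add: pos_le_divide_eq)
  qed (use x0_props(2) xs(1) in simp)
  define y where "y w = (case w of None \<Rightarrow> t | Some v \<Rightarrow> x v - t * x0 v)" for w
  \<comment> \<open>if the new vertex is used at all, then \<open>\<sigma>0\<close> is a face of \<open>\<sigma>\<close>\<close>
  have sub: "\<sigma>0 \<subseteq> \<sigma>" if "t \<noteq> 0"
  proof
    fix v assume v: "v \<in> \<sigma>0"
    have "0 < t * x0 v" using that t0 pos[OF v] by simp
    then show "v \<in> \<sigma>" using le[of v] xs(2)[of v] by (cases "v \<in> \<sigma>") auto
  qed
  define \<tau> where "\<tau> = {w. y w \<noteq> 0}"
  have Some_sub: "Some -` \<tau> \<subseteq> \<sigma>"
  proof
    fix v assume v: "v \<in> Some -` \<tau>"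
    show "v \<in> \<sigma>"
    proof (rule ccontr)
      assume "v \<notin> \<sigma>"
      then have "x v = 0" using xs(2) by simp
      moreover have "t * x0 v = 0" using le[of v] t0 x0_props(1)[of v] \<open>x v = 0\<close>
        by (simp add: mult_le_0_iff) linarith
      ultimately show False using v by (simp add: \<tau>_def y_def)
    qed
  qed
  have None: "None \<in> \<tau> \<longleftrightarrow> t \<noteq> 0" by (simp add: \<tau>_def y_def)
  have "Some -` \<tau> \<union> (if None \<in> \<tau> then \<sigma>0 else {}) \<in> K"
  proof (rule face_K[OF \<sigma>])
    show "Some -` \<tau> \<union> (if None \<in> \<tau> then \<sigma>0 else {}) \<subseteq> \<sigma>" using Some_sub sub None by simp
    show "Some -` \<tau> \<union> (if None \<in> \<tau> then \<sigma>0 else {}) \<noteq> {}"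
    proof (cases "t = 0")
      case True
      then have "Some -` \<tau> = {v. x v \<noteq> 0}" by (simp add: \<tau>_def y_def vimage_def)
      then show ?thesis using in_face_support(2)[OF x finite_K[OF \<sigma>]] by simp
    qed (use ne None in simp)
  qed
  moreover have "Some u \<notin> \<tau>" using u(2) pos[OF u(1)] by (simp add: \<tau>_def y_def)
  ultimately have \<tau>L: "\<tau> \<in> L" using u(1) by (auto simp: star_subdivision_def)
  have "sum y \<tau> = sum (\<lambda>v. x v - t * x0 v) (Some -` \<tau>) + t"
    using sum_option[OF finite_L[OF \<tau>L], of y] None by (simp add: y_def)
  also have "sum (\<lambda>v. x v - t * x0 v) (Some -` \<tau>) = sum (\<lambda>v. x v - t * x0 v) \<sigma>"
    by (intro sum.mono_neutral_left) (use finite_K[OF \<sigma>] Some_sub in \<open>auto simp: \<tau>_def y_def\<close>)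
  also have "\<dots> = 1 - t * sum x0 \<sigma>" using xs(3) by (simp add: sum_subtractf sum_distrib_left)
  also have "t * sum x0 \<sigma> = t"
  proof (cases "t = 0")
    case False
    have "sum x0 \<sigma> = sum x0 \<sigma>0"
      using finite_K[OF \<sigma>] sub[OF False] x0_props(2) by (intro sum.mono_neutral_right) auto
    then show ?thesis using x0_props(3) by simp
  qed simp
  finally have "sum y \<tau> = 1" by simp
  moreover have "0 \<le> y w" for w using t0 le by (simp add: y_def split: option.split)
  ultimately have y: "y \<in> closed_face \<tau>" by (auto simp: closed_face_def \<tau>_def)
  have x_eq: "x = star_map x0 y" by (auto simp: star_map_def y_def)
  have \<tau>_sub: "\<tau> \<subseteq> insert None (Some ` \<sigma>)"
  proof
    fix w assume "w \<in> \<tau>"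
    then show "w \<in> insert None (Some ` \<sigma>)" using Some_sub by (cases w) auto
  qed
  show ?thesis by (rule bexI[OF _ \<tau>L], rule conjI[OF \<tau>_sub], rule image_eqI[where f = "star_map x0" and x = y, OF x_eq y])
qed

lemma triangulated_star:
  assumes "vertex_order le"
  shows "triangulated_space le (geometric_realization K) L (star_map x0)"
proof -
  interpret vertex_order le by (rule assms)
  show ?thesis
  proof unfold_locales
    show "finite \<tau>" if "\<tau> \<in> L" for \<tau> using that by (rule finite_L)
    show "bij_betw (star_map x0) (\<Union>\<tau>\<in>L. closed_face \<tau>) (topspace (geometric_realization K))"
      unfolding bij_betw_def
    proof (intro conjI star_map_inj equalityI)
      show "star_map x0 ` (\<Union>\<tau>\<in>L. closed_face \<tau>) \<subseteq> topspace (geometric_realization K)"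
      proof (rule image_subsetI)
        fix y assume "y \<in> (\<Union>\<tau>\<in>L. closed_face \<tau>)"
        then obtain \<tau> where \<tau>: "\<tau> \<in> L" "y \<in> closed_face \<tau>" by blast
        have "Some -` \<tau> \<union> (if None \<in> \<tau> then \<sigma>0 else {}) \<in> K" using \<tau>(1) by (simp add: star_subdivision_def)
        then show "star_map x0 y \<in> topspace (geometric_realization K)"
          using star_map_face[OF \<tau>] unfolding topspace_geometric_realization by (rule UN_I)
      qed
      show "topspace (geometric_realization K) \<subseteq> star_map x0 ` (\<Union>\<tau>\<in>L. closed_face \<tau>)"
      proof
        fix x assume "x \<in> topspace (geometric_realization K)"
        then obtain \<sigma> where "\<sigma> \<in> K" "x \<in> closed_face \<sigma>" by auto
        from star_map_onto[OF this] show "x \<in> star_map x0 ` (\<Union>\<tau>\<in>L. closed_face \<tau>)" by blast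
      qed
    qed
    show "continuous_map (subtopology (powertop_real UNIV) (closed_face \<tau>)) (geometric_realization K) (star_map x0)"
      if \<tau>: "\<tau> \<in> L" for \<tau>
    proof -
      let ?\<sigma> = "Some -` \<tau> \<union> (if None \<in> \<tau> then \<sigma>0 else {})"
      have \<sigma>: "?\<sigma> \<in> K" using \<tau> by (simp add: star_subdivision_def)
      have "continuous_map (subtopology (powertop_real UNIV) (closed_face \<tau>)) (powertop_real UNIV) (star_map x0)"
        unfolding continuous_map_componentwise_UNIV star_map_def
        by (intro allI continuous_intros continuous_map_from_subtopology continuous_map_product_projection) auto
      then have "continuous_map (subtopology (powertop_real UNIV) (closed_face \<tau>))
          (subtopology (powertop_real UNIV) (closed_face ?\<sigma>)) (star_map x0)"
        using star_map_face[OF \<tau>] by (auto simp: continuous_map_in_subtopology)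
      from continuous_map_compose[OF this continuous_map_face_realization[OF \<sigma>]]
      show ?thesis by (simp add: comp_def)
    qed
    show "\<exists>M. finite M \<and> C \<subseteq> star_map x0 ` (\<Union>\<tau>\<in>{\<tau> \<in> L. \<tau> \<subseteq> M}. closed_face \<tau>)"
      if C: "compactin (geometric_realization K) C" for C
    proof -
      obtain M where M: "finite M" "\<forall>x\<in>C. {v. x v \<noteq> 0} \<subseteq> M" using compactin_realization[OF K C] by blast
      have "C \<subseteq> star_map x0 ` (\<Union>\<tau>\<in>{\<tau> \<in> L. \<tau> \<subseteq> insert None (Some ` M)}. closed_face \<tau>)"
      proof
        fix x assume x: "x \<in> C"
        then have "x \<in> topspace (geometric_realization K)" using compactin_subset_topspace[OF C] by blast
        then obtain \<sigma> where \<sigma>: "\<sigma> \<in> K" "x \<in> closed_face \<sigma>" by auto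
        note supp = in_face_support[OF \<sigma>(2) finite_K[OF \<sigma>(1)]]
        have "{v. x v \<noteq> 0} \<in> K" by (rule face_K[OF \<sigma>(1) closed_face_support[OF \<sigma>(2)] supp(2)])
        from star_map_onto[OF this supp(1)] obtain \<tau>
          where \<tau>: "\<tau> \<in> L" "\<tau> \<subseteq> insert None (Some ` {v. x v \<noteq> 0})" "x \<in> star_map x0 ` closed_face \<tau>"
          by blast
        have "\<tau> \<subseteq> insert None (Some ` M)" using \<tau>(2) M(2) x by blast
        then show "x \<in> star_map x0 ` (\<Union>\<tau>\<in>{\<tau> \<in> L. \<tau> \<subseteq> insert None (Some ` M)}. closed_face \<tau>)"
          using \<tau>(1,3) by blast
      qed
      then show ?thesis using M(1) by (intro exI[of _ "insert None (Some ` M)"]) simp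
    qed
    show "\<exists>f. continuous_map (geometric_realization K) euclideanreal f \<and> f x \<noteq> f y" if "x \<noteq> y" for x y
      using that by (rule separated_realization)
  qed
qed

lemma basepoint_vertex:
  "{None} \<in> L" "star_map x0 (\<lambda>w. if w = None then 1 else 0) = x0"
proof -
  have "\<sigma>0 \<noteq> {}" by (rule abstract_complexD(2)[OF K \<sigma>0])
  then show "{None} \<in> L" using \<sigma>0 by (auto simp: star_subdivision_def vimage_def)
qed (simp add: star_map_def)

end

theorem proposition3p1:
  fixes K :: "'v set set" and X :: "('v \<Rightarrow> real) topology" and x0 :: "'v \<Rightarrow> real"
  assumes "abstract_complex K"
    and "X = geometric_realization K"
    and "path_connected_space X"
    and "x0 \<in> topspace X"
  shows "\<exists>(CX :: nat \<Rightarrow> nat \<Rightarrow> (nat \<Rightarrow> 'v \<Rightarrow> real) set set)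
           (CSP :: nat \<Rightarrow> nat \<Rightarrow> ('v \<Rightarrow> real) multiset set set)
           (CSub :: nat \<Rightarrow> nat \<Rightarrow> ('v \<Rightarrow> real) set set set).
     (\<forall>n\<ge>1.
        cell_decomposition (cartesian_power n X) (CX n) \<and>
        cell_decomposition (SP n X) (CSP n) \<and>
        cell_decomposition (Sub n X) (CSub n) \<and>
        cellular_map (cartesian_power n X) (CX n) (SP n X) (CSP n) (unordered n) \<and>
        cellular_map (SP n X) (CSP n) (Sub n X) (CSub n) set_mset \<and>
        subcomplex (SP n X) (CSP n) (unordered n ` fat_diagonal n X) \<and>
        subcomplex (SP n X) (CSP n) (add_mset x0 ` topspace (SP (n - 1) X)) \<and>
        subcomplex (Sub n X) (CSub n) (topspace (Sub (n - 1) X))) \<and>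
     (\<forall>r\<ge>1. \<forall>s\<ge>1.
        cellular_map (k_prod_topology (SP r X) (SP s X)) (product_cells (CSP r) (CSP s))
          (SP (r + s) X) (CSP (r + s)) (\<lambda>(A, B). A + B) \<and>
        cellular_map (k_prod_topology (Sub r X) (Sub s X)) (product_cells (CSub r) (CSub s))
          (Sub (r + s) X) (CSub (r + s)) (\<lambda>(S, T). S \<union> T) \<and>
        cellular_map (k_prod_topology (SP r X) (SP s X)) (product_cells (CSP r) (CSP s))
          (k_prod_topology (Sub r X) (Sub s X)) (product_cells (CSub r) (CSub s))
          (map_prod set_mset set_mset) \<and>
        (\<forall>A\<in>topspace (SP r X). \<forall>B\<in>topspace (SP s X).
           set_mset (A + B) = set_mset A \<union> set_mset B))"
proof -
  obtain \<sigma> where \<sigma>: "\<sigma> \<in> K" "x0 \<in> closed_face \<sigma>" using assms(2,4) by auto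
  \<comment> \<open>the simplex whose interior contains the basepoint\<close>
  define \<sigma>0 where "\<sigma>0 = {v. x0 v \<noteq> 0}"
  have "finite \<sigma>" by (rule abstract_complexD(1)[OF assms(1) \<sigma>(1)])
  note supp = in_face_support[OF \<sigma>(2) this] closed_face_support[OF \<sigma>(2)]
  have "star_at_point K \<sigma>0 x0"
  proof
    show "abstract_complex K" by (rule assms(1))
    show "\<sigma>0 \<in> K" unfolding \<sigma>0_def by (rule abstract_complexD(3)[OF assms(1) \<sigma>(1) supp(3,2)])
    show "x0 \<in> closed_face \<sigma>0" unfolding \<sigma>0_def by (rule supp(1))
    show "0 < x0 v" if "v \<in> \<sigma>0" for v
      using that \<sigma>(2) by (auto simp: \<sigma>0_def closed_face_def less_le)
  qed
  then interpret star_at_point K \<sigma>0 x0 .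
  obtain le :: "'v option \<Rightarrow> 'v option \<Rightarrow> bool" where le: "vertex_order le"
    using ex_vertex_order by blast
  interpret triangulated_space le X L "star_map x0"
    unfolding assms(2) by (rule triangulated_star[OF le])
  show ?thesis
  proof (rule exI[of _ power_cells], rule exI[of _ SP_cells], rule exI[of _ Sub_cells], intro conjI allI impI ballI)
    fix n :: nat assume n: "1 \<le> n"
    show "subcomplex (SP n X) (SP_cells n) (add_mset x0 ` topspace (SP (n - 1) X))"
      by (rule subcomplex_basepoint[OF n basepoint_vertex(1), of None]) (simp_all add: basepoint_vertex(2) assms(4))
  qed (simp_all only: decomposition_power decomposition_SP decomposition_Sub cellular_unordered cellular_set_mset
      subcomplex_fat_diagonal subcomplex_Sub cellular_SP_plus cellular_Sub_Un cellular_map_prod_set_mset set_mset_union)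
qed

end
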